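(* Let $\pi$ be a private coin protocol with inputs $(X,Y)\sim\mathrm{P}_{XY}$ and with a bounded number of rounds. For every $0<\varepsilon<1$, $$\lim_{n\to\infty}\frac1n D_\varepsilon(\pi^n|\mathrm{P}_{XY}^n)=\mathtt{IC}(\pi).$$
   Context: All logarithms are to base 2. $X$ and $Y$ are random variables with values in finite sets $\mathcal{X},\mathcal{Y}$ and fixed joint distribution $\mathrm{P}_{XY}$. Party 1 observes $X$ and Party 2 observes $Y$. Interactive protocol. An interactive protocol uses shared public randomness $U$ and private randomness $U_{\mathcal{X}}$ (Party 1) and $U_{\mathcal{Y}}$ (Party 2), where $U,U_{\mathcal{X}},U_{\mathcal{Y}}$ are mutually independent and jointly independent of the inputs. Party 1 sends messages in odd rounds, Party 2 in even rounds. In round $i$ the communicating party sends a bit string $\Pi_i\in\{0,1\}^*$ determined by the previous messages $\Pi^{i-1}=(\Pi_1,\dots,\Pi_{i-1})$ and that party's observations ($(X,U_{\mathcal{X}},U)$ for Party 1, $(Y,U_{\mathcal{Y}},U)$ for Party 2). Each possible value of $\Pi_i$ is associated with a next state: "continue" (the other party sends the next message) or "stop" (the protocol ends). The set $\mathcal{C}_i$ of possible values of $\Pi_i$ and the associated next states are determined by a common function, i.e., by a random variable $V$ with $H(V|X,U_{\mathcal{X}},U,\Pi^{i-1})=H(V|Y,U_{\mathcal{Y}},U,\Pi^{i-1})=0$. The transcript $\Pi$ is the sequence of all messages. The length $|\pi|$ of a protocol $\pi$ is the maximum number of bits communicated in any execution. A private coin protocol is one with $U$ constant. Bounded number of rounds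 means that the number of rounds is at most some constant $d<\infty$ with probability 1. A random variable $F$ is recoverable by $\pi$ for Party 1 (Party 2) if $F$ is a function of $(X,U,U_{\mathcal{X}},\Pi)$ (of $(Y,U,U_{\mathcal{Y}},\Pi)$). Simulation. For a private coin protocol $\pi$ with transcript $\Pi$ and $0\le\varepsilon<1$, a protocol $\pi_{\mathrm{sim}}$ (public and private randomness allowed) is an $\varepsilon$-simulation of $\pi$ if there are $\Pi_{\mathcal{X}}$ and $\Pi_{\mathcal{Y}}$, recoverable by $\pi_{\mathrm{sim}}$ for Party 1 and Party 2 respectively, with $d_{\mathrm{var}}(\mathrm{P}_{\Pi\Pi XY},\mathrm{P}_{\Pi_{\mathcal{X}}\Pi_{\mathcal{Y}}XY})\le\varepsilon$, where $d_{\mathrm{var}}(\mathrm{P},\mathrm{Q})=\frac12\sum_x|\mathrm{P}(x)-\mathrm{Q}(x)|$ and $\mathrm{P}_{\Pi\Pi XY}$ is the law of $(\Pi,\Pi,X,Y)$. $D_\varepsilon(\pi|\mathrm{P}_{XY})$ is the minimum length of an $\varepsilon$-simulation of $\pi$ when the inputs have distribution $\mathrm{P}_{XY}$. Product protocol. $\mathrm{P}_{XY}^n$ is the law of $n$ i.i.d. copies $(X_i,Y_i)_{i=1}^n$ of $(X,Y)$; Party 1 observes $X^n$, Party 2 observes $Y^n$. $\pi^n$ denotes running $\pi$ on each coordinate $(X_i,Y_i)$ with independent private randomness, so its transcript $\Pi^n$ consists of $n$ transcripts and $(\Pi^n,X^n,Y^n)$ is $n$ i.i.d. copies of $(\Pi,X,Y)$.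 Information complexity. $\mathtt{IC}(\pi)=I(\Pi\wedge X|Y)+I(\Pi\wedge Y|X)$ (conditional mutual informations).
   Formalization: In the definition of D_ε, simulating protocols must have prefix-free sets C_i of possible messages (else silence and round number carry information for free and the claim fails, e.g. when Party 1 sends a uniform bit X), and their public and private randomness is taken real-valued. *)

theory Defs
  imports "HOL-Probability.Probability" "HOL-Library.Sublist"
begin

section \<open>Interactive protocols\<close>

type_synonym message = "bool list"
type_synonym transcript = "message list"

datatype next_state = Continue | Stop

text \<open>
  A party with input type \<^typ>\<open>'i\<close>, private randomness of type \<^typ>\<open>'r\<close> and access to public
  randomness of type \<^typ>\<open>'u\<close>.  From its view (input, private randomness, public randomness,
  previous messages), \<open>message_of\<close> gives the message it sends when it is its turn, while
  \<open>codebook_of\<close> is what it knows about the current round, whoever speaks: a partial map whose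
  domain is the set of possible values of the message and whose values are the associated next
  states.
\<close>

record ('i, 'r, 'u) party =
  private_rand :: "'r measure"
  message_of :: "'i \<Rightarrow> 'r \<Rightarrow> 'u \<Rightarrow> transcript \<Rightarrow> message"
  codebook_of :: "'i \<Rightarrow> 'r \<Rightarrow> 'u \<Rightarrow> transcript \<Rightarrow> (message \<rightharpoonup> next_state)"

record ('x, 'y, 'a, 'b, 'u) protocol =
  public_rand :: "'u measure"
  party1 :: "('x, 'a, 'u) party"
  party2 :: "('y, 'b, 'u) party"

text \<open>The outcomes are \<open>((x, y), u, a, b)\<close>: the inputs, the public randomness, and the private
  randomness of the two parties.\<close>

type_synonym ('x, 'y, 'a, 'b, 'u) outcome = "('x \<times> 'y) \<times> 'u \<times> 'a \<times> 'b"

definition execution_space ::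
    "('x \<times> 'y) pmf \<Rightarrow> ('x, 'y, 'a, 'b, 'u) protocol \<Rightarrow> ('x, 'y, 'a, 'b, 'u) outcome measure" where
  "execution_space P \<pi> = measure_pmf P \<Otimes>\<^sub>M (public_rand \<pi> \<Otimes>\<^sub>M
     (private_rand (party1 \<pi>) \<Otimes>\<^sub>M private_rand (party2 \<pi>)))"

definition input1 :: "('x, 'y, 'a, 'b, 'u) outcome \<Rightarrow> 'x" where
  "input1 = (\<lambda>((x, y), u, a, b). x)"

definition input2 :: "('x, 'y, 'a, 'b, 'u) outcome \<Rightarrow> 'y" where
  "input2 = (\<lambda>((x, y), u, a, b). y)"

fun codebook1 :: "('x, 'y, 'a, 'b, 'u) protocol \<Rightarrow> ('x, 'y, 'a, 'b, 'u) outcome \<Rightarrow> transcript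
    \<Rightarrow> (message \<rightharpoonup> next_state)" where
  "codebook1 \<pi> ((x, y), u, a, b) h = codebook_of (party1 \<pi>) x a u h"

fun codebook2 :: "('x, 'y, 'a, 'b, 'u) protocol \<Rightarrow> ('x, 'y, 'a, 'b, 'u) outcome \<Rightarrow> transcript
    \<Rightarrow> (message \<rightharpoonup> next_state)" where
  "codebook2 \<pi> ((x, y), u, a, b) h = codebook_of (party2 \<pi>) y b u h"

text \<open>After an even number of messages the next round is an odd one, in which Party 1 speaks.\<close>

fun sent_message :: "('x, 'y, 'a, 'b, 'u) protocol \<Rightarrow> ('x, 'y, 'a, 'b, 'u) outcome \<Rightarrow> transcript
    \<Rightarrow> message" where
  "sent_message \<pi> ((x, y), u, a, b) h =
     (if even (length h) then message_of (party1 \<pi>) x a u h else message_of (party2 \<pi>) y b u h)"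

text \<open>
  \<open>run \<pi> \<omega> i\<close> is the list of messages sent in the first \<open>i\<close> rounds, together with the state
  reached.  The choice of \<^const>\<open>codebook1\<close> for the next state is immaterial, since
  \<open>interactive_protocol\<close> below makes the two codebooks agree almost surely.
\<close>

primrec run :: "('x, 'y, 'a, 'b, 'u) protocol \<Rightarrow> ('x, 'y, 'a, 'b, 'u) outcome \<Rightarrow> nat
    \<Rightarrow> transcript \<times> next_state" where
  "run \<pi> \<omega> 0 = ([], Continue)"
| "run \<pi> \<omega> (Suc i) =
     (let (h, s) = run \<pi> \<omega> i; m = sent_message \<pi> \<omega> h in
      if s = Stop then (h, s)
      else (h @ [m], if codebook1 \<pi> \<omega> h m = Some Continue then Continue else Stop))"

definition terminates :: "('x, 'y, 'a, 'b, 'u) protocol \<Rightarrow> ('x, 'y, 'a, 'b, 'u) outcome \<Rightarrow> bool" where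
  "terminates \<pi> \<omega> \<longleftrightarrow> (\<exists>i. snd (run \<pi> \<omega> i) = Stop)"

text \<open>The value is irrelevant on non-terminating executions, which will have probability 0.\<close>

definition transcript_of :: "('x, 'y, 'a, 'b, 'u) protocol \<Rightarrow> ('x, 'y, 'a, 'b, 'u) outcome
    \<Rightarrow> transcript" where
  "transcript_of \<pi> \<omega> = fst (run \<pi> \<omega> (LEAST i. snd (run \<pi> \<omega> i) = Stop))"

definition measurable_party :: "'u measure \<Rightarrow> ('i, 'r, 'u) party \<Rightarrow> bool" where
  "measurable_party U p \<longleftrightarrow>
     (\<forall>x h. (\<lambda>(r, u). message_of p x r u h) \<in> private_rand p \<Otimes>\<^sub>M U \<rightarrow>\<^sub>M count_space UNIV) \<and>
     (\<forall>x h m. (\<lambda>(r, u). codebook_of p x r u h m) \<in> private_rand p \<Otimes>\<^sub>M U \<rightarrow>\<^sub>M count_space UNIV)"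

text \<open>
  The last condition says that, with probability 1, in every round that takes place the codebook is
  common to both parties, i.e. it is a function of the view of Party 1 and also a function of the
  view of Party 2, and that the message sent is one of its possible values.
\<close>

definition interactive_protocol :: "('x \<times> 'y) pmf \<Rightarrow> ('x, 'y, 'a, 'b, 'u) protocol \<Rightarrow> bool" where
  "interactive_protocol P \<pi> \<longleftrightarrow>
     prob_space (public_rand \<pi>) \<and>
     prob_space (private_rand (party1 \<pi>)) \<and>
     prob_space (private_rand (party2 \<pi>)) \<and>
     measurable_party (public_rand \<pi>) (party1 \<pi>) \<and>
     measurable_party (public_rand \<pi>) (party2 \<pi>) \<and>
     (AE \<omega> in execution_space P \<pi>. terminates \<pi> \<omega>) \<and>
     (AE \<omega> in execution_space P \<pi>. \<forall>i h. run \<pi> \<omega> i = (h, Continue) \<longrightarrow>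
        codebook1 \<pi> \<omega> h = codebook2 \<pi> \<omega> h \<and> sent_message \<pi> \<omega> h \<in> dom (codebook1 \<pi> \<omega> h))"

definition prefix_free_messages :: "('x \<times> 'y) pmf \<Rightarrow> ('x, 'y, 'a, 'b, 'u) protocol \<Rightarrow> bool" where
  "prefix_free_messages P \<pi> \<longleftrightarrow>
     (AE \<omega> in execution_space P \<pi>. \<forall>i h. run \<pi> \<omega> i = (h, Continue) \<longrightarrow>
        (\<forall>m\<in>dom (codebook1 \<pi> \<omega> h). \<forall>m'\<in>dom (codebook1 \<pi> \<omega> h). prefix m m' \<longrightarrow> m = m'))"

definition private_coin :: "('x, 'y, 'a, 'b, 'u) protocol \<Rightarrow> bool" where
  "private_coin \<pi> \<longleftrightarrow> (\<exists>c. AE u in public_rand \<pi>. u = c)"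

definition bounded_rounds :: "('x \<times> 'y) pmf \<Rightarrow> ('x, 'y, 'a, 'b, 'u) protocol \<Rightarrow> bool" where
  "bounded_rounds P \<pi> \<longleftrightarrow>
     (\<exists>d. AE \<omega> in execution_space P \<pi>. terminates \<pi> \<omega> \<and> length (transcript_of \<pi> \<omega>) \<le> d)"

text \<open>The executions over which the maximum is taken are those producing a transcript of positive
  probability; as there are countably many transcripts, the others form a null set, on which the
  parties need not even agree on the codebooks.\<close>

definition protocol_length :: "('x \<times> 'y) pmf \<Rightarrow> ('x, 'y, 'a, 'b, 'u) protocol \<Rightarrow> enat" where
  "protocol_length P \<pi> =
     (SUP \<tau>\<in>{\<tau>. \<P>(\<omega> in execution_space P \<pi>. transcript_of \<pi> \<omega> = \<tau>) > 0}.
        enat (\<Sum>m\<leftarrow>\<tau>. length m))"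

definition recoverable1 :: "('x \<times> 'y) pmf \<Rightarrow> ('x, 'y, 'a, 'b, 'u) protocol
    \<Rightarrow> (('x, 'y, 'a, 'b, 'u) outcome \<Rightarrow> 't) \<Rightarrow> bool" where
  "recoverable1 P \<pi> F \<longleftrightarrow>
     (\<exists>f. (\<forall>x \<tau>. (\<lambda>(a, u). f x a u \<tau>) \<in>
              private_rand (party1 \<pi>) \<Otimes>\<^sub>M public_rand \<pi> \<rightarrow>\<^sub>M count_space UNIV) \<and>
          (\<forall>((x, y), u, a, b)\<in>space (execution_space P \<pi>).
              F ((x, y), u, a, b) = f x a u (transcript_of \<pi> ((x, y), u, a, b))))"

definition recoverable2 :: "('x \<times> 'y) pmf \<Rightarrow> ('x, 'y, 'a, 'b, 'u) protocol
    \<Rightarrow> (('x, 'y, 'a, 'b, 'u) outcome \<Rightarrow> 't) \<Rightarrow> bool" where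
  "recoverable2 P \<pi> F \<longleftrightarrow>
     (\<exists>f. (\<forall>y \<tau>. (\<lambda>(b, u). f y b u \<tau>) \<in>
              private_rand (party2 \<pi>) \<Otimes>\<^sub>M public_rand \<pi> \<rightarrow>\<^sub>M count_space UNIV) \<and>
          (\<forall>((x, y), u, a, b)\<in>space (execution_space P \<pi>).
              F ((x, y), u, a, b) = f y b u (transcript_of \<pi> ((x, y), u, a, b))))"

definition cond_mutual_info :: "'w measure \<Rightarrow> ('w \<Rightarrow> 'c) \<Rightarrow> ('w \<Rightarrow> 'd) \<Rightarrow> ('w \<Rightarrow> 'e) \<Rightarrow> real" where
  "cond_mutual_info M A B C = prob_space.conditional_mutual_information M 2
     (count_space UNIV) (count_space UNIV) (count_space UNIV) A B C"

definition information_complexity :: "('x \<times> 'y) pmf \<Rightarrow> ('x, 'y, 'a, 'b, 'u) protocol \<Rightarrow> real" where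
  "information_complexity P \<pi> =
     cond_mutual_info (execution_space P \<pi>) (transcript_of \<pi>) input1 input2 +
     cond_mutual_info (execution_space P \<pi>) (transcript_of \<pi>) input2 input1"


section \<open>Product protocols\<close>

definition iid_inputs :: "nat \<Rightarrow> ('x \<times> 'y) pmf \<Rightarrow> ('x list \<times> 'y list) pmf" where
  "iid_inputs n P = map_pmf (\<lambda>zs. (map fst zs, map snd zs)) (replicate_pmf n P)"

text \<open>The joint law of \<open>(\<Pi>\<^sup>n, X\<^sup>n, Y\<^sup>n)\<close> when \<open>\<pi>\<close> is run on each of \<open>n\<close> coordinates with independent
  private randomness; \<open>u\<close> is constant for the private coin protocols this is meant for.\<close>

definition product_law :: "nat \<Rightarrow> ('x \<times> 'y) pmf \<Rightarrow> ('x, 'y, 'a, 'b, 'u) protocol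
    \<Rightarrow> (transcript list \<times> 'x list \<times> 'y list) measure" where
  "product_law n P \<pi> =
     distr (measure_pmf (iid_inputs n P) \<Otimes>\<^sub>M (public_rand \<pi> \<Otimes>\<^sub>M
              ((\<Pi>\<^sub>M i\<in>{..<n}. private_rand (party1 \<pi>)) \<Otimes>\<^sub>M
               (\<Pi>\<^sub>M i\<in>{..<n}. private_rand (party2 \<pi>)))))
       (count_space UNIV)
       (\<lambda>((xs, ys), u, a, b).
          (map (\<lambda>i. transcript_of \<pi> ((xs ! i, ys ! i), u, a i, b i)) [0..<n], xs, ys))"


section \<open>Simulation\<close>

definition d_var :: "'c measure \<Rightarrow> 'c measure \<Rightarrow> real" where
  "d_var M N = (\<Sum>\<^sub>\<infinity>x. \<bar>measure M {x} - measure N {x}\<bar>) / 2"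

text \<open>
  The simulated protocol enters only through the joint law \<open>Q\<close> of its transcript and the inputs,
  whose marginal law is \<open>P\<close>.

  The messages of a simulating protocol are required to be prefix-free.  Otherwise a party could
  convey information by the length of a message, in particular by silence (the empty message), and
  the number of transmitted bits would not measure communication: with enough rounds any message
  could be conveyed with a single bit, through the number of the round in which this bit is sent.
\<close>

definition is_simulation :: "real \<Rightarrow> ('x \<times> 'y) pmf \<Rightarrow> ('t \<times> 'x \<times> 'y) measure
    \<Rightarrow> ('x, 'y, 'a, 'b, 'u) protocol \<Rightarrow> bool" where
  "is_simulation \<epsilon> P Q \<sigma> \<longleftrightarrow>
     interactive_protocol P \<sigma> \<and> prefix_free_messages P \<sigma> \<and>
     (\<exists>F1 F2. recoverable1 P \<sigma> F1 \<and> recoverable2 P \<sigma> F2 \<and>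
        d_var (distr Q (count_space UNIV) (\<lambda>(\<tau>, x, y). (\<tau>, \<tau>, x, y)))
              (distr (execution_space P \<sigma>) (count_space UNIV)
                 (\<lambda>\<omega>. (F1 \<omega>, F2 \<omega>, input1 \<omega>, input2 \<omega>))) \<le> \<epsilon>)"

text \<open>
  The public and private randomness of the simulating protocols range over arbitrary probability
  spaces on the reals; as messages and inputs take countably many values, other probability spaces
  would not allow for more.  The infimum over a nonempty set of extended naturals is a minimum.
\<close>

definition simulation_cost :: "real \<Rightarrow> ('x \<times> 'y) pmf \<Rightarrow> ('t \<times> 'x \<times> 'y) measure \<Rightarrow> enat" where
  "simulation_cost \<epsilon> P Q =
     (INF \<sigma>\<in>{\<sigma> :: ('x, 'y, real, real, real) protocol. is_simulation \<epsilon> P Q \<sigma>}.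
        protocol_length P \<sigma>)"

end

theory Submission
  imports Defs "HOL-Real_Asymp.Real_Asymp"
begin

text \<open>
  Write \<open>Q\<close> for the joint law of the transcript and the inputs, and
  \<open>ic(\<tau>, x, y) = log (Q(\<tau>|x,y) / Q(\<tau>|y)) + log (Q(\<tau>|x,y) / Q(\<tau>|x))\<close>, whose expectation is the
  information complexity and which concentrates around \<open>n IC\<close> for \<open>n\<close> independent copies.

  Lower bound. Fix all the randomness of a simulation with at most \<open>L\<close> bits; its transcript is
  \<open>s = s(x, y)\<close>, in which party \<open>i\<close> sends \<open>l\<^sub>i(s)\<close> bits. If \<open>ic(\<tau>, x, y) \<ge> l\<close>, then AM-GM gives
  \<open>P(x,y) \<le> 2\<^bsup>(L-l)/2\<^esup> (P(x) Q(y|x,\<tau>) 2\<^bsup>-l\<^sub>2(s)\<^esup> + P(y) Q(x|y,\<tau>) 2\<^bsup>-l\<^sub>1(s)\<^esup>) / 2\<close>.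
  Summed over the inputs for which both parties output the same \<open>\<tau>\<close>, each of the two terms contributes
  at most 1: for fixed \<open>x\<close> the output \<open>\<tau>\<close> is determined by \<open>s\<close>, and the messages received by party 1
  form a prefix code on the transcripts that it considers possible, so that Kraft's inequality
  applies. Hence a simulation outputs a common transcript with \<open>ic \<ge> l\<close> with probability at most
  \<open>2\<^bsup>(L-l)/2\<^esup>\<close>, which rules out rates below \<open>IC\<close> for every error less than 1.

  Upper bound. The simulation replaces each round of the product protocol by one message. The
  speaker knows the law \<open>w\<close> of the next state and the listener an estimate \<open>v\<close> of it. Both look at the
  same random ordering of the cells of a fine grid; the speaker selects the first cell below the
  graph of \<open>w\<close>, sends a hash of it, and the listener selects the first cell below the graph of
  \<open>2\<^sup>\<lambda> v\<close> with this hash. Slightly more than \<open>\<lambda>\<close> hash bits suffice when \<open>w \<le> 2\<^sup>\<lambda> v\<close>. As only the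
  speaker's input influences a round, \<open>log (w / v)\<close> is the increment of \<open>ic\<close> in that round, and the
  expected increments add up to \<open>IC\<close>.
\<close>

section \<open>Converse: counting transcripts\<close>

text \<open>Upper bound: \<open>d_var_le_overlap\<close> turns a lower bound on the probability that
  both parties follow the true path of states into a bound on the variation distance, so what
  happens after a decoding error is never analysed. As the seeds of the rounds are independent,
  success probabilities multiply along a path just as the transition probabilities of the protocol
  do. Beyond its main term, each round costs a number of extra bits and a relative loss that do not
  depend on \<open>n\<close>; there are \<open>d\<close> rounds for every \<open>n\<close>, and this
  is where the bounded number of rounds enters. Lower bound: a codebook may depend on the history
  and the randomness, and a message can be parsed only by somebody who knows it. Hence Kraft's
  inequality is applied in each party's view separately, and AM-GM merges the two bounds without
  knowing how the \<open>L\<close> bits are divided between the parties. Transcripts form an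
  infinite set, so the logarithmic densities may be unbounded. Their squares are still integrable
  because the input alphabets are finite: the likelihood ratio is bounded above, and its inverse,
  which controls the negative part of the logarithm, has expectation at most 1.\<close>

instance next_state :: countable
  by countable_datatype

section \<open>Kraft's inequality for the transcripts seen by one party\<close>

definition prefix_free :: "'a list set \<Rightarrow> bool" where
  "prefix_free C \<longleftrightarrow> (\<forall>c\<in>C. \<forall>c'\<in>C. prefix c c' \<longrightarrow> c = c')"

text \<open>Extending the codewords in all ways to a common length \<open>N\<close> gives disjoint
  sets of strings, since a common extension makes two codewords comparable. The extensions of
  \<open>c\<close> are a fraction \<open>(1/2) ^ length c\<close> of all strings of length
  \<open>N\<close>.\<close>

lemma kraft_inequality:
  fixes C :: "bool list set"
  assumes fin: "finite C" and pf: "prefix_free C"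
  shows "(\<Sum>c\<in>C. (1/2::real) ^ length c) \<le> 1"
proof -
  obtain N where N: "\<And>c. c \<in> C \<Longrightarrow> length c \<le> N"
    using fin by (metis finite_imageI finite_nat_set_iff_bounded_le image_eqI)
  define E where "E c = {xs :: bool list. length xs = N \<and> prefix c xs}" for c
  have Eimg: "E c = (\<lambda>ys. c @ ys) ` {ys. length ys = N - length c}" if "c \<in> C" for c
    using N[OF that] by (auto simp: E_def prefix_def)
  have cardlists: "card {ys :: bool list. length ys = n} = 2 ^ n" for n
    using card_lists_length_eq[of "UNIV :: bool set" n] by simp
  have finlists: "finite {ys :: bool list. length ys = n}" for n
    using finite_lists_length_eq[of "UNIV :: bool set" n] by simp
  have cardE: "card (E c) = 2 ^ (N - length c)" if "c \<in> C" for c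
    unfolding Eimg[OF that] by (subst card_image) (auto simp: inj_on_def cardlists)
  have disj: "E c \<inter> E c' = {}" if "c \<in> C" "c' \<in> C" "c \<noteq> c'" for c c'
  proof (rule ccontr)
    assume "E c \<inter> E c' \<noteq> {}"
    then obtain xs where "prefix c xs" "prefix c' xs" by (auto simp: E_def)
    then have "prefix c c' \<or> prefix c' c" by (metis prefix_same_cases)
    then show False using pf that by (auto simp: prefix_free_def)
  qed
  have "(\<Sum>c\<in>C. card (E c)) = card (\<Union>c\<in>C. E c)"
    using fin disj by (subst card_UN_disjoint) (auto simp: E_def intro: finite_subset[OF _ finlists[of N]])
  also have "\<dots> \<le> card {ys :: bool list. length ys = N}"
    by (rule card_mono[OF finlists]) (auto simp: E_def)
  finally have "(\<Sum>c\<in>C. card (E c)) \<le> 2 ^ N" by (simp add: cardlists)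
  then have "(\<Sum>c\<in>C. (2::nat) ^ (N - length c)) \<le> 2 ^ N"
    using cardE by simp
  then have "real (\<Sum>c\<in>C. 2 ^ (N - length c)) \<le> real (2 ^ N)"
    by (simp only: of_nat_le_iff)
  then have "(\<Sum>c\<in>C. (2::real) ^ (N - length c)) \<le> 2 ^ N"
    by simp
  moreover have "(\<Sum>c\<in>C. (2::real) ^ (N - length c)) = 2 ^ N * (\<Sum>c\<in>C. (1/2) ^ length c)"
    unfolding sum_distrib_left
    by (intro sum.cong refl) (use N in \<open>simp add: power_diff power_divide\<close>)
  ultimately show ?thesis by simp
qed

text \<open>Rounds are numbered from 0 here, so Party 1 speaks at even positions:
  \<open>bits_of odd\<close> counts the bits that Party 1 receives, \<open>bits_of even\<close>
  those that Party 2 receives.\<close>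

definition bits_of :: "(nat \<Rightarrow> bool) \<Rightarrow> transcript \<Rightarrow> nat" where
  "bits_of R s = (\<Sum>j | j < length s \<and> R j. length (s ! j))"

lemma bits_of_split: "bits_of R s + bits_of (\<lambda>j. \<not> R j) s = (\<Sum>m\<leftarrow>s. length m)"
proof -
  have "(\<Sum>m\<leftarrow>s. length m) = (\<Sum>j<length s. length (s ! j))"
    by (simp add: sum_list_sum_nth atLeast0LessThan)
  also have "\<dots> = (\<Sum>j\<in>{j. j < length s \<and> R j} \<union> {j. j < length s \<and> \<not> R j}. length (s ! j))"
    by (rule sum.cong) auto
  also have "\<dots> = bits_of R s + bits_of (\<lambda>j. \<not> R j) s"
    unfolding bits_of_def by (rule sum.union_disjoint) auto
  finally show ?thesis by simp
qed

text \<open>The message boundaries are lost on purpose, since Kraft's inequality concerns plain bit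
  strings; the codebooks in \<open>compatible\<close> recover them.\<close>

definition selected :: "(nat \<Rightarrow> bool) \<Rightarrow> transcript \<Rightarrow> bool list" where
  "selected R s = concat (map (\<lambda>j. if R j then s ! j else []) [0..<length s])"

lemma length_selected: "length (selected R s) = bits_of R s"
proof -
  have "length (selected R s) = (\<Sum>j<length s. if R j then length (s ! j) else 0)"
    by (simp add: selected_def length_concat comp_def if_distrib[of length] interv_sum_list_conv_sum_set_nat atLeast0LessThan cong: if_cong)
  also have "\<dots> = bits_of R s"
    unfolding bits_of_def by (subst sum.inter_filter[symmetric]) (auto intro: sum.cong)
  finally show ?thesis .
qed

text \<open>The transcripts \<open>s\<close> compatible with the view of a party that computes the messages of the rounds
  outside \<open>R\<close> by \<open>msg\<close> and receives those in \<open>R\<close>; \<open>cb\<close> are its codebooks.\<close>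

definition compatible :: "(nat \<Rightarrow> bool) \<Rightarrow> (transcript \<Rightarrow> message) \<Rightarrow>
    (transcript \<Rightarrow> message \<rightharpoonup> next_state) \<Rightarrow> transcript \<Rightarrow> bool" where
  "compatible R msg cb s \<longleftrightarrow> s \<noteq> [] \<and> (\<forall>j<length s.
     (\<not> R j \<longrightarrow> s ! j = msg (take j s)) \<and> s ! j \<in> dom (cb (take j s)) \<and>
     prefix_free (dom (cb (take j s))) \<and>
     (cb (take j s) (s ! j) = Some Continue \<longleftrightarrow> Suc j < length s))"

text \<open>A party parses the received bits along its own computation. After equal histories, its
  own messages agree because they are computed from the history, and the received ones agree because
  both are prefixes of one string and lie in one prefix-free codebook.\<close>

lemma compatible_prefix_selected:
  assumes s: "compatible R msg cb s" and t: "compatible R msg cb t"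
    and pre: "prefix (selected R s) (selected R t)"
  shows "s = t"
proof -
  \<comment> \<open>\<open>sel i u\<close> is what remains to be parsed of
    \<open>selected R u\<close> once the first \<open>i\<close> messages are known.\<close>
  define sel where "sel i u = concat (map (\<lambda>j. if R j then u ! j else []) [i..<length u])" for i and u :: transcript
  have sel_unfold: "sel i u = (if R i then u ! i else []) @ sel (Suc i) u" if "i < length u" for i u
    using that by (simp add: sel_def upt_conv_Cons)
  have "i \<le> length s \<Longrightarrow> i \<le> length t \<Longrightarrow> take i s = take i t \<and> prefix (sel i s) (sel i t)" for i
  proof (induction i)
    case 0
    then show ?case using pre by (simp add: sel_def selected_def)
  next
    case (Suc i)
    then have i: "i < length s" "i < length t" and eq: "take i s = take i t"
      and p: "prefix (sel i s) (sel i t)" by auto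
    have nth: "s ! i = t ! i"
    proof (cases "R i")
      case False
      then show ?thesis using s t i eq by (auto simp: compatible_def)
    next
      case True
      then have "prefix (s ! i @ sel (Suc i) s) (t ! i @ sel (Suc i) t)"
        using p i by (simp add: sel_unfold)
      then have "prefix (s ! i) (t ! i) \<or> prefix (t ! i) (s ! i)"
        by (meson append_prefixD prefix_same_cases prefixI)
      moreover have "s ! i \<in> dom (cb (take i s))" "t ! i \<in> dom (cb (take i s))"
        "prefix_free (dom (cb (take i s)))"
        using s t i eq by (auto simp: compatible_def)
      ultimately show ?thesis unfolding prefix_free_def by metis
    qed
    have "take (Suc i) s = take (Suc i) t" using eq nth i by (simp add: take_Suc_conv_app_nth)
    moreover have "prefix (sel (Suc i) s) (sel (Suc i) t)"
      using p nth i by (cases "R i") (simp_all add: sel_unfold)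
    ultimately show ?case by simp
  qed note ind = this
  \<comment> \<open>Neither transcript is a proper initial segment of the other: the next state
    after the last message of the shorter one is read off the same codebook in both.\<close>
  have "\<not> length s < length t" if s: "compatible R msg cb s" and t: "compatible R msg cb t"
    and eq: "take (min (length s) (length t)) s = take (min (length s) (length t)) t" for s t
  proof
    assume lt: "length s < length t"
    define j where "j = length s - 1"
    have ne: "s \<noteq> []" using s by (simp add: compatible_def)
    then have j: "j < length s" "Suc j = length s" by (auto simp: j_def)
    have st: "s = take (length s) t" using eq lt by simp
    have "take j s = take j t" "s ! j = t ! j"
      using arg_cong[OF st, of "take j"] arg_cong[OF st, of "\<lambda>u. u ! j"] j by simp_all
    then have "(cb (take j s) (s ! j) = Some Continue) \<longleftrightarrow> Suc j < length t"
      using t j lt by (auto simp: compatible_def)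
    moreover have "(cb (take j s) (s ! j) = Some Continue) \<longleftrightarrow> Suc j < length s"
      using s j by (auto simp: compatible_def)
    ultimately show False using j lt by simp
  qed note nlt = this
  have "take (min (length s) (length t)) s = take (min (length s) (length t)) t"
    using ind[of "min (length s) (length t)"] by linarith
  then have len: "length s = length t" using nlt[OF s t] nlt[OF t s]
    by (metis min.commute linorder_neqE_nat)
  then show ?thesis using ind[of "length s"] by (metis order_refl take_all_iff)
qed

lemma kraft_transcripts:
  assumes "finite C" and comp: "\<And>s. s \<in> C \<Longrightarrow> compatible R msg cb s"
  shows "(\<Sum>s\<in>C. (1/2::real) ^ bits_of R s) \<le> 1"
proof -
  have inj: "inj_on (selected R) C"
    using compatible_prefix_selected[OF comp comp] by (auto simp: inj_on_def)
  have "(\<Sum>s\<in>C. (1/2::real) ^ bits_of R s) = (\<Sum>c\<in>selected R ` C. (1/2) ^ length c)"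
    using inj by (simp add: sum.reindex length_selected)
  also have "\<dots> \<le> 1"
    using assms(1) compatible_prefix_selected[OF comp comp]
    by (intro kraft_inequality) (auto simp: prefix_free_def)
  finally show ?thesis .
qed

section \<open>Summing over the inputs and merging the two views\<close>

lemma finite_proj:
  assumes "finite G"
  shows "finite (fst ` G)" "finite {y. (x, y) \<in> G}"
  using assms by (simp, intro finite_subset[OF _ finite_imageI[OF assms, of snd]]) force

text \<open>For fixed \<open>x\<close> the values of \<open>y\<close> are grouped by the transcript
  \<open>s = S x y\<close>. Within a group the output \<open>f x s\<close> is fixed, so the
  quotients are conditional probabilities of \<open>y\<close> and add up to at most 1; what remains
  is one weight per transcript. A vanishing \<open>qm\<close> is harmless, as the quotient is then
  0.\<close>

lemma sum_disintegrate_le_1: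
  fixes q :: "'t \<Rightarrow> 'x \<Rightarrow> 'y \<Rightarrow> real" and w :: "'s \<Rightarrow> real"
  assumes fin: "finite G"
    and q: "\<And>t x F. finite F \<Longrightarrow> (\<Sum>y\<in>F. q t x y) \<le> qm t x" "\<And>t x y. q t x y \<ge> 0"
    and p: "\<And>F. finite F \<Longrightarrow> (\<Sum>x\<in>F. p x) \<le> 1" "\<And>x. p x \<ge> 0"
    and w: "\<And>x. (\<Sum>s\<in>S x ` {y. (x, y) \<in> G}. w s) \<le> 1" "\<And>s. w s \<ge> 0"
  shows "(\<Sum>(x, y)\<in>G. p x * (q (f x (S x y)) x y / qm (f x (S x y)) x) * w (S x y)) \<le> 1"
proof -
  define X where "X = fst ` G"
  define Y where "Y x = {y. (x, y) \<in> G}" for x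
  have finX: "finite X" and finY: "\<And>x. finite (Y x)"
    using finite_proj[OF fin] by (auto simp: X_def Y_def)
  have G: "G = Sigma X Y" by (force simp: X_def Y_def)
  have inner: "(\<Sum>y\<in>Y x. (q (f x (S x y)) x y / qm (f x (S x y)) x) * w (S x y)) \<le> 1" for x
  proof -
    have "(\<Sum>y\<in>Y x. (q (f x (S x y)) x y / qm (f x (S x y)) x) * w (S x y))
        = (\<Sum>s\<in>S x ` Y x. \<Sum>y | y \<in> Y x \<and> S x y = s. (q (f x (S x y)) x y / qm (f x (S x y)) x) * w (S x y))"
      by (rule sum.image_gen[OF finY])
    also have "\<dots> = (\<Sum>s\<in>S x ` Y x. (\<Sum>y | y \<in> Y x \<and> S x y = s. q (f x s) x y) / qm (f x s) x * w s)"
      by (auto intro!: sum.cong simp: sum_divide_distrib sum_distrib_right)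
    also have "\<dots> \<le> (\<Sum>s\<in>S x ` Y x. 1 * w s)"
    proof (intro sum_mono mult_right_mono w)
      fix s
      have "(\<Sum>y | y \<in> Y x \<and> S x y = s. q (f x s) x y) \<le> qm (f x s) x"
        using finY by (intro q) simp
      moreover have "(\<Sum>y | y \<in> Y x \<and> S x y = s. q (f x s) x y) \<ge> 0"
        by (intro sum_nonneg q)
      ultimately show "(\<Sum>y | y \<in> Y x \<and> S x y = s. q (f x s) x y) / qm (f x s) x \<le> 1"
        by (auto simp: divide_le_eq_1)
    qed
    also have "\<dots> \<le> 1" using w by (simp add: Y_def)
    finally show ?thesis .
  qed
  have "(\<Sum>(x, y)\<in>G. p x * (q (f x (S x y)) x y / qm (f x (S x y)) x) * w (S x y))
      = (\<Sum>x\<in>X. p x * (\<Sum>y\<in>Y x. (q (f x (S x y)) x y / qm (f x (S x y)) x) * w (S x y)))"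
    unfolding G by (subst sum.Sigma[symmetric]) (auto simp: finX finY sum_distrib_left mult.assoc)
  also have "\<dots> \<le> (\<Sum>x\<in>X. p x * 1)"
    by (intro sum_mono mult_left_mono inner p)
  also have "\<dots> \<le> 1" using p finX by simp
  finally show ?thesis .
qed

lemma sum_pmf_marginal_le:
  assumes "finite F" "inj_on g F" "\<And>y. y \<in> F \<Longrightarrow> h (g y) = a"
  shows "(\<Sum>y\<in>F. pmf Q (g y)) \<le> pmf (map_pmf h Q) a"
proof -
  have "(\<Sum>y\<in>F. pmf Q (g y)) = (\<Sum>z\<in>g ` F. pmf Q z)"
    using assms by (simp add: sum.reindex)
  also have "\<dots> = measure Q (g ` F)"
    using assms by (simp add: measure_measure_pmf_finite)
  also have "\<dots> \<le> measure Q (h -` {a})"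
    using assms by (intro measure_pmf.finite_measure_mono) auto
  finally show ?thesis by (simp add: pmf_map)
qed

definition inputs_law :: "('t \<times> 'x \<times> 'y) pmf \<Rightarrow> ('x \<times> 'y) pmf" where
  "inputs_law Q = map_pmf snd Q"
definition law1 :: "('t \<times> 'x \<times> 'y) pmf \<Rightarrow> ('t \<times> 'x) pmf" where
  "law1 Q = map_pmf (\<lambda>(t, x, y). (t, x)) Q"
definition law2 :: "('t \<times> 'x \<times> 'y) pmf \<Rightarrow> ('t \<times> 'y) pmf" where
  "law2 Q = map_pmf (\<lambda>(t, x, y). (t, y)) Q"
definition in1 :: "('t \<times> 'x \<times> 'y) pmf \<Rightarrow> 'x pmf" where
  "in1 Q = map_pmf (\<lambda>(t, x, y). x) Q"
definition in2 :: "('t \<times> 'x \<times> 'y) pmf \<Rightarrow> 'y pmf" where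
  "in2 Q = map_pmf (\<lambda>(t, x, y). y) Q"

text \<open>The event that the information complexity density is at least \<open>l\<close>.\<close>

definition high_density :: "real \<Rightarrow> ('t \<times> 'x \<times> 'y) pmf \<Rightarrow> ('t \<times> 'x \<times> 'y) set" where
  "high_density l Q = {(t, x, y). pmf Q (t, x, y) > 0 \<and>
     2 powr l * (pmf (inputs_law Q) (x, y))\<^sup>2 * pmf (law1 Q) (t, x) * pmf (law2 Q) (t, y)
       \<le> (pmf Q (t, x, y))\<^sup>2 * pmf (in1 Q) x * pmf (in2 Q) y}"

lemma pmf_map_pos: "pmf Q z > 0 \<Longrightarrow> pmf (map_pmf h Q) (h z) > 0"
  by (metis imageI pmf_positive set_map_pmf set_pmf_iff less_irrefl)

lemma high_density_bound:
  fixes L l1 l2 :: nat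
  assumes "(t, x, y) \<in> high_density l Q" "l1 + l2 \<le> L"
  shows "pmf (inputs_law Q) (x, y) \<le> 2 powr ((real L - l) / 2) *
    ((pmf (in1 Q) x * (pmf Q (t, x, y) / pmf (law1 Q) (t, x)) * (1/2) ^ l2 +
      pmf (in2 Q) y * (pmf Q (t, x, y) / pmf (law2 Q) (t, y)) * (1/2) ^ l1) / 2)"
proof -
  define p where "p = pmf (inputs_law Q) (x, y)"
  define a where "a = pmf (in1 Q) x * (pmf Q (t, x, y) / pmf (law1 Q) (t, x))"
  define b where "b = pmf (in2 Q) y * (pmf Q (t, x, y) / pmf (law2 Q) (t, y))"
  have pos: "pmf Q (t, x, y) > 0" and le: "2 powr l * p\<^sup>2 * pmf (law1 Q) (t, x) * pmf (law2 Q) (t, y)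
       \<le> (pmf Q (t, x, y))\<^sup>2 * pmf (in1 Q) x * pmf (in2 Q) y"
    using assms by (auto simp: high_density_def p_def)
  have pos1: "pmf (law1 Q) (t, x) > 0" and pos2: "pmf (law2 Q) (t, y) > 0"
    using pmf_map_pos[OF pos, of "\<lambda>(t, x, y). (t, x)"] pmf_map_pos[OF pos, of "\<lambda>(t, x, y). (t, y)"]
    by (simp_all add: law1_def law2_def)
  have ab: "a \<ge> 0" "b \<ge> 0" by (auto simp: a_def b_def)
  \<comment> \<open>\<open>a\<close> is P(x) Q(y | t, x) and \<open>b\<close> its mirror image P(y)
    Q(x | t, y); the density condition is this inequality with the denominators cleared.\<close>
  have "2 powr l * p\<^sup>2 \<le> a * b"
    using le pos1 pos2 by (simp add: a_def b_def field_simps power2_eq_square)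
  \<comment> \<open>The weights for Kraft's inequality are inserted before AM-GM. Their product is
    compensated by a factor that depends only on the total number of bits.\<close>
  also have "\<dots> = 2 ^ (l1 + l2) * ((a * (1/2) ^ l2) * (b * (1/2) ^ l1))"
    by (simp add: power_add power_divide)
  also have "\<dots> \<le> 2 ^ L * ((a * (1/2) ^ l2) * (b * (1/2) ^ l1))"
    using assms(2) ab by (intro mult_right_mono power_increasing) auto
  also have "\<dots> \<le> 2 ^ L * ((a * (1/2) ^ l2 + b * (1/2) ^ l1) / 2)\<^sup>2"
  proof (intro mult_left_mono)
    show "u * v \<le> ((u + v) / 2)\<^sup>2" for u v :: real
      using zero_le_power2[of "u - v"] by (simp add: power2_eq_square field_simps)
  qed auto
  finally have *: "2 powr l * p\<^sup>2 \<le> 2 ^ L * ((a * (1/2) ^ l2 + b * (1/2) ^ l1) / 2)\<^sup>2" .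
  have "p\<^sup>2 = 2 powr (- l) * (2 powr l * p\<^sup>2)"
    by (simp add: powr_minus)
  also have "\<dots> \<le> 2 powr (- l) * (2 ^ L * ((a * (1/2) ^ l2 + b * (1/2) ^ l1) / 2)\<^sup>2)"
    using * by (intro mult_left_mono) auto
  also have "\<dots> = (2 powr ((real L - l) / 2) * ((a * (1/2) ^ l2 + b * (1/2) ^ l1) / 2))\<^sup>2"
  proof -
    have "2 powr (- l) * 2 ^ L = (2 powr ((real L - l) / 2))\<^sup>2"
      by (simp add: power2_eq_square flip: powr_add powr_realpow)
    then show ?thesis by (simp only: power_mult_distrib mult.assoc[symmetric])
  qed
  finally show ?thesis unfolding p_def[symmetric] a_def[symmetric] b_def[symmetric]
    by (rule power2_le_imp_le) (use ab in auto)
qed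

lemma deterministic_converse:
  fixes Q :: "('t \<times> 'x \<times> 'y) pmf" and S :: "'x \<Rightarrow> 'y \<Rightarrow> transcript"
  assumes fin: "finite G"
    and dens: "\<And>x y. (x, y) \<in> G \<Longrightarrow> (f1 x (S x y), x, y) \<in> high_density l Q"
    and agree: "\<And>x y. (x, y) \<in> G \<Longrightarrow> f1 x (S x y) = f2 y (S x y)"
    and len: "\<And>x y. (x, y) \<in> G \<Longrightarrow> (\<Sum>m\<leftarrow>S x y. length m) \<le> L"
    and c1: "\<And>x y. (x, y) \<in> G \<Longrightarrow> compatible odd (msg1 x) (cb1 x) (S x y)"
    and c2: "\<And>x y. (x, y) \<in> G \<Longrightarrow> compatible even (msg2 y) (cb2 y) (S x y)"
  shows "measure (inputs_law Q) G \<le> 2 powr ((real L - l) / 2)"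
proof -
  let ?A = "\<lambda>x y. pmf (in1 Q) x * (pmf Q (f1 x (S x y), x, y) / pmf (law1 Q) (f1 x (S x y), x)) * (1/2) ^ bits_of odd (S x y)"
  let ?B = "\<lambda>x y. pmf (in2 Q) y * (pmf Q (f2 y (S x y), x, y) / pmf (law2 Q) (f2 y (S x y), y)) * (1/2) ^ bits_of even (S x y)"
  have pmf_le: "(\<Sum>x\<in>F. pmf p x) \<le> 1" if "finite F" for p :: "'q pmf" and F
    using that by (simp add: measure_measure_pmf_finite[symmetric])
  have A: "(\<Sum>(x, y)\<in>G. ?A x y) \<le> 1"
  proof (rule sum_disintegrate_le_1[where q = "\<lambda>t x y. pmf Q (t, x, y)" and qm = "\<lambda>t x. pmf (law1 Q) (t, x)"
        and w = "\<lambda>s. (1/2) ^ bits_of odd s" and f = f1, OF fin])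
    show "(\<Sum>y\<in>F. pmf Q (t, x, y)) \<le> pmf (law1 Q) (t, x)" if "finite F" for t x F
      unfolding law1_def using that by (intro sum_pmf_marginal_le) (auto simp: inj_on_def)
    show "(\<Sum>s\<in>S x ` {y. (x, y) \<in> G}. (1/2::real) ^ bits_of odd s) \<le> 1" for x
      by (rule kraft_transcripts[where msg = "msg1 x" and cb = "cb1 x"]) (auto simp: c1 finite_proj[OF fin])
  qed (auto simp: pmf_le)
  \<comment> \<open>Transposing \<open>G\<close> exchanges the roles of the parties.\<close>
  have B: "(\<Sum>(y, x)\<in>prod.swap ` G. ?B x y) \<le> 1"
  proof (rule sum_disintegrate_le_1[where q = "\<lambda>t y x. pmf Q (t, x, y)" and qm = "\<lambda>t x. pmf (law2 Q) (t, x)"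
        and w = "\<lambda>s. (1/2) ^ bits_of even s" and f = f2 and S = "\<lambda>y x. S x y"])
    show "(\<Sum>x\<in>F. pmf Q (t, x, y)) \<le> pmf (law2 Q) (t, y)" if "finite F" for t y F
      unfolding law2_def using that by (intro sum_pmf_marginal_le) (auto simp: inj_on_def)
    show "(\<Sum>s\<in>(\<lambda>x. S x y) ` {x. (y, x) \<in> prod.swap ` G}. (1/2::real) ^ bits_of even s) \<le> 1" for y
      by (rule kraft_transcripts[where msg = "msg2 y" and cb = "cb2 y"])
        (use finite_proj(2)[of "prod.swap ` G" y] fin in \<open>auto simp: c2\<close>)
  qed (auto simp: pmf_le fin)
  have "(\<Sum>(y, x)\<in>prod.swap ` G. ?B x y) = (\<Sum>(x, y)\<in>G. ?B x y)"
    by (subst sum.reindex) (auto simp: case_prod_beta)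
  with B have B': "(\<Sum>(x, y)\<in>G. ?B x y) \<le> 1" by simp
  have "measure (inputs_law Q) G = (\<Sum>(x, y)\<in>G. pmf (inputs_law Q) (x, y))"
    using fin by (simp add: measure_measure_pmf_finite case_prod_beta)
  also have "\<dots> \<le> (\<Sum>(x, y)\<in>G. 2 powr ((real L - l) / 2) * ((?A x y + ?B x y) / 2))"
  proof (intro sum_mono, clarify)
    fix x y assume G: "(x, y) \<in> G"
    have "bits_of even (S x y) + bits_of odd (S x y) \<le> L"
      using len[OF G] bits_of_split[of even "S x y"] by simp
    \<comment> \<open>As the outputs agree, the second term can be written with Party 2's output,
      which for fixed \<open>y\<close> is a function of the transcript.\<close>
    from high_density_bound[OF dens[OF G] this]
    show "pmf (inputs_law Q) (x, y) \<le> 2 powr ((real L - l) / 2) * ((?A x y + ?B x y) / 2)"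
      by (simp add: agree[OF G])
  qed
  also have "\<dots> = 2 powr ((real L - l) / 2) * (((\<Sum>(x, y)\<in>G. ?A x y) + (\<Sum>(x, y)\<in>G. ?B x y)) / 2)"
    by (simp add: case_prod_beta sum_distrib_left sum_divide_distrib sum.distrib add_divide_distrib distrib_left)
  also have "\<dots> \<le> 2 powr ((real L - l) / 2) * ((1 + 1) / 2)"
    using A B' by (intro mult_left_mono divide_right_mono add_mono) auto
  finally show ?thesis by simp
qed

section \<open>Variation distance and executions of protocols\<close>

text \<open>With countably many outcomes, those of probability 0 together form a null set, so the
  measure lives on its atoms. This turns laws of transcripts and of outputs into values of type
  \<open>pmf\<close>.\<close>

lemma prob_space_countable_pmf:
  fixes M :: "'z::countable measure"
  assumes "prob_space M" and sets: "sets M = UNIV"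
  obtains p where "measure_pmf p = M"
proof -
  interpret prob_space M by fact
  have space: "space M = UNIV" using sets_eq_imp_space_eq[of M "count_space UNIV"] sets by simp
  have "(\<Union>x\<in>{x. measure M {x} = 0}. {x}) \<in> null_sets M"
    by (rule null_sets_UN') (auto simp: sets emeasure_eq_measure null_sets_def)
  then have "AE x in M. measure M {x} \<noteq> 0"
    by (intro AE_I'[where N = "{x. measure M {x} = 0}"]) auto
  then have "measure_pmf (Abs_pmf M) = M"
    using sets by (intro Abs_pmf_inverse) (auto simp: prob_space_axioms)
  then show ?thesis using that by blast
qed

section \<open>Variation distance: tests and overlaps\<close>

lemma d_var_pmf:
  "d_var (measure_pmf p) (measure_pmf q) = infsetsum (\<lambda>x. \<bar>pmf p x - pmf q x\<bar>) UNIV / 2"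
proof -
  have "Infinite_Set_Sum.abs_summable_on (\<lambda>x. pmf p x - pmf q x) UNIV" by (intro abs_summable_on_diff) auto
  then have "Infinite_Set_Sum.abs_summable_on (\<lambda>x. norm (pmf p x - pmf q x)) UNIV"
    by (rule abs_summable_on_normI)
  then show ?thesis by (simp add: d_var_def infsetsum_infsum measure_pmf_single)
qed

text \<open>The signed differences over \<open>A\<close> and over its complement cancel, so each of
  the two parts of the sum of absolute values is at least the difference of the probabilities; this
  absorbs the factor 1/2 in \<open>d_var\<close>.\<close>

lemma measure_diff_le_d_var: "measure_pmf.prob p A - measure_pmf.prob q A \<le> d_var (measure_pmf p) (measure_pmf q)"
proof -
  have s: "Infinite_Set_Sum.abs_summable_on (\<lambda>x. pmf p x - pmf q x) B" for B by (intro abs_summable_on_diff) auto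
  have s': "Infinite_Set_Sum.abs_summable_on (\<lambda>x. \<bar>pmf p x - pmf q x\<bar>) B" for B
    using abs_summable_on_normI[OF s[of B]] by simp
  have diff: "measure_pmf.prob p B - measure_pmf.prob q B = infsetsum (\<lambda>x. pmf p x - pmf q x) B" for B
    by (simp add: measure_pmf_conv_infsetsum infsetsum_diff pmf_abs_summable)
  have le: "infsetsum (\<lambda>x. pmf p x - pmf q x) B \<le> infsetsum (\<lambda>x. \<bar>pmf p x - pmf q x\<bar>) B" for B
    by (intro infsetsum_mono s s') auto
  have le': "- infsetsum (\<lambda>x. pmf p x - pmf q x) B \<le> infsetsum (\<lambda>x. \<bar>pmf p x - pmf q x\<bar>) B" for B
    unfolding infsetsum_uminus[symmetric] by (intro infsetsum_mono s') (use s[of B] abs_summable_on_uminus in auto)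
  have "infsetsum (\<lambda>x. \<bar>pmf p x - pmf q x\<bar>) UNIV = infsetsum (\<lambda>x. \<bar>pmf p x - pmf q x\<bar>) (A \<union> - A)"
    by simp
  also have "\<dots> = infsetsum (\<lambda>x. \<bar>pmf p x - pmf q x\<bar>) A + infsetsum (\<lambda>x. \<bar>pmf p x - pmf q x\<bar>) (- A)"
    by (rule infsetsum_Un_disjoint) (auto simp: s')
  also have "\<dots> \<ge> (measure_pmf.prob p A - measure_pmf.prob q A) + (- (measure_pmf.prob p (-A) - measure_pmf.prob q (-A)))"
    unfolding diff by (intro add_mono le le')
  finally show ?thesis
    using measure_pmf.prob_compl[of A p] measure_pmf.prob_compl[of A q]
    by (simp add: d_var_pmf Compl_eq_Diff_UNIV)
qed

text \<open>Let \<open>r\<close> be \<open>c p\<close> restricted to \<open>Z\<close>, a common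
  minorant of \<open>p\<close> and \<open>q\<close>. Then
  \<open>|p - q| <= (p - r) + (q - r)\<close>, and the right side has total mass
  \<open>2 - 2 r(Z)\<close>. A simulation is thus judged only by how likely it produces the correct
  outcomes.\<close>

lemma d_var_le_overlap:
  assumes c: "0 \<le> c" "c \<le> 1" and le: "\<And>z. z \<in> Z \<Longrightarrow> c * pmf p z \<le> pmf q z"
  shows "d_var (measure_pmf p) (measure_pmf q) \<le> 1 - c * measure_pmf.prob p Z"
proof -
  let ?r = "\<lambda>z. c * (pmf p z * indicator Z z)"
  have sz: "Infinite_Set_Sum.abs_summable_on (\<lambda>z. pmf p z * indicator Z z) UNIV"
    by (rule abs_summable_on_comparison_test[OF pmf_abs_summable[of p UNIV]]) (auto simp: indicator_def)
  then have sr: "Infinite_Set_Sum.abs_summable_on ?r UNIV" by (intro abs_summable_on_cmult_right) auto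
  have "infsetsum (\<lambda>z. pmf p z * indicator Z z) UNIV = measure_pmf.prob p Z"
    unfolding measure_pmf_conv_infsetsum by (rule infsetsum_cong_neutral) auto
  then have r: "infsetsum ?r UNIV = c * measure_pmf.prob p Z"
    using infsetsum_cmult_right[OF sz, of c] by simp
  have s: "Infinite_Set_Sum.abs_summable_on (\<lambda>x. pmf p x - pmf q x) UNIV" by (intro abs_summable_on_diff) auto
  have s': "Infinite_Set_Sum.abs_summable_on (\<lambda>x. \<bar>pmf p x - pmf q x\<bar>) UNIV"
    using abs_summable_on_normI[OF s] by simp
  have srr: "Infinite_Set_Sum.abs_summable_on (\<lambda>x. pmf p x - ?r x) UNIV" "Infinite_Set_Sum.abs_summable_on (\<lambda>x. pmf q x - ?r x) UNIV"
    by (intro abs_summable_on_diff sr; auto)+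
  have "infsetsum (\<lambda>x. \<bar>pmf p x - pmf q x\<bar>) UNIV \<le> infsetsum (\<lambda>x. (pmf p x - ?r x) + (pmf q x - ?r x)) UNIV"
  proof (rule infsetsum_mono[OF s'])
    show "Infinite_Set_Sum.abs_summable_on (\<lambda>x. (pmf p x - ?r x) + (pmf q x - ?r x)) UNIV"
      by (intro abs_summable_on_add srr)
    fix x
    have "?r x \<le> pmf p x" using c by (auto simp: indicator_def mult_left_le_one_le)
    moreover have "?r x \<le> pmf q x" using c le[of x] by (auto simp: indicator_def)
    ultimately show "\<bar>pmf p x - pmf q x\<bar> \<le> (pmf p x - ?r x) + (pmf q x - ?r x)"
      unfolding abs_le_iff by linarith
  qed
  also have "\<dots> = 2 - 2 * (c * measure_pmf.prob p Z)"
    by (subst infsetsum_add[OF srr], subst (1 2) infsetsum_diff)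
      (auto simp: sr r infsetsum_pmf_eq_1)
  finally show ?thesis by (simp add: d_var_pmf)
qed

section \<open>Runs and the local conditions that determine them\<close>

definition valid_state :: "nat \<Rightarrow> transcript \<times> next_state \<Rightarrow> bool" where
  "valid_state i = (\<lambda>(h, s). length h \<le> i \<and> (s = Continue \<longrightarrow> length h = i) \<and> (s = Stop \<longrightarrow> h \<noteq> []))"

text \<open>Tells whether the state after message \<open>j\<close> is \<open>Continue\<close>: every
  message but the last was followed by another one, and the last one leads to
  \<open>s\<close>.\<close>

definition goes_on :: "transcript \<times> next_state \<Rightarrow> nat \<Rightarrow> bool" where
  "goes_on = (\<lambda>(h, s) j. Suc j < length h \<or> s = Continue)"

lemma run_history:
  assumes "run \<pi> \<omega> i = (h, s)"
  shows "valid_state i (h, s)"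
    and "\<And>j. j < length h \<Longrightarrow> run \<pi> \<omega> j = (take j h, Continue) \<and> sent_message \<pi> \<omega> (take j h) = h ! j \<and>
      (codebook1 \<pi> \<omega> (take j h) (h ! j) = Some Continue \<longleftrightarrow> goes_on (h, s) j)"
proof -
  have "valid_state i (h, s) \<and> (\<forall>j<length h. run \<pi> \<omega> j = (take j h, Continue) \<and> sent_message \<pi> \<omega> (take j h) = h ! j \<and>
      (codebook1 \<pi> \<omega> (take j h) (h ! j) = Some Continue \<longleftrightarrow> goes_on (h, s) j))"
    using assms
  proof (induction i arbitrary: h s)
    case 0
    then show ?case by (auto simp: valid_state_def)
  next
    case (Suc i)
    obtain h0 s0 where r: "run \<pi> \<omega> i = (h0, s0)" by fastforce
    note IH = Suc.IH[OF r]
    show ?case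
    proof (cases s0)
      case Stop
      then have "h = h0" "s = s0" using Suc.prems r by auto
      then show ?thesis using IH Stop by (auto simp: valid_state_def)
    next
      case Continue
      define m where "m = sent_message \<pi> \<omega> h0"
      have h: "h = h0 @ [m]" and s: "s = (if codebook1 \<pi> \<omega> h0 m = Some Continue then Continue else Stop)"
        using Suc.prems r Continue by (auto simp: Let_def m_def)
      have len: "length h0 = i" using IH Continue by (auto simp: valid_state_def)
      have "run \<pi> \<omega> j = (take j h, Continue) \<and> sent_message \<pi> \<omega> (take j h) = h ! j \<and>
      (codebook1 \<pi> \<omega> (take j h) (h ! j) = Some Continue \<longleftrightarrow> goes_on (h, s) j)" if "j < length h" for j
      proof (cases "j < length h0")
        case True
        then show ?thesis using IH Continue by (auto simp: h nth_append goes_on_def)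
      next
        case False
        then have "j = i" using that h len by simp
        then show ?thesis using r Continue len s by (auto simp: h m_def goes_on_def)
      qed
      then show ?thesis using len by (auto simp: valid_state_def h)
    qed
  qed
  then show "valid_state i (h, s)"
    and "\<And>j. j < length h \<Longrightarrow> run \<pi> \<omega> j = (take j h, Continue) \<and> sent_message \<pi> \<omega> (take j h) = h ! j \<and>
      (codebook1 \<pi> \<omega> (take j h) (h ! j) = Some Continue \<longleftrightarrow> goes_on (h, s) j)" by auto
qed

lemma run_Stop_mono: "run \<pi> \<omega> i = (h, Stop) \<Longrightarrow> run \<pi> \<omega> (i + k) = (h, Stop)"
  by (induction k) auto

text \<open>Converse of \<open>run_history\<close>. The codebook condition is demanded only at
  histories that the run actually reaches, because only there are the codebooks of the two parties
  known to agree.\<close>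

lemma runI:
  assumes valid: "valid_state i (h, s)"
    and sent: "\<And>j. j < length h \<Longrightarrow> sent_message \<pi> \<omega> (take j h) = h ! j"
    and cb: "\<And>j. j < length h \<Longrightarrow> run \<pi> \<omega> j = (take j h, Continue) \<Longrightarrow>
      codebook1 \<pi> \<omega> (take j h) (h ! j) = Some Continue \<longleftrightarrow> goes_on (h, s) j"
  shows "run \<pi> \<omega> i = (h, s)"
proof -
  have *: "run \<pi> \<omega> j = (take j h, Continue)" if "j < length h" for j
    using that
  proof (induction j)
    case (Suc j)
    then have IH: "run \<pi> \<omega> j = (take j h, Continue)" by simp
    moreover have "goes_on (h, s) j" using Suc.prems by (auto simp: goes_on_def)
    ultimately show ?case
      using sent[of j] cb[of j] Suc.prems by (simp add: Let_def take_Suc_conv_app_nth)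
  qed simp
  have end_run: "run \<pi> \<omega> (length h) = (h, s)"
  proof (cases "h = []")
    case True
    then show ?thesis using valid by (cases s) (auto simp: valid_state_def)
  next
    case False
    then obtain j where j: "length h = Suc j" by (cases "length h") auto
    then have "take (Suc j) h = h" by simp
    then have "take j h @ [h ! j] = h" using j by (metis lessI take_Suc_conv_app_nth)
    moreover have "goes_on (h, s) j \<longleftrightarrow> s = Continue" using j by (auto simp: goes_on_def)
    ultimately show ?thesis
      using *[of j] sent[of j] cb[of j] j by (cases s) (auto simp: Let_def)
  qed
  show ?thesis
  proof (cases s)
    case Continue
    then show ?thesis using end_run valid by (auto simp: valid_state_def)
  next
    case Stop
    then show ?thesis using run_Stop_mono[of \<pi> \<omega> "length h" h "i - length h"] end_run valid
      by (auto simp: valid_state_def)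
  qed
qed

lemma transcript_of_eqI: "run \<pi> \<omega> i = (h, Stop) \<Longrightarrow> transcript_of \<pi> \<omega> = h"
proof -
  assume r: "run \<pi> \<omega> i = (h, Stop)"
  define k where "k = (LEAST i. snd (run \<pi> \<omega> i) = Stop)"
  have "snd (run \<pi> \<omega> k) = Stop" "k \<le> i"
    unfolding k_def using r by (auto intro: LeastI[where k = i] Least_le)
  then have "run \<pi> \<omega> k = (transcript_of \<pi> \<omega>, Stop)"
    by (simp add: transcript_of_def k_def prod_eq_iff)
  from run_Stop_mono[OF this, of "i - k"] show ?thesis using r \<open>k \<le> i\<close> by simp
qed

lemma terminates_run:
  assumes "terminates \<pi> \<omega>"
  shows "run \<pi> \<omega> (length (transcript_of \<pi> \<omega>)) = (transcript_of \<pi> \<omega>, Stop)"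
proof -
  obtain i where "snd (run \<pi> \<omega> i) = Stop" using assms by (auto simp: terminates_def)
  then obtain h where r: "run \<pi> \<omega> i = (h, Stop)" by (cases "run \<pi> \<omega> i") auto
  have "run \<pi> \<omega> (length h) = (h, Stop)"
    using run_history[OF r] by (intro runI) (auto simp: valid_state_def)
  then show ?thesis using transcript_of_eqI[OF r] by simp
qed

section \<open>Measurability of runs, transcripts and outputs\<close>

lemma measurable_countable_fst:
  fixes P :: "'z::countable pmf"
  assumes "\<And>z. (\<lambda>r. f (z, r)) \<in> N \<rightarrow>\<^sub>M K"
  shows "f \<in> measure_pmf P \<Otimes>\<^sub>M N \<rightarrow>\<^sub>M K"
proof -
  have "f \<in> count_space UNIV \<Otimes>\<^sub>M N \<rightarrow>\<^sub>M K"
    using assms by (intro measurable_pair_measure_countable1) auto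
  then show ?thesis
    by (subst measurable_cong_sets[where M' = "count_space UNIV \<Otimes>\<^sub>M N" and N' = K])
      (auto intro!: sets_pair_measure_cong)
qed

definition measurable_protocol :: "('x, 'y, 'a, 'b, 'u) protocol \<Rightarrow> bool" where
  "measurable_protocol \<pi> \<longleftrightarrow> measurable_party (public_rand \<pi>) (party1 \<pi>) \<and>
     measurable_party (public_rand \<pi>) (party2 \<pi>)"

abbreviation randomness :: "('x, 'y, 'a, 'b, 'u) protocol \<Rightarrow> ('u \<times> 'a \<times> 'b) measure" where
  "randomness \<pi> \<equiv> public_rand \<pi> \<Otimes>\<^sub>M (private_rand (party1 \<pi>) \<Otimes>\<^sub>M private_rand (party2 \<pi>))"

lemma execution_space_alt: "execution_space P \<pi> = measure_pmf P \<Otimes>\<^sub>M randomness \<pi>"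
  by (simp add: execution_space_def)

lemma measurable_view1:
  "(\<lambda>(a, u). f a u) \<in> A \<Otimes>\<^sub>M U \<rightarrow>\<^sub>M K \<Longrightarrow> (\<lambda>(u, a, b). f a u) \<in> U \<Otimes>\<^sub>M (A \<Otimes>\<^sub>M B) \<rightarrow>\<^sub>M K"
  using measurable_compose[of "\<lambda>(u, a, b). (a, u)" "U \<Otimes>\<^sub>M (A \<Otimes>\<^sub>M B)" "A \<Otimes>\<^sub>M U" "\<lambda>(a, u). f a u" K]
  by (simp add: case_prod_beta')

lemma measurable_view2:
  "(\<lambda>(b, u). f b u) \<in> B \<Otimes>\<^sub>M U \<rightarrow>\<^sub>M K \<Longrightarrow> (\<lambda>(u, a, b). f b u) \<in> U \<Otimes>\<^sub>M (A \<Otimes>\<^sub>M B) \<rightarrow>\<^sub>M K"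
  using measurable_compose[of "\<lambda>(u, a, b). (b, u)" "U \<Otimes>\<^sub>M (A \<Otimes>\<^sub>M B)" "B \<Otimes>\<^sub>M U" "\<lambda>(b, u). f b u" K]
  by (simp add: case_prod_beta')

text \<open>Messages and codebook entries are measurable for each fixed input, history and message.
  These range over countable types, so inserting the random history and the random message preserves
  measurability.\<close>

lemma measurable_run:
  fixes P :: "('x::countable \<times> 'y::countable) pmf"
  assumes "measurable_protocol \<pi>"
  shows "(\<lambda>\<omega>. run \<pi> \<omega> i) \<in> execution_space P \<pi> \<rightarrow>\<^sub>M count_space UNIV"
proof -
  have m: "(\<lambda>\<omega>. sent_message \<pi> \<omega> h) \<in> execution_space P \<pi> \<rightarrow>\<^sub>M count_space UNIV" for h
    unfolding execution_space_alt
  proof (rule measurable_countable_fst)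
    fix z :: "'x \<times> 'y"
    obtain x y where z: "z = (x, y)" by fastforce
    show "(\<lambda>r. sent_message \<pi> (z, r) h) \<in> randomness \<pi> \<rightarrow>\<^sub>M count_space UNIV"
    proof (cases "even (length h)")
      case True
      then have "(\<lambda>r. sent_message \<pi> (z, r) h) = (\<lambda>(u, a, b). message_of (party1 \<pi>) x a u h)"
        by (auto simp: z)
      then show ?thesis
        using assms by (auto simp: measurable_protocol_def measurable_party_def intro: measurable_view1)
    next
      case False
      then have "(\<lambda>r. sent_message \<pi> (z, r) h) = (\<lambda>(u, a, b). message_of (party2 \<pi>) y b u h)"
        by (auto simp: z)
      then show ?thesis
        using assms by (auto simp: measurable_protocol_def measurable_party_def intro: measurable_view2)
    qed
  qed
  have c: "(\<lambda>\<omega>. codebook1 \<pi> \<omega> h m) \<in> execution_space P \<pi> \<rightarrow>\<^sub>M count_space UNIV" for h m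
    unfolding execution_space_alt
  proof (rule measurable_countable_fst)
    fix z :: "'x \<times> 'y"
    obtain x y where z: "z = (x, y)" by fastforce
    have "(\<lambda>r. codebook1 \<pi> (z, r) h m) = (\<lambda>(u, a, b). codebook_of (party1 \<pi>) x a u h m)"
      by (auto simp: z)
    then show "(\<lambda>r. codebook1 \<pi> (z, r) h m) \<in> randomness \<pi> \<rightarrow>\<^sub>M count_space UNIV"
      using assms by (auto simp: measurable_protocol_def measurable_party_def intro: measurable_view1)
  qed
  show ?thesis
  proof (induction i)
    case (Suc i)
    define step where "step hs \<omega> = (if snd hs = Stop then hs else (fst hs @ [sent_message \<pi> \<omega> (fst hs)],
      if codebook1 \<pi> \<omega> (fst hs) (sent_message \<pi> \<omega> (fst hs)) = Some Continue then Continue else Stop))" for hs \<omega>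
    have "(\<lambda>\<omega>. step (run \<pi> \<omega> i) \<omega>) \<in> execution_space P \<pi> \<rightarrow>\<^sub>M count_space UNIV"
    proof (rule measurable_compose_countable[OF _ Suc])
      fix hs :: "transcript \<times> next_state"
      define g where "g msg \<omega> = (if snd hs = Stop then hs else (fst hs @ [msg],
        if codebook1 \<pi> \<omega> (fst hs) msg = Some Continue then Continue else Stop))" for msg \<omega>
      have "(\<lambda>\<omega>. g (sent_message \<pi> \<omega> (fst hs)) \<omega>) \<in> execution_space P \<pi> \<rightarrow>\<^sub>M count_space UNIV"
      proof (rule measurable_compose_countable[OF _ m])
        fix msg
        show "g msg \<in> execution_space P \<pi> \<rightarrow>\<^sub>M count_space UNIV"
          unfolding g_def[abs_def]
          by (rule measurable_compose[OF c, of "\<lambda>c. if snd hs = Stop then hs else (fst hs @ [msg], if c = Some Continue then Continue else Stop)"]) simp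
      qed
      then show "step hs \<in> execution_space P \<pi> \<rightarrow>\<^sub>M count_space UNIV"
        by (simp only: g_def step_def[abs_def])
    qed
    moreover have "run \<pi> \<omega> (Suc i) = step (run \<pi> \<omega> i) \<omega>" for \<omega>
      by (cases "run \<pi> \<omega> i") (simp add: step_def Let_def)
    ultimately show ?case by (simp only:)
  qed simp
qed

lemma measurable_transcript_of:
  fixes P :: "('x::countable \<times> 'y::countable) pmf"
  assumes "measurable_protocol \<pi>"
  shows "transcript_of \<pi> \<in> execution_space P \<pi> \<rightarrow>\<^sub>M count_space UNIV"
proof -
  note r = measurable_run[OF assms, of _ P]
  have "(\<lambda>\<omega>. LEAST i. snd (run \<pi> \<omega> i) = Stop) \<in> execution_space P \<pi> \<rightarrow>\<^sub>M count_space UNIV"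
    by (intro measurable_Least measurable_compose[OF r, of "\<lambda>r. snd r = Stop"]) simp
  moreover have "(\<lambda>\<omega>. fst (run \<pi> \<omega> i)) \<in> execution_space P \<pi> \<rightarrow>\<^sub>M count_space UNIV" for i
    by (rule measurable_compose[OF r, of fst]) simp
  ultimately show ?thesis unfolding transcript_of_def[abs_def]
    by (rule measurable_compose_countable[where f = "\<lambda>i \<omega>. fst (run \<pi> \<omega> i)", rotated])
qed

lemma interactive_measurable: "interactive_protocol P \<pi> \<Longrightarrow> measurable_protocol \<pi>"
  by (simp add: interactive_protocol_def measurable_protocol_def)

lemma prob_space_execution:
  assumes "interactive_protocol P \<pi>"
  shows "prob_space (randomness \<pi>)" "prob_space (execution_space P \<pi>)"
  using assms unfolding execution_space_alt interactive_protocol_def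
  by (auto intro!: prob_space_pair measure_pmf.prob_space_axioms)

lemma space_execution:
  "space (execution_space P \<pi>) = UNIV \<times> space (randomness \<pi>)"
  by (simp add: execution_space_alt space_pair_measure)

lemma measurable_input1: "input1 \<in> execution_space P \<pi> \<rightarrow>\<^sub>M count_space UNIV"
  and measurable_input2: "input2 \<in> execution_space P \<pi> \<rightarrow>\<^sub>M count_space UNIV"
proof -
  have "(\<lambda>\<omega>. fst (fst \<omega>)) \<in> measure_pmf P \<Otimes>\<^sub>M randomness \<pi> \<rightarrow>\<^sub>M count_space UNIV"
    "(\<lambda>\<omega>. snd (fst \<omega>)) \<in> measure_pmf P \<Otimes>\<^sub>M randomness \<pi> \<rightarrow>\<^sub>M count_space UNIV"
    by (auto intro: measurable_compose[OF measurable_fst])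
  then show "input1 \<in> execution_space P \<pi> \<rightarrow>\<^sub>M count_space UNIV" "input2 \<in> execution_space P \<pi> \<rightarrow>\<^sub>M count_space UNIV"
    by (simp_all add: input1_def input2_def execution_space_alt case_prod_beta')
qed

lemma measurable_recoverable1:
  fixes P :: "('x::countable \<times> 'y::countable) pmf"
  assumes m: "measurable_protocol \<pi>" and F: "recoverable1 P \<pi> F"
  shows "F \<in> execution_space P \<pi> \<rightarrow>\<^sub>M count_space UNIV"
proof -
  obtain f where f: "\<And>x \<tau>. (\<lambda>(a, u). f x a u \<tau>) \<in> private_rand (party1 \<pi>) \<Otimes>\<^sub>M public_rand \<pi> \<rightarrow>\<^sub>M count_space UNIV"
    and F: "\<And>x y u a b. ((x, y), u, a, b) \<in> space (execution_space P \<pi>) \<Longrightarrow>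
      F ((x, y), u, a, b) = f x a u (transcript_of \<pi> ((x, y), u, a, b))"
    using F unfolding recoverable1_def by fastforce
  have "(\<lambda>\<omega>. (\<lambda>((x, y), u, a, b). f x a u \<tau>) \<omega>) \<in> execution_space P \<pi> \<rightarrow>\<^sub>M count_space UNIV" for \<tau>
    unfolding execution_space_alt
    by (rule measurable_countable_fst) (use measurable_view1[OF f] in \<open>auto simp: case_prod_beta'\<close>)
  then have "(\<lambda>\<omega>. (\<lambda>((x, y), u, a, b). f x a u (transcript_of \<pi> \<omega>)) \<omega>) \<in> execution_space P \<pi> \<rightarrow>\<^sub>M count_space UNIV"
    by (rule measurable_compose_countable[OF _ measurable_transcript_of[OF m]])
  then show ?thesis
    by (rule measurable_cong[THEN iffD1, rotated]) (auto simp: F)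
qed

lemma measurable_recoverable2:
  fixes P :: "('x::countable \<times> 'y::countable) pmf"
  assumes m: "measurable_protocol \<pi>" and F: "recoverable2 P \<pi> F"
  shows "F \<in> execution_space P \<pi> \<rightarrow>\<^sub>M count_space UNIV"
proof -
  obtain f where f: "\<And>x \<tau>. (\<lambda>(b, u). f x b u \<tau>) \<in> private_rand (party2 \<pi>) \<Otimes>\<^sub>M public_rand \<pi> \<rightarrow>\<^sub>M count_space UNIV"
    and F: "\<And>x y u a b. ((x, y), u, a, b) \<in> space (execution_space P \<pi>) \<Longrightarrow>
      F ((x, y), u, a, b) = f y b u (transcript_of \<pi> ((x, y), u, a, b))"
    using F unfolding recoverable2_def by fastforce
  have "(\<lambda>\<omega>. (\<lambda>((x, y), u, a, b). f y b u \<tau>) \<omega>) \<in> execution_space P \<pi> \<rightarrow>\<^sub>M count_space UNIV" for \<tau>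
    unfolding execution_space_alt
    by (rule measurable_countable_fst) (use measurable_view2[OF f] in \<open>auto simp: case_prod_beta'\<close>)
  then have "(\<lambda>\<omega>. (\<lambda>((x, y), u, a, b). f y b u (transcript_of \<pi> \<omega>)) \<omega>) \<in> execution_space P \<pi> \<rightarrow>\<^sub>M count_space UNIV"
    by (rule measurable_compose_countable[OF _ measurable_transcript_of[OF m]])
  then show ?thesis
    by (rule measurable_cong[THEN iffD1, rotated]) (auto simp: F)
qed

section \<open>From fixed randomness to arbitrary simulations\<close>

definition proper :: "('x, 'y, 'a, 'b, 'u) protocol \<Rightarrow> ('x, 'y, 'a, 'b, 'u) outcome \<Rightarrow> bool" where
  "proper \<pi> \<omega> \<longleftrightarrow> terminates \<pi> \<omega> \<and> (\<forall>i h. run \<pi> \<omega> i = (h, Continue) \<longrightarrow>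
     codebook1 \<pi> \<omega> h = codebook2 \<pi> \<omega> h \<and> sent_message \<pi> \<omega> h \<in> dom (codebook1 \<pi> \<omega> h) \<and>
     prefix_free (dom (codebook1 \<pi> \<omega> h)))"

lemma AE_proper:
  assumes "interactive_protocol P \<pi>" "prefix_free_messages P \<pi>"
  shows "AE \<omega> in execution_space P \<pi>. proper \<pi> \<omega>"
proof -
  have "AE \<omega> in execution_space P \<pi>. terminates \<pi> \<omega>"
    "AE \<omega> in execution_space P \<pi>. \<forall>i h. run \<pi> \<omega> i = (h, Continue) \<longrightarrow>
        codebook1 \<pi> \<omega> h = codebook2 \<pi> \<omega> h \<and> sent_message \<pi> \<omega> h \<in> dom (codebook1 \<pi> \<omega> h)"
    using assms(1) by (simp_all add: interactive_protocol_def)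
  moreover have "AE \<omega> in execution_space P \<pi>. \<forall>i h. run \<pi> \<omega> i = (h, Continue) \<longrightarrow>
      prefix_free (dom (codebook1 \<pi> \<omega> h))"
    using assms(2) by (simp add: prefix_free_messages_def prefix_free_def)
  ultimately show ?thesis unfolding proper_def by eventually_elim blast
qed

lemma proper_transcript:
  assumes "proper \<pi> \<omega>"
  shows "transcript_of \<pi> \<omega> \<noteq> []"
    and "\<And>j. j < length (transcript_of \<pi> \<omega>) \<Longrightarrow>
      sent_message \<pi> \<omega> (take j (transcript_of \<pi> \<omega>)) = transcript_of \<pi> \<omega> ! j \<and>
      (codebook1 \<pi> \<omega> (take j (transcript_of \<pi> \<omega>)) (transcript_of \<pi> \<omega> ! j) = Some Continue \<longleftrightarrow>
        Suc j < length (transcript_of \<pi> \<omega>)) \<and>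
      codebook2 \<pi> \<omega> (take j (transcript_of \<pi> \<omega>)) = codebook1 \<pi> \<omega> (take j (transcript_of \<pi> \<omega>)) \<and>
      transcript_of \<pi> \<omega> ! j \<in> dom (codebook1 \<pi> \<omega> (take j (transcript_of \<pi> \<omega>))) \<and>
      prefix_free (dom (codebook1 \<pi> \<omega> (take j (transcript_of \<pi> \<omega>))))"
proof -
  have r: "run \<pi> \<omega> (length (transcript_of \<pi> \<omega>)) = (transcript_of \<pi> \<omega>, Stop)"
    by (rule terminates_run) (use assms in \<open>simp add: proper_def\<close>)
  note h = run_history[OF r]
  show "transcript_of \<pi> \<omega> \<noteq> []" using h(1) by (auto simp: valid_state_def)
  fix j assume j: "j < length (transcript_of \<pi> \<omega>)"
  show "sent_message \<pi> \<omega> (take j (transcript_of \<pi> \<omega>)) = transcript_of \<pi> \<omega> ! j \<and>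
      (codebook1 \<pi> \<omega> (take j (transcript_of \<pi> \<omega>)) (transcript_of \<pi> \<omega> ! j) = Some Continue \<longleftrightarrow>
        Suc j < length (transcript_of \<pi> \<omega>)) \<and>
      codebook2 \<pi> \<omega> (take j (transcript_of \<pi> \<omega>)) = codebook1 \<pi> \<omega> (take j (transcript_of \<pi> \<omega>)) \<and>
      transcript_of \<pi> \<omega> ! j \<in> dom (codebook1 \<pi> \<omega> (take j (transcript_of \<pi> \<omega>))) \<and>
      prefix_free (dom (codebook1 \<pi> \<omega> (take j (transcript_of \<pi> \<omega>))))"
    using h(2)[OF j] assms unfolding proper_def goes_on_def by simp metis
qed

text \<open>Agreement of the codebooks along the run transfers membership, prefix-freeness and next
  states from Party 1's codebook to Party 2's. Hence the same transcript can be parsed in both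
  views, each time with a codebook that the party itself can compute.\<close>

lemma proper_compatible:
  assumes "proper \<pi> ((x, y), u, a, b)"
  shows "compatible odd (\<lambda>h. message_of (party1 \<pi>) x a u h) (\<lambda>h. codebook_of (party1 \<pi>) x a u h)
      (transcript_of \<pi> ((x, y), u, a, b))"
    and "compatible even (\<lambda>h. message_of (party2 \<pi>) y b u h) (\<lambda>h. codebook_of (party2 \<pi>) y b u h)
      (transcript_of \<pi> ((x, y), u, a, b))"
proof -
  note P = proper_transcript(2)[OF assms]
  have "message_of (party1 \<pi>) x a u (take j (transcript_of \<pi> ((x, y), u, a, b))) = transcript_of \<pi> ((x, y), u, a, b) ! j"
    if "j < length (transcript_of \<pi> ((x, y), u, a, b))" "even j" for j
    using P[OF that(1)] that(2) by (simp add: min_absorb2 that(1) less_imp_le)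
  moreover have "message_of (party2 \<pi>) y b u (take j (transcript_of \<pi> ((x, y), u, a, b))) = transcript_of \<pi> ((x, y), u, a, b) ! j"
    if "j < length (transcript_of \<pi> ((x, y), u, a, b))" "odd j" for j
    using P[OF that(1)] that(2) by (simp add: min_absorb2 that(1) less_imp_le)
  ultimately show "compatible odd (\<lambda>h. message_of (party1 \<pi>) x a u h) (\<lambda>h. codebook_of (party1 \<pi>) x a u h)
      (transcript_of \<pi> ((x, y), u, a, b))"
    and "compatible even (\<lambda>h. message_of (party2 \<pi>) y b u h) (\<lambda>h. codebook_of (party2 \<pi>) y b u h)
      (transcript_of \<pi> ((x, y), u, a, b))"
    using P proper_transcript(1)[OF assms] unfolding compatible_def by simp_all
qed

text \<open>\<open>protocol_length\<close> ignores transcripts of probability 0; as there are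
  countably many of them, they are avoided almost surely.\<close>

lemma AE_protocol_length:
  fixes P :: "('x::countable \<times> 'y::countable) pmf"
  assumes ip: "interactive_protocol P \<pi>" and len: "protocol_length P \<pi> \<le> enat L"
  shows "AE \<omega> in execution_space P \<pi>. (\<Sum>m\<leftarrow>transcript_of \<pi> \<omega>. length m) \<le> L"
proof -
  interpret prob_space "execution_space P \<pi>" using prob_space_execution[OF ip] by simp
  note meas = measurable_transcript_of[OF interactive_measurable[OF ip], of P]
  have "AE \<omega> in execution_space P \<pi>. \<forall>\<tau>. transcript_of \<pi> \<omega> = \<tau> \<longrightarrow> (\<Sum>m\<leftarrow>\<tau>. length m) \<le> L"
    unfolding AE_all_countable
  proof
    fix \<tau>
    have set: "{\<omega> \<in> space (execution_space P \<pi>). transcript_of \<pi> \<omega> = \<tau>} \<in> events"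
      using measurable_sets[OF meas, of "{\<tau>}"] by (simp add: vimage_def Int_def conj_commute)
    show "AE \<omega> in execution_space P \<pi>. transcript_of \<pi> \<omega> = \<tau> \<longrightarrow> (\<Sum>m\<leftarrow>\<tau>. length m) \<le> L"
    proof (cases "\<P>(\<omega> in execution_space P \<pi>. transcript_of \<pi> \<omega> = \<tau>) > 0")
      case True
      then have "enat (\<Sum>m\<leftarrow>\<tau>. length m) \<le> protocol_length P \<pi>"
        unfolding protocol_length_def by (intro SUP_upper) simp
      also note len
      finally show ?thesis by simp
    next
      case False
      then have "\<P>(\<omega> in execution_space P \<pi>. transcript_of \<pi> \<omega> = \<tau>) = 0"
        by (simp add: zero_less_measure_iff)
      then have "AE \<omega> in execution_space P \<pi>. transcript_of \<pi> \<omega> \<noteq> \<tau>"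
        using set by (subst (asm) prob_eq_0) auto
      then show ?thesis by eventually_elim auto
    qed
  qed
  then show ?thesis by eventually_elim auto
qed

text \<open>The randomness is independent of the inputs, so Fubini averages the event of a common
  high-density output over sections in which the randomness is fixed and the inputs still follow
  \<open>inputs_law Q\<close>. Each section falls under \<open>deterministic_converse\<close>;
  passing to the ideal law costs \<epsilon>.\<close>

lemma simulation_converse:
  fixes Q :: "('t::countable \<times> 'x::countable \<times> 'y::countable) pmf"
  assumes sim: "is_simulation \<epsilon> (inputs_law Q) (measure_pmf Q) \<sigma>"
    and len: "protocol_length (inputs_law Q) \<sigma> \<le> enat L"
    and fin: "finite (set_pmf (inputs_law Q))"
  shows "measure_pmf.prob Q (high_density l Q) \<le> \<epsilon> + 2 powr ((real L - l) / 2)"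
proof -
  let ?P = "inputs_law Q"
  define M where "M = execution_space ?P \<sigma>"
  define N where "N = randomness \<sigma>"
  obtain F1 F2 where ip: "interactive_protocol ?P \<sigma>" and pf: "prefix_free_messages ?P \<sigma>"
    and F1: "recoverable1 ?P \<sigma> F1" and F2: "recoverable2 ?P \<sigma> F2"
    and dv: "d_var (distr Q (count_space UNIV) (\<lambda>(\<tau>, x, y). (\<tau>, \<tau>, x, y)))
              (distr M (count_space UNIV) (\<lambda>\<omega>. (F1 \<omega>, F2 \<omega>, input1 \<omega>, input2 \<omega>))) \<le> \<epsilon>"
    using sim unfolding is_simulation_def M_def by blast
  interpret N: prob_space N using prob_space_execution[OF ip] by (simp add: N_def)
  interpret M: prob_space M using prob_space_execution[OF ip] by (simp add: M_def)
  interpret PN: pair_sigma_finite "measure_pmf ?P" N ..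
  have MN: "M = measure_pmf ?P \<Otimes>\<^sub>M N" by (simp add: M_def N_def execution_space_alt)
  have meas: "F1 \<in> M \<rightarrow>\<^sub>M count_space UNIV" "F2 \<in> M \<rightarrow>\<^sub>M count_space UNIV"
    "input1 \<in> M \<rightarrow>\<^sub>M count_space UNIV" "input2 \<in> M \<rightarrow>\<^sub>M count_space UNIV"
    using measurable_recoverable1[OF interactive_measurable[OF ip] F1]
      measurable_recoverable2[OF interactive_measurable[OF ip] F2]
      measurable_input1 measurable_input2 by (simp_all add: M_def)
  let ?out = "\<lambda>\<omega>. (F1 \<omega>, F2 \<omega>, input1 \<omega>, input2 \<omega>)"
  have meas_out: "?out \<in> M \<rightarrow>\<^sub>M count_space UNIV"
  proof -
    have "?out \<in> M \<rightarrow>\<^sub>M count_space UNIV \<Otimes>\<^sub>M (count_space UNIV \<Otimes>\<^sub>M (count_space UNIV \<Otimes>\<^sub>M count_space UNIV))"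
      by (intro measurable_Pair meas)
    then show ?thesis by (simp add: pair_measure_countable)
  qed
  \<comment> \<open>Under the ideal law the two copies of the transcript coincide, so there
    \<open>T\<close> has the probability of \<open>high_density l Q\<close>.\<close>
  define T where "T = {(\<tau>, \<tau>', x, y). \<tau> = \<tau>' \<and> (\<tau>, x, y) \<in> high_density l Q}"
  define E where "E = ?out -` T \<inter> space M"
  have E: "E \<in> sets M" unfolding E_def using meas_out by (rule measurable_sets) simp
  obtain f1 where f1: "\<And>x y u a b. ((x, y), u, a, b) \<in> space M \<Longrightarrow>
      F1 ((x, y), u, a, b) = f1 x a u (transcript_of \<sigma> ((x, y), u, a, b))"
    using F1 unfolding recoverable1_def M_def by fastforce
  obtain f2 where f2: "\<And>x y u a b. ((x, y), u, a, b) \<in> space M \<Longrightarrow>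
      F2 ((x, y), u, a, b) = f2 y b u (transcript_of \<sigma> ((x, y), u, a, b))"
    using F2 unfolding recoverable2_def M_def by fastforce
  have "AE \<omega> in M. proper \<sigma> \<omega> \<and> (\<Sum>m\<leftarrow>transcript_of \<sigma> \<omega>. length m) \<le> L"
    using AE_proper[OF ip pf] AE_protocol_length[OF ip len] unfolding M_def by eventually_elim simp
  then obtain Z where Z: "Z \<in> null_sets M"
    and good: "\<And>\<omega>. \<omega> \<in> space M \<Longrightarrow> \<omega> \<notin> Z \<Longrightarrow> proper \<sigma> \<omega> \<and> (\<Sum>m\<leftarrow>transcript_of \<sigma> \<omega>. length m) \<le> L"
    unfolding eventually_ae_filter by blast
  define C where "C = 2 powr ((real L - l) / 2)"
  have section_bound: "emeasure (measure_pmf ?P) ((\<lambda>z. (z, r)) -` (E - Z)) \<le> ennreal C" for r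
  proof -
    obtain u a b where r: "r = (u, a, b)" by (cases r) auto
    \<comment> \<open>Intersecting with the support makes \<open>G\<close> finite and leaves its
      probability unchanged.\<close>
    define G where "G = ((\<lambda>z. (z, r)) -` (E - Z)) \<inter> set_pmf ?P"
    have G: "((x, y), u, a, b) \<in> space M" "proper \<sigma> ((x, y), u, a, b)"
      "(\<Sum>m\<leftarrow>transcript_of \<sigma> ((x, y), u, a, b). length m) \<le> L"
      "f1 x a u (transcript_of \<sigma> ((x, y), u, a, b)) = f2 y b u (transcript_of \<sigma> ((x, y), u, a, b))"
      "(f1 x a u (transcript_of \<sigma> ((x, y), u, a, b)), x, y) \<in> high_density l Q"
      if "(x, y) \<in> G" for x y
    proof -
      have *: "((x, y), u, a, b) \<in> E" "((x, y), u, a, b) \<notin> Z" using that by (auto simp: G_def r)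
      then show sp: "((x, y), u, a, b) \<in> space M" by (simp add: E_def)
      show "proper \<sigma> ((x, y), u, a, b)" "(\<Sum>m\<leftarrow>transcript_of \<sigma> ((x, y), u, a, b). length m) \<le> L"
        using good[OF sp] * by auto
      show "f1 x a u (transcript_of \<sigma> ((x, y), u, a, b)) = f2 y b u (transcript_of \<sigma> ((x, y), u, a, b))"
        "(f1 x a u (transcript_of \<sigma> ((x, y), u, a, b)), x, y) \<in> high_density l Q"
        using * f1[OF sp] f2[OF sp] by (auto simp: E_def T_def input1_def input2_def)
    qed
    have "measure ?P G \<le> C"
      unfolding C_def
      by (rule deterministic_converse[where S = "\<lambda>x y. transcript_of \<sigma> ((x, y), u, a, b)"
          and ?f1.0 = "\<lambda>x. f1 x a u" and ?f2.0 = "\<lambda>y. f2 y b u"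
          and ?msg1.0 = "\<lambda>x h. message_of (party1 \<sigma>) x a u h" and ?cb1.0 = "\<lambda>x h. codebook_of (party1 \<sigma>) x a u h"
          and ?msg2.0 = "\<lambda>y h. message_of (party2 \<sigma>) y b u h" and ?cb2.0 = "\<lambda>y h. codebook_of (party2 \<sigma>) y b u h"])
        (rule finite_subset[OF _ fin] G proper_compatible; simp add: G_def)+
    then show ?thesis
      by (simp add: G_def measure_pmf.emeasure_eq_measure measure_Int_set_pmf ennreal_leI)
  qed
  have EZ: "E - Z \<in> sets M" using E Z by auto
  have "emeasure M E = emeasure M (E - Z)"
    using E Z by (simp add: emeasure_Diff_null_set)
  also have "\<dots> = (\<integral>\<^sup>+r. emeasure (measure_pmf ?P) ((\<lambda>z. (z, r)) -` (E - Z)) \<partial>N)"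
    using EZ unfolding MN by (rule PN.emeasure_pair_measure_alt2)
  also have "\<dots> \<le> (\<integral>\<^sup>+r. ennreal C \<partial>N)"
    by (intro nn_integral_mono section_bound)
  also have "\<dots> = ennreal C" by (simp add: N.emeasure_space_1)
  finally have ME: "measure M E \<le> C"
    by (simp add: M.emeasure_eq_measure C_def)
  have "prob_space (distr M (count_space UNIV) ?out)" by (rule M.prob_space_distr[OF meas_out])
  then obtain q where q: "measure_pmf q = distr M (count_space UNIV) ?out"
    by (rule prob_space_countable_pmf) simp
  have p: "distr Q (count_space UNIV) (\<lambda>(\<tau>, x, y). (\<tau>, \<tau>, x, y)) = measure_pmf (map_pmf (\<lambda>(\<tau>, x, y). (\<tau>, \<tau>, x, y)) Q)"
    by (simp add: map_pmf_rep_eq)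
  have "measure_pmf.prob (map_pmf (\<lambda>(\<tau>, x, y). (\<tau>, \<tau>, x, y)) Q) T - measure_pmf.prob q T \<le> \<epsilon>"
    using order_trans[OF measure_diff_le_d_var dv[unfolded p q[symmetric]]] .
  moreover have "measure_pmf.prob q T = measure M E"
    unfolding q E_def by (rule measure_distr[OF meas_out]) simp
  moreover have "measure_pmf.prob (map_pmf (\<lambda>(\<tau>, x, y). (\<tau>, \<tau>, x, y)) Q) T = measure_pmf.prob Q (high_density l Q)"
  proof -
    have "(\<lambda>(\<tau>, x, y). (\<tau>, \<tau>, x, y)) -` T = high_density l Q" by (auto simp: T_def)
    then show ?thesis by simp
  qed
  ultimately show ?thesis using ME by (simp add: C_def)
qed

section \<open>Transmitting one message with shared randomness\<close>

primrec list_pmf :: "'a pmf list \<Rightarrow> 'a list pmf" where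
  "list_pmf [] = return_pmf []"
| "list_pmf (p # ps) = map_pmf (\<lambda>(x, xs). x # xs) (pair_pmf p (list_pmf ps))"

lemma prob_mono_support:
  "(\<And>x. x \<in> set_pmf p \<Longrightarrow> x \<in> A \<Longrightarrow> x \<in> B) \<Longrightarrow> measure_pmf.prob p A \<le> measure_pmf.prob p B"
  by (intro measure_pmf.finite_measure_mono_AE AE_pmfI) auto

lemma prob_pair_pmf_Times:
  "measure_pmf.prob (pair_pmf p q) (A \<times> B) = measure_pmf.prob p A * measure_pmf.prob q B"
proof -
  have "measure_pmf.prob (pair_pmf p q) (A \<times> B)
      = measure_pmf.prob (pair_pmf p q) ((A \<times> B) \<inter> set_pmf (pair_pmf p q))"
    by (simp only: measure_Int_set_pmf)
  also have "(A \<times> B) \<inter> set_pmf (pair_pmf p q) = (A \<inter> set_pmf p) \<times> (B \<inter> set_pmf q)"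
    by auto
  also have "measure_pmf.prob (pair_pmf p q) \<dots> = measure_pmf.prob p (A \<inter> set_pmf p) * measure_pmf.prob q (B \<inter> set_pmf q)"
    by (rule measure_pmf_prob_product) (auto intro: countable_subset[OF Int_lower2 countable_set_pmf])
  finally show ?thesis by (simp only: measure_Int_set_pmf)
qed

lemma prob_list_pmf:
  "measure_pmf.prob (list_pmf ps) {xs. length xs = length ps \<and> (\<forall>i<length ps. xs ! i \<in> E i)}
    = (\<Prod>i<length ps. measure_pmf.prob (ps ! i) (E i))"
proof (induction ps arbitrary: E)
  case (Cons p ps)
  have eq: "(\<lambda>(x, xs). x # xs) -` {xs. length xs = length (p # ps) \<and> (\<forall>i<length (p # ps). xs ! i \<in> E i)}
    = E 0 \<times> {xs. length xs = length ps \<and> (\<forall>i<length ps. xs ! i \<in> E (Suc i))}"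
    by (auto simp: nth_Cons less_Suc_eq_0_disj split: nat.splits)
  have "measure_pmf.prob (list_pmf (p # ps)) {xs. length xs = length (p # ps) \<and> (\<forall>i<length (p # ps). xs ! i \<in> E i)}
    = measure_pmf.prob p (E 0) * measure_pmf.prob (list_pmf ps) {xs. length xs = length ps \<and> (\<forall>i<length ps. xs ! i \<in> E (Suc i))}"
    unfolding list_pmf.simps measure_map_pmf eq
    by (rule prob_pair_pmf_Times)
  also have "\<dots> = (\<Prod>i<length (p # ps). measure_pmf.prob ((p # ps) ! i) (E i))"
    by (simp add: Cons.IH prod.lessThan_Suc_shift del: prod.lessThan_Suc)
  finally show ?case .
qed simp

lemma pmf_list_pmf:
  assumes "length xs = length ps"
  shows "pmf (list_pmf ps) xs = (\<Prod>i<length ps. pmf (ps ! i) (xs ! i))"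
proof -
  have "pmf (list_pmf ps) xs = measure_pmf.prob (list_pmf ps) {xs}"
    by (simp add: measure_pmf_single)
  also have "{xs} = {ys. length ys = length ps \<and> (\<forall>i<length ps. ys ! i \<in> {xs ! i})}"
    using assms by (auto intro: nth_equalityI)
  also have "measure_pmf.prob (list_pmf ps) \<dots> = (\<Prod>i<length ps. measure_pmf.prob (ps ! i) {xs ! i})"
    by (rule prob_list_pmf)
  finally show ?thesis by (simp add: measure_pmf_single)
qed

lemma replicate_pmf_conv_list_pmf: "replicate_pmf n p = list_pmf (replicate n p)"
  by (induction n) (auto simp: map_pmf_def pair_pmf_def bind_assoc_pmf bind_return_pmf)

lemma pmf_replicate_pmf: "length xs = n \<Longrightarrow> pmf (replicate_pmf n p) xs = (\<Prod>i<n. pmf p (xs ! i))"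
  by (simp add: replicate_pmf_conv_list_pmf pmf_list_pmf)

section \<open>Uniformly random orderings\<close>

abbreviation random_order :: "'a set \<Rightarrow> 'a list pmf" where
  "random_order S \<equiv> pmf_of_set (permutations_of_set S)"

lemma filter_random_order:
  assumes "finite S" "A \<subseteq> S"
  shows "map_pmf (filter (\<lambda>z. z \<in> A)) (random_order S) = random_order A"
proof -
  have "map_pmf (filter (\<lambda>z. z \<in> A)) (random_order S)
      = map_pmf fst (map_pmf (partition (\<lambda>z. z \<in> A)) (random_order S))"
    by (simp add: map_pmf_comp)
  also have "\<dots> = random_order {z \<in> S. z \<in> A}"
    by (simp add: partition_random_permutations[OF assms(1)] map_fst_pair_pmf)
  also have "{z \<in> S. z \<in> A} = A" using assms by auto
  finally show ?thesis .
qed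

definition first_in :: "'a set \<Rightarrow> 'a list \<Rightarrow> 'a" where
  "first_in A xs = hd (filter (\<lambda>z. z \<in> A) xs)"

lemma card_Cons_permutations:
  assumes "finite A" "a \<in> A"
  shows "card ((#) a ` permutations_of_set (A - {a})) = fact (card A - 1)"
    "(#) a ` permutations_of_set (A - {a}) \<subseteq> permutations_of_set A"
proof -
  have "card ((#) a ` permutations_of_set (A - {a})) = card (permutations_of_set (A - {a}))"
    by (rule card_image) simp
  also have "\<dots> = fact (card (A - {a}))"
    by (rule card_permutations_of_set) (use assms in simp)
  finally show "card ((#) a ` permutations_of_set (A - {a})) = fact (card A - 1)"
    by (simp only: card_Diff_singleton[OF assms(2)])
  show "(#) a ` permutations_of_set (A - {a}) \<subseteq> permutations_of_set A"
  proof clarify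
    fix ys assume "ys \<in> permutations_of_set (A - {a})"
    then have "set ys = A - {a}" "distinct ys" by (simp_all add: permutations_of_set_def)
    then show "a # ys \<in> permutations_of_set A"
      using insert_Diff[OF assms(2)] by (simp add: permutations_of_set_def)
  qed
qed

text \<open>The order induced on \<open>A\<close> is uniform, and a fraction
  \<open>1 / card A\<close> of the orders of \<open>A\<close> begins with \<open>a\<close>.\<close>

lemma prob_first_in:
  assumes "finite S" "A \<subseteq> S" "a \<in> A"
  shows "measure_pmf.prob (random_order S) {xs. first_in A xs = a} = 1 / card A"
proof -
  have fin: "finite A" using assms finite_subset by auto
  have "measure_pmf.prob (random_order S) {xs. first_in A xs = a} = measure_pmf.prob (random_order A) {xs. hd xs = a}"
    unfolding filter_random_order[OF assms(1,2), symmetric] measure_map_pmf by (simp add: first_in_def vimage_def)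
  also have "\<dots> = card (permutations_of_set A \<inter> {xs. hd xs = a}) / card (permutations_of_set A)"
    using fin by (intro measure_pmf_of_set) (auto simp: permutations_of_set_empty_iff)
  also have "permutations_of_set A \<inter> {xs. hd xs = a} = (#) a ` permutations_of_set (A - {a})"
  proof (intro equalityI subsetI)
    fix xs assume xs: "xs \<in> permutations_of_set A \<inter> {xs. hd xs = a}"
    then obtain ys where "xs = a # ys" using assms(3) by (cases xs) (auto simp: permutations_of_set_def)
    with xs show "xs \<in> (#) a ` permutations_of_set (A - {a})" by (auto simp: permutations_of_set_def)
  qed (use card_Cons_permutations(2)[OF fin assms(3)] in auto)
  also have "card ((#) a ` permutations_of_set (A - {a})) / card (permutations_of_set A) = 1 / card A"
  proof -
    have "card A > 0" using fin assms(3) by (auto simp: card_gt_0_iff)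
    then have "fact (card A) = real (card A) * fact (card A - 1)" by (rule fact_reduce)
    then show ?thesis using card_Cons_permutations(1)[OF fin assms(3)] fin by simp
  qed
  finally show ?thesis .
qed

text \<open>The event says that \<open>b\<close> precedes all of \<open>A\<close> and that
  \<open>a\<close> is the first element of \<open>A\<close>. The order induced on
  \<open>insert b A\<close> is uniform and has its first two entries prescribed.\<close>

lemma prob_first_two:
  assumes "finite S" "A \<subseteq> S" "a \<in> A" "b \<in> S - A"
  shows "measure_pmf.prob (random_order S) {xs. \<exists>ys. filter (\<lambda>z. z \<in> insert b A) xs = b # a # ys}
    = 1 / (real (card A + 1) * card A)"
proof -
  let ?B = "insert b A"
  have fin: "finite A" using assms finite_subset by auto
  have "measure_pmf.prob (random_order S) {xs. \<exists>ys. filter (\<lambda>z. z \<in> ?B) xs = b # a # ys}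
      = measure_pmf.prob (random_order ?B) {xs. \<exists>ys. xs = b # a # ys}"
    using assms by (subst filter_random_order[of S ?B, symmetric]) (auto simp: vimage_def)
  also have "\<dots> = card (permutations_of_set ?B \<inter> {xs. \<exists>ys. xs = b # a # ys}) / card (permutations_of_set ?B)"
    using fin by (intro measure_pmf_of_set) (auto simp: permutations_of_set_empty_iff)
  also have "permutations_of_set ?B \<inter> {xs. \<exists>ys. xs = b # a # ys}
      = (\<lambda>ys. b # a # ys) ` permutations_of_set (A - {a})"
  proof (intro equalityI subsetI)
    fix xs assume "xs \<in> permutations_of_set ?B \<inter> {xs. \<exists>ys. xs = b # a # ys}"
    then obtain ys where ys: "xs = b # a # ys" "distinct (b # a # ys)" "set (b # a # ys) = insert b A"
      by (auto simp: permutations_of_set_def)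
    then have "set ys = A - {a}" using assms(4) by auto
    then show "xs \<in> (\<lambda>ys. b # a # ys) ` permutations_of_set (A - {a})"
      using ys by (auto simp: permutations_of_set_def)
  next
    fix xs assume "xs \<in> (\<lambda>ys. b # a # ys) ` permutations_of_set (A - {a})"
    then obtain ys where ys: "xs = b # a # ys" "distinct ys" "set ys = A - {a}"
      by (auto simp: permutations_of_set_def)
    then show "xs \<in> permutations_of_set ?B \<inter> {xs. \<exists>ys. xs = b # a # ys}"
      using assms(3,4) insert_Diff[OF assms(3)] by (auto simp: permutations_of_set_def)
  qed
  also have "card \<dots> = fact (card A - 1)"
    using fin assms(3) by (subst card_image) (auto simp: inj_on_def)
  also have "real (fact (card A - 1)) / card (permutations_of_set ?B) = 1 / (real (card A + 1) * card A)"
  proof -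
    have "card A > 0" using fin assms(3) by (auto simp: card_gt_0_iff)
    then have "fact (card A) = real (card A) * fact (card A - 1)" by (rule fact_reduce)
    moreover have "card (permutations_of_set ?B) = fact (Suc (card A))"
      using fin assms(4) by simp
    ultimately have "real (card (permutations_of_set ?B)) = (real (card A + 1) * card A) * fact (card A - 1)"
      by (simp only: fact_Suc of_nat_mult of_nat_fact) simp
    then show ?thesis by simp
  qed
  finally show ?thesis .
qed

text \<open>Some element of \<open>B\<close> precedes \<open>a\<close>. It lies outside
  \<open>A\<close>, whose first element is \<open>a\<close>, and so it precedes all of
  \<open>A\<close>.\<close>

lemma first_in_race:
  assumes "distinct xs" "a \<in> set xs" "a \<in> A" "a \<in> B" "first_in A xs = a" "first_in B xs \<noteq> a"
  shows "\<exists>b\<in>B - A. \<exists>ys. filter (\<lambda>z. z \<in> insert b A) xs = b # a # ys"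
proof -
  obtain us vs where xs: "xs = us @ a # vs" using assms(2) by (meson split_list)
  have a: "a \<notin> set us" using assms(1) xs by auto
  have us: "set us \<inter> A = {}"
  proof (rule ccontr)
    assume "set us \<inter> A \<noteq> {}"
    then have "filter (\<lambda>z. z \<in> A) us \<noteq> []" by (auto simp: filter_empty_conv)
    then have "first_in A xs \<in> set (filter (\<lambda>z. z \<in> A) us)"
      using hd_in_set by (fastforce simp: first_in_def xs)
    then show False using assms(5) a by auto
  qed
  have ne: "filter (\<lambda>z. z \<in> B) us \<noteq> []"
    using assms(4,6) by (auto simp: first_in_def xs)
  define b where "b = hd (filter (\<lambda>z. z \<in> B) us)"
  have "b \<in> set (filter (\<lambda>z. z \<in> B) us)" unfolding b_def by (rule hd_in_set[OF ne])
  then have b: "b \<in> B" "b \<in> set us" by auto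
  then have "b \<notin> A" using us by auto
  obtain us1 us2 where us12: "us = us1 @ b # us2" using b(2) by (meson split_list)
  have "filter (\<lambda>z. z \<in> insert b A) us1 = []" "filter (\<lambda>z. z \<in> insert b A) us2 = []"
    using us assms(1) by (auto simp: filter_empty_conv us12 xs)
  then have "filter (\<lambda>z. z \<in> insert b A) xs = b # a # filter (\<lambda>z. z \<in> insert b A) vs"
    using assms(3) by (simp add: xs us12)
  then show ?thesis using b \<open>b \<notin> A\<close> by blast
qed

section \<open>Random hashing and decoding of the selected element\<close>

definition random_hash :: "nat \<Rightarrow> 'a set \<Rightarrow> ('a \<Rightarrow> bool list) pmf" where
  "random_hash k S = Pi_pmf S undefined (\<lambda>_. pmf_of_set {b. length b = k})"

lemma bool_lists_length: "finite {b :: bool list. length b = k}" "card {b :: bool list. length b = k} = 2 ^ k"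
  "{b :: bool list. length b = k} \<noteq> {}"
  using card_lists_length_eq[of "UNIV :: bool set" k] finite_lists_length_eq[of "UNIV :: bool set" k]
  by (auto intro: exI[of _ "replicate k True"])

text \<open>Given all other hash values, the value at \<open>a\<close> is uniform on the
  \<open>2 ^ k\<close> strings and hits the value at \<open>b\<close> with probability
  \<open>(1/2) ^ k\<close>.\<close>

lemma prob_random_hash_eq:
  assumes "finite S" "a \<in> S" "b \<in> S" "a \<noteq> b"
  shows "measure_pmf.prob (random_hash k S) {g. g a = g b} = (1/2) ^ k"
proof -
  let ?U = "pmf_of_set {b :: bool list. length b = k}"
  have S: "S = insert a (S - {a})" using assms by auto
  have "random_hash k S = map_pmf (\<lambda>(y, f). f(a := y)) (pair_pmf ?U (random_hash k (S - {a})))"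
    unfolding random_hash_def using assms by (subst S, subst Pi_pmf_insert) auto
  also have "\<dots> = bind_pmf (random_hash k (S - {a})) (\<lambda>f. map_pmf (\<lambda>y. f(a := y)) ?U)"
    by (subst pair_commute_pmf) (simp add: pair_pmf_def map_pmf_def bind_assoc_pmf bind_return_pmf)
  finally have eq: "random_hash k S = bind_pmf (random_hash k (S - {a})) (\<lambda>f. map_pmf (\<lambda>y. f(a := y)) ?U)" .
  have "emeasure (random_hash k S) {g. g a = g b}
      = (\<integral>\<^sup>+f. emeasure (map_pmf (\<lambda>y. f(a := y)) ?U) {g. g a = g b} \<partial>random_hash k (S - {a}))"
    by (simp only: eq emeasure_bind_pmf)
  also have "\<dots> = (\<integral>\<^sup>+f. ennreal ((1/2) ^ k) \<partial>random_hash k (S - {a}))"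
  proof (intro nn_integral_cong_AE AE_pmfI)
    fix f assume "f \<in> set_pmf (random_hash k (S - {a}))"
    then have "f b \<in> {b. length b = k}"
      using assms bool_lists_length by (auto simp: random_hash_def set_Pi_pmf PiE_dflt_def)
    then have "measure_pmf.prob ?U {f b} = (1/2) ^ k"
      using bool_lists_length[of k] by (simp add: measure_pmf_single power_one_over)
    moreover have "(\<lambda>y. f(a := y)) -` {g. g a = g b} = {f b}" using assms(4) by auto
    ultimately show "emeasure (map_pmf (\<lambda>y. f(a := y)) ?U) {g. g a = g b} = ennreal ((1/2) ^ k)"
      by (simp add: measure_pmf.emeasure_eq_measure)
  qed
  finally show ?thesis
    by (simp add: measure_pmf.emeasure_eq_measure)
qed

type_synonym 'a seed = "'a list \<times> ('a \<Rightarrow> bool list)"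

definition random_seed :: "nat \<Rightarrow> 'a set \<Rightarrow> 'a seed pmf" where
  "random_seed k S = pair_pmf (random_order S) (random_hash k S)"

text \<open>An error of the listener needs a competitor \<open>b\<close> outside \<open>A\<close>
  that both precedes \<open>a\<close> and shares its hash. Order and hashes are independent, so the
  two small probabilities are multiplied before the union bound over \<open>B - A\<close>. The
  factor \<open>1 / card A\<close> occurs in the success and in the failure term, so the loss is
  relative to the probability of selecting \<open>a\<close>.\<close>

lemma prob_hash_decoding:
  assumes "finite S" "A \<subseteq> S" "B \<subseteq> S" "a \<in> A" "a \<in> B"
  shows "measure_pmf.prob (random_seed k S) {(xs, g). first_in A xs = a \<and> first_in {z \<in> B. g z = g a} xs = a}
    \<ge> 1 / card A * (1 - card B * (1/2) ^ k / (card A + 1))"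
proof -
  let ?R = "random_seed k S"
  define bad where "bad b = {xs. \<exists>ys. filter (\<lambda>z. z \<in> insert b A) xs = b # a # ys} \<times> {g :: 'a \<Rightarrow> bool list. g a = g b}" for b
  have finB: "finite B" using assms finite_subset by auto
  have fin_perm: "set_pmf (random_order S) = permutations_of_set S"
    using assms by (intro set_pmf_of_set) (auto simp: permutations_of_set_empty_iff)
  have prod: "measure_pmf.prob ?R (E \<times> F) = measure_pmf.prob (random_order S) E * measure_pmf.prob (random_hash k S) F" for E F
    unfolding random_seed_def by (rule prob_pair_pmf_Times)
  have bad: "measure_pmf.prob ?R (bad b) = 1 / (real (card A + 1) * card A) * (1/2) ^ k" if "b \<in> B - A" for b
  proof -
    have "b \<in> S - A" "a \<noteq> b" "a \<in> S" using that assms by auto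
    then show ?thesis unfolding bad_def prod
      using prob_first_two[OF assms(1,2,4), of b] prob_random_hash_eq[OF assms(1), of a b k] assms by simp
  qed
  have "1 / card A = measure_pmf.prob ?R ({xs. first_in A xs = a} \<times> UNIV)"
    unfolding prod using prob_first_in[OF assms(1,2,4)] by simp
  also have "\<dots> \<le> measure_pmf.prob ?R ({(xs, g). first_in A xs = a \<and> first_in {z \<in> B. g z = g a} xs = a} \<union> (\<Union>b\<in>B - A. bad b))"
  proof (rule prob_mono_support)
    fix r assume r: "r \<in> set_pmf ?R" "r \<in> {xs. first_in A xs = a} \<times> UNIV"
    obtain xs g where rr: "r = (xs, g)" by fastforce
    have xs: "xs \<in> permutations_of_set S" using r fin_perm by (auto simp: rr random_seed_def)
    then have "distinct xs" "a \<in> set xs" using assms by (auto simp: permutations_of_set_def)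
    moreover have "first_in A xs = a" using r by (simp add: rr)
    ultimately have "first_in {z \<in> B. g z = g a} xs \<noteq> a \<Longrightarrow>
      \<exists>b\<in>{z \<in> B. g z = g a} - A. \<exists>ys. filter (\<lambda>z. z \<in> insert b A) xs = b # a # ys"
      using assms by (intro first_in_race) auto
    note race = this
    show "r \<in> {(xs, g). first_in A xs = a \<and> first_in {z \<in> B. g z = g a} xs = a} \<union> (\<Union>b\<in>B - A. bad b)"
    proof (cases "first_in {z \<in> B. g z = g a} xs = a")
      case True
      then show ?thesis using \<open>first_in A xs = a\<close> by (simp add: rr)
    next
      case False
      then obtain b ys where b: "b \<in> {z \<in> B. g z = g a} - A" "filter (\<lambda>z. z \<in> insert b A) xs = b # a # ys"
        using race by blast
      then have "r \<in> bad b" by (simp add: rr bad_def)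
      then show ?thesis using b by blast
    qed
  qed
  also have "\<dots> \<le> measure_pmf.prob ?R {(xs, g). first_in A xs = a \<and> first_in {z \<in> B. g z = g a} xs = a}
      + measure_pmf.prob ?R (\<Union>b\<in>B - A. bad b)"
    by (rule measure_Un_le) auto
  also have "measure_pmf.prob ?R (\<Union>b\<in>B - A. bad b) \<le> (\<Sum>b\<in>B - A. measure_pmf.prob ?R (bad b))"
    using finB by (intro measure_pmf.finite_measure_subadditive_finite) auto
  also have "\<dots> = card (B - A) * (1 / (real (card A + 1) * card A) * (1/2) ^ k)"
    by (simp add: bad)
  also have "\<dots> \<le> card B * (1 / (real (card A + 1) * card A) * (1/2) ^ k)"
    using finB by (intro mult_right_mono) (auto intro: card_mono)
  finally show ?thesis by (simp add: algebra_simps)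
qed

section \<open>Selecting a cell below the graph of a distribution\<close>

definition cells :: "'s set \<Rightarrow> nat \<Rightarrow> ('s \<times> nat) set" where
  "cells M T = M \<times> {..<T}"

text \<open>A cell counts only if its upper edge is below the graph, so column \<open>m\<close> has
  \<open>floor (T * f m)\<close> cells, cut off at 0 and \<open>T\<close>.\<close>

definition below :: "'s set \<Rightarrow> nat \<Rightarrow> ('s \<Rightarrow> real) \<Rightarrow> ('s \<times> nat) set" where
  "below M T f = {(m, t) \<in> cells M T. real t + 1 \<le> T * f m}"

text \<open>The default string covers cells on which the hash has a wrong length: every message has
  exactly \<open>k\<close> bits, so that the codebook is known in advance. The second component is
  the selected value, which the speaker keeps as its new state.\<close>

definition send :: "nat \<Rightarrow> 's set \<Rightarrow> nat \<Rightarrow> 's pmf \<Rightarrow> ('s \<times> nat) seed \<Rightarrow> bool list \<times> 's" where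
  "send k M T w r = (let z = first_in (below M T (pmf w)) (fst r); b = snd r z
     in (if length b = k then b else replicate k False, fst z))"

text \<open>The listener knows the hash \<open>b\<close> but not \<open>w\<close>. Raising its graph
  by the factor \<open>c\<close> puts the speaker's cell among the candidates whenever
  \<open>w <= c v\<close> at the selected value.\<close>

definition receive :: "'s set \<Rightarrow> nat \<Rightarrow> real \<Rightarrow> 's pmf \<Rightarrow> ('s \<times> nat) seed \<Rightarrow> bool list \<Rightarrow> 's" where
  "receive M T c v r b = fst (first_in {z \<in> below M T (\<lambda>m. c * pmf v m). snd r z = b} (fst r))"

lemma length_send: "length (fst (send k M T w r)) = k"
  by (simp add: send_def Let_def)

definition column :: "nat \<Rightarrow> real \<Rightarrow> nat set" where
  "column T q = {t. t < T \<and> real t + 1 \<le> T * q}"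

lemma column_eq: "column T q = {..< min T (nat \<lfloor>T * q\<rfloor>)}"
proof -
  have "real t + 1 \<le> T * q \<longleftrightarrow> t < nat \<lfloor>T * q\<rfloor>" for t
    by linarith
  then show ?thesis unfolding column_def lessThan_def min_less_iff_conj by blast
qed

lemma finite_column: "finite (column T q)"
  by (simp add: column_eq)

lemma card_column_le:
  assumes "(q :: real) \<ge> 0"
  shows "real (card (column T q)) \<le> T * q"
proof -
  have "card (column T q) \<le> nat \<lfloor>T * q\<rfloor>" unfolding column_eq by simp
  moreover have "real (nat \<lfloor>T * q\<rfloor>) \<le> T * q" using assms by simp
  ultimately show ?thesis by linarith
qed

lemma card_column_ge:
  assumes "(q :: real) \<ge> 0" "q \<le> 1"
  shows "real (card (column T q)) \<ge> T * q - 1"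
proof -
  have "T * q \<le> T" using assms by (simp add: mult_left_le)
  then have "nat \<lfloor>T * q\<rfloor> \<le> T" by linarith
  then have "card (column T q) = nat \<lfloor>T * q\<rfloor>" by (simp add: column_eq min_absorb2)
  then show ?thesis by linarith
qed

lemma card_below:
  assumes "finite M"
  shows "card (below M T f) = (\<Sum>m\<in>M. card (column T (f m)))"
proof -
  have "below M T f = Sigma M (\<lambda>m. column T (f m))"
    by (auto simp: below_def cells_def column_def)
  then show ?thesis using assms finite_column by (simp add: card_SigmaI)
qed

text \<open>There are two relative losses. Rounding to whole cells costs \<eta>, since one cell is
  at most an \<eta> fraction of \<open>T * pmf w m\<close>. Collisions cost about
  \<open>card B / card A / 2 ^ k\<close>, at most \<open>2 * c / 2 ^ k\<close> because
  \<open>card B <= c * T\<close> and \<open>card A >= T / 2\<close>. The bound is proportional to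
  \<open>pmf w m\<close>, so that it can be multiplied along a path.\<close>

lemma transmission:
  fixes w v :: "'s pmf"
  assumes M: "finite M" "m \<in> M" "measure_pmf.prob w M \<ge> 3/4"
    and T: "4 * card M \<le> T" "1 \<le> \<eta> * (T * pmf w m)"
    and wv: "pmf w m \<le> c * pmf v m" and c: "c \<ge> 0"
  shows "measure_pmf.prob (random_seed k (cells M T))
      {r. snd (send k M T w r) = m \<and> receive M T c v r (fst (send k M T w r)) = m}
    \<ge> pmf w m * (1 - \<eta> - 2 * c / 2 ^ k)"
proof -
  define S where "S = cells M T"
  define A where "A = below M T (pmf w)"
  define B where "B = below M T (\<lambda>m. c * pmf v m)"
  let ?R = "random_seed k S"
  let ?E = "{r. snd (send k M T w r) = m \<and> receive M T c v r (fst (send k M T w r)) = m}"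
  have finS: "finite S" using M by (simp add: S_def cells_def)
  have AS: "A \<subseteq> S" and BS: "B \<subseteq> S" by (auto simp: A_def B_def S_def below_def)
  have finA: "finite A" using AS finS finite_subset by auto
  have cardM: "card M \<ge> 1" using M by (metis One_nat_def Suc_leI card_gt_0_iff empty_iff)
  then have T0: "T > 0" using T by linarith
  have wpos: "pmf w m > 0" using T(2) by (cases "pmf w m = 0") (auto simp: pmf_pos pmf_eq_0_set_pmf[symmetric] less_le)
  have "\<eta> * (T * pmf w m) > 0" using T(2) by linarith
  then have \<eta>: "\<eta> > 0" using T0 wpos by (auto simp: zero_less_mult_iff mult_less_0_iff)
  have "card A \<le> (\<Sum>m\<in>M. T * pmf w m)"
    unfolding A_def card_below[OF M(1)] of_nat_sum by (intro sum_mono card_column_le) auto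
  also have "\<dots> = T * measure_pmf.prob w M"
    using M by (simp add: sum_distrib_left measure_measure_pmf_finite)
  also have "\<dots> \<le> T" by (simp add: mult_left_le)
  finally have A_le: "card A \<le> T" by simp
  \<comment> \<open>Of the mass 3/4 at most one cell per element of \<open>M\<close> is lost by
    rounding, which is at most \<open>T / 4\<close> cells in all.\<close>
  have "T / 2 \<le> T * measure_pmf.prob w M - card M"
    using T(1) mult_left_mono[OF M(3), of "real T"] by linarith
  also have "\<dots> = (\<Sum>m\<in>M. T * pmf w m - 1)"
    using M by (simp add: sum_distrib_left measure_measure_pmf_finite sum_subtractf)
  also have "\<dots> \<le> card A"
    unfolding A_def card_below[OF M(1)] of_nat_sum by (intro sum_mono card_column_ge) (auto simp: pmf_le_1)
  finally have A_ge: "T / 2 \<le> card A" .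
  have "card B \<le> (\<Sum>m\<in>M. T * (c * pmf v m))"
    unfolding B_def card_below[OF M(1)] of_nat_sum using c by (intro sum_mono card_column_le) auto
  also have "\<dots> = T * c * measure_pmf.prob v M"
    using M by (simp add: sum_distrib_left measure_measure_pmf_finite mult.assoc)
  also have "\<dots> \<le> T * c" using c by (simp add: mult_left_le)
  finally have B_le: "card B \<le> T * c" .
  define q where "q = card B * (1/2) ^ k / (card A + 1)"
  have q_le: "q \<le> 2 * c / 2 ^ k"
  proof -
    have "q \<le> (T * c) * (1/2) ^ k / (T / 2)"
      unfolding q_def using B_le A_ge T0 c by (intro frac_le mult_right_mono) auto
    then show ?thesis using T0 by (simp add: power_one_over field_simps)
  qed
  define a where "a t = (m, t)" for t :: nat
  let ?C = "column T (pmf w m)"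
  define F where "F t = {(xs, g :: 's \<times> nat \<Rightarrow> bool list). first_in A xs = a t \<and> first_in {z \<in> B. g z = g (a t)} xs = a t}" for t
  have aAB: "a t \<in> A" "a t \<in> B" if "t \<in> ?C" for t
  proof -
    show "a t \<in> A" using that M by (auto simp: A_def a_def below_def cells_def column_def)
    have "T * pmf w m \<le> T * (c * pmf v m)" using wv by (intro mult_left_mono) auto
    moreover have "t < T" "real t + 1 \<le> T * pmf w m" using that by (auto simp: column_def)
    ultimately have "t < T" "real t + 1 \<le> T * (c * pmf v m)" by linarith+
    then show "a t \<in> B" using M by (simp add: B_def a_def below_def cells_def)
  qed
  have F: "measure_pmf.prob ?R (F t) \<ge> 1 / card A * (1 - q)" if "t \<in> ?C" for t
    unfolding F_def q_def using prob_hash_decoding[OF finS AS BS aAB[OF that]] by simp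
  \<comment> \<open>The value \<open>m\<close> is transmitted correctly if both parties select the
    same cell of its column. These events are disjoint for different cells, so their probabilities
    add up.\<close>
  have "card ?C * (1 / card A * (1 - q)) = (\<Sum>t\<in>?C. 1 / card A * (1 - q))" by simp
  also have "\<dots> \<le> (\<Sum>t\<in>?C. measure_pmf.prob ?R (F t))" by (intro sum_mono F)
  also have "\<dots> = measure_pmf.prob ?R (\<Union>t\<in>?C. F t)"
    by (rule measure_pmf.finite_measure_finite_Union[symmetric])
      (auto simp: finite_column F_def a_def disjoint_family_on_def)
  also have "\<dots> \<le> measure_pmf.prob ?R ?E"
  proof (rule prob_mono_support)
    fix r assume r: "r \<in> set_pmf ?R" "r \<in> (\<Union>t\<in>?C. F t)"
    then obtain t where t: "t \<in> ?C" "r \<in> F t" by auto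
    obtain xs g where rr: "r = (xs, g)" by fastforce
    have "g \<in> set_pmf (random_hash k S)" using r by (simp add: rr random_seed_def)
    then have "length (g (a t)) = k"
      using subsetD[OF AS aAB(1)[OF t(1)]] finS bool_lists_length[of k] by (auto simp: a_def random_hash_def set_Pi_pmf PiE_dflt_def)
    then show "r \<in> ?E"
      using t by (simp add: rr F_def send_def receive_def A_def[symmetric] B_def[symmetric] Let_def) (simp add: a_def)
  qed
  finally have main: "card ?C * (1 / card A * (1 - q)) \<le> measure_pmf.prob ?R ?E" .
  show ?thesis
  \<comment> \<open>A nonpositive right-hand side is trivial; otherwise all factors below are
    nonnegative and the estimates can be multiplied.\<close>
  proof (cases "1 - \<eta> - 2 * c / 2 ^ k \<le> 0")
    case True
    then have "pmf w m * (1 - \<eta> - 2 * c / 2 ^ k) \<le> 0" by (simp add: mult_nonneg_nonpos)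
    then show ?thesis using measure_nonneg order_trans by blast
  next
    case False
    then have q1: "1 - q \<ge> 0" "\<eta> < 1" using q_le \<eta> c
      by (auto, smt (verit) divide_nonneg_nonneg zero_le_power)
    have q0: "q \<ge> 0" by (simp add: q_def)
    have C_ge: "card ?C \<ge> T * pmf w m * (1 - \<eta>)"
      using card_column_ge[of "pmf w m" T] T(2) by (simp add: pmf_le_1 algebra_simps)
    have "pmf w m * (1 - \<eta> - 2 * c / 2 ^ k) \<le> pmf w m * ((1 - \<eta>) * (1 - q))"
    proof (intro mult_left_mono)
      have "\<eta> * q \<ge> 0" using \<eta> q0 by simp
      then show "1 - \<eta> - 2 * c / 2 ^ k \<le> (1 - \<eta>) * (1 - q)"
        using q_le by (simp add: algebra_simps)
    qed simp
    also have "\<dots> = (T * pmf w m * (1 - \<eta>)) * (1 / T * (1 - q))"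
      using T0 by simp
    also have "\<dots> \<le> card ?C * (1 / card A * (1 - q))"
      using C_ge A_le A_ge q1 T0 wpos by (intro mult_mono mult_right_mono divide_left_mono) auto
    finally show ?thesis using main by (simp add: S_def)
  qed
qed

section \<open>Simulating protocols\<close>

primrec party_state :: "(nat \<Rightarrow> 's \<Rightarrow> message \<Rightarrow> 's) \<Rightarrow> 's \<Rightarrow> transcript \<Rightarrow> nat \<Rightarrow> 's" where
  "party_state up s0 h 0 = s0"
| "party_state up s0 h (Suc i) = up i (party_state up s0 h i) (h ! i)"

lemma party_state_take: "j \<le> i \<Longrightarrow> party_state up s0 (take i h) j = party_state up s0 h j"
  by (induction j) auto

text \<open>\<open>simulation_cost\<close> ranges over protocols with real-valued randomness. The
  support of a \<open>pmf\<close> is countable, so a sample can be passed as its number.\<close>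

definition encode :: "'z pmf \<Rightarrow> 'z \<Rightarrow> real" where
  "encode R z = real (to_nat_on (set_pmf R) z)"

definition decode :: "'z pmf \<Rightarrow> real \<Rightarrow> 'z" where
  "decode R u = from_nat_into (set_pmf R) (nat \<lfloor>u\<rfloor>)"

lemma decode_encode: "z \<in> set_pmf R \<Longrightarrow> decode R (encode R z) = z"
  by (simp add: encode_def decode_def from_nat_into_to_nat_on)

text \<open>A party of a protocol with \<open>d\<close> rounds in which the \<open>i\<close>-th message has \<open>k i\<close> bits.  It keeps a
  state that it updates after every message, and it reads its shared randomness off the public
  random number.\<close>

definition seeded_party :: "nat \<Rightarrow> (nat \<Rightarrow> nat) \<Rightarrow> 'z pmf \<Rightarrow> (nat \<Rightarrow> 'z \<Rightarrow> 'i \<Rightarrow> 's \<Rightarrow> message)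
    \<Rightarrow> (nat \<Rightarrow> 'z \<Rightarrow> 'i \<Rightarrow> 's \<Rightarrow> message \<Rightarrow> 's) \<Rightarrow> 's \<Rightarrow> ('i, real, real) party" where
  "seeded_party d k R sn up s0 =
     \<lparr>private_rand = measure_pmf (return_pmf 0),
      message_of = (\<lambda>x a u h. sn (length h) (decode R u) x
        (party_state (\<lambda>j. up j (decode R u) x) s0 h (length h))),
      codebook_of = (\<lambda>x a u h m. if length m = k (length h)
        then Some (if Suc (length h) < d then Continue else Stop) else None)\<rparr>"

definition seeded_protocol where
  "seeded_protocol d k R sn1 up1 sn2 up2 s0 =
     \<lparr>public_rand = measure_pmf (map_pmf (encode R) R),
      party1 = seeded_party d k R sn1 up1 s0,
      party2 = seeded_party d k R sn2 up2 s0\<rparr>"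

text \<open>The two states as a function of the inputs and the seed alone, bypassing the transcript;
  this makes the law of the outputs an image of the seed distribution.\<close>

primrec joint_state where
  "joint_state sn1 up1 sn2 up2 s0 x y z 0 = (s0, s0)"
| "joint_state sn1 up1 sn2 up2 s0 x y z (Suc i) =
    (let (s1, s2) = joint_state sn1 up1 sn2 up2 s0 x y z i;
         b = (if even i then sn1 i z x s1 else sn2 i z y s2)
     in (up1 i z x s1 b, up2 i z y s2 b))"

text \<open>The codebook of round \<open>i\<close> consists of all strings of length
  \<open>k i\<close>. It is therefore common to both parties and prefix-free whatever the parties
  compute, so every requirement on a protocol holds surely and only the correctness of the outputs
  is left.\<close>

locale seeded =
  fixes P :: "('x::countable \<times> 'y::countable) pmf" and d :: nat and k :: "nat \<Rightarrow> nat" and R :: "'z pmf"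
    and sn1 :: "nat \<Rightarrow> 'z \<Rightarrow> 'x \<Rightarrow> 's \<Rightarrow> message" and up1 :: "nat \<Rightarrow> 'z \<Rightarrow> 'x \<Rightarrow> 's \<Rightarrow> message \<Rightarrow> 's"
    and sn2 :: "nat \<Rightarrow> 'z \<Rightarrow> 'y \<Rightarrow> 's \<Rightarrow> message" and up2 :: "nat \<Rightarrow> 'z \<Rightarrow> 'y \<Rightarrow> 's \<Rightarrow> message \<Rightarrow> 's" and s0 :: 's
  assumes d: "d > 0"
    and len1: "\<And>i z x s. length (sn1 i z x s) = k i"
    and len2: "\<And>i z y s. length (sn2 i z y s) = k i"
begin

definition \<sigma> :: "('x, 'y, real, real, real) protocol" where
  "\<sigma> = seeded_protocol d k R sn1 up1 sn2 up2 s0"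

lemmas \<sigma>_defs = \<sigma>_def seeded_protocol_def seeded_party_def

lemma codebooks:
  "codebook1 \<sigma> \<omega> h m = (if length m = k (length h) then Some (if Suc (length h) < d then Continue else Stop) else None)"
  "codebook2 \<sigma> \<omega> h m = (if length m = k (length h) then Some (if Suc (length h) < d then Continue else Stop) else None)"
  by (cases \<omega>; auto simp: \<sigma>_defs)+

lemma length_sent: "length (sent_message \<sigma> \<omega> h) = k (length h)"
  by (cases \<omega>) (auto simp: \<sigma>_defs len1 len2)

primrec hist where
  "hist \<omega> 0 = []"
| "hist \<omega> (Suc i) = hist \<omega> i @ [sent_message \<sigma> \<omega> (hist \<omega> i)]"

lemma length_hist [simp]: "length (hist \<omega> i) = i"
  by (induction i) auto

lemma take_hist: "i \<le> j \<Longrightarrow> take i (hist \<omega> j) = hist \<omega> i"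
  by (induction j) (auto simp: le_Suc_eq)

lemma run_hist: "i \<le> d \<Longrightarrow> run \<sigma> \<omega> i = (hist \<omega> i, if i < d then Continue else Stop)"
proof (induction i)
  case 0
  then show ?case using d by simp
next
  case (Suc i)
  then have "run \<sigma> \<omega> i = (hist \<omega> i, Continue)" by simp
  then show ?case using Suc.prems by (simp add: Let_def codebooks length_sent)
qed

lemma transcript_hist: "transcript_of \<sigma> \<omega> = hist \<omega> d"
  by (rule transcript_of_eqI[of _ _ d]) (simp add: run_hist)

lemma nth_hist: "i < j \<Longrightarrow> hist \<omega> j ! i = sent_message \<sigma> \<omega> (hist \<omega> i)"
proof (induction j)
  case (Suc j)
  then show ?case by (cases "i = j") (auto simp: nth_append)
qed simp

lemma bits_hist: "(\<Sum>m\<leftarrow>hist \<omega> i. length m) = (\<Sum>j<i. k j)"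
  by (induction i) (auto simp: length_sent)

lemma party_states:
  assumes "i \<le> d"
  shows "(party_state (\<lambda>j. up1 j (decode R u) x) s0 (hist ((x, y), u, a, b) d) i,
          party_state (\<lambda>j. up2 j (decode R u) y) s0 (hist ((x, y), u, a, b) d) i)
    = joint_state sn1 up1 sn2 up2 s0 x y (decode R u) i"
  using assms
proof (induction i)
  case (Suc i)
  let ?h = "hist ((x, y), u, a, b)"
  have i: "i < d" "i \<le> d" using Suc.prems by auto
  have pt: "party_state up s0 (?h i) i = party_state up s0 (?h d) i" for up :: "nat \<Rightarrow> 's \<Rightarrow> message \<Rightarrow> 's"
    using party_state_take[of i i up s0 "?h d"] i by (simp add: take_hist)
  have "?h d ! i = (if even i then sn1 i (decode R u) x (party_state (\<lambda>j. up1 j (decode R u) x) s0 (?h d) i)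
      else sn2 i (decode R u) y (party_state (\<lambda>j. up2 j (decode R u) y) s0 (?h d) i))"
    using i(1) by (simp add: nth_hist) (simp add: \<sigma>_defs pt)
  then show ?case using Suc.IH[OF i(2)]
    by (simp add: Let_def case_prod_beta prod_eq_iff)
qed simp

lemma final_states:
  "party_state (\<lambda>j. up1 j (decode R u) x) s0 (hist ((x, y), u, a, b) d) d
    = fst (joint_state sn1 up1 sn2 up2 s0 x y (decode R u) d)"
  "party_state (\<lambda>j. up2 j (decode R u) y) s0 (hist ((x, y), u, a, b) d) d
    = snd (joint_state sn1 up1 sn2 up2 s0 x y (decode R u) d)"
  using party_states[of d u x y a b] by (simp_all add: prod_eq_iff)

lemma measurable_const_fst:
  "(\<lambda>(r, u). f u) \<in> measure_pmf p \<Otimes>\<^sub>M measure_pmf q \<rightarrow>\<^sub>M count_space UNIV"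
  using measurable_compose[OF measurable_snd, of f "measure_pmf q" "count_space UNIV" "measure_pmf p"]
  by (simp add: case_prod_beta')

lemma interactive: "interactive_protocol P \<sigma>"
proof -
  have *: "prob_space (public_rand \<sigma>)" "prob_space (private_rand (party1 \<sigma>))" "prob_space (private_rand (party2 \<sigma>))"
    by (simp_all add: \<sigma>_defs measure_pmf.prob_space_axioms del: map_pmf_rep_eq)
  have "measurable_party (public_rand \<sigma>) (party1 \<sigma>)" "measurable_party (public_rand \<sigma>) (party2 \<sigma>)"
    by (auto simp: measurable_party_def \<sigma>_defs intro!: measurable_const_fst)
  moreover have "terminates \<sigma> \<omega>" for \<omega>
    unfolding terminates_def using run_hist[of d \<omega>] by (intro exI[of _ d]) simp
  moreover have "run \<sigma> \<omega> i = (h, Continue) \<longrightarrow>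
        codebook1 \<sigma> \<omega> h = codebook2 \<sigma> \<omega> h \<and> sent_message \<sigma> \<omega> h \<in> dom (codebook1 \<sigma> \<omega> h)" for \<omega> i h
    by (auto simp: fun_eq_iff codebooks length_sent dom_def)
  ultimately show ?thesis
    unfolding interactive_protocol_def using * by (intro conjI AE_I2 allI)
qed

lemma prefix_free: "prefix_free_messages P \<sigma>"
proof -
  have "m = m'" if "m \<in> dom (codebook1 \<sigma> \<omega> h)" "m' \<in> dom (codebook1 \<sigma> \<omega> h)" "prefix m m'" for \<omega> h m m'
    using that by (auto simp: codebooks dom_def prefix_def split: if_splits)
  then show ?thesis unfolding prefix_free_messages_def by blast
qed

lemma length_le: "protocol_length P \<sigma> \<le> enat (\<Sum>i<d. k i)"
  unfolding protocol_length_def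
proof (rule SUP_least, clarify)
  fix \<tau> assume "\<P>(\<omega> in execution_space P \<sigma>. transcript_of \<sigma> \<omega> = \<tau>) > 0"
  then have "{\<omega> \<in> space (execution_space P \<sigma>). transcript_of \<sigma> \<omega> = \<tau>} \<noteq> {}"
    by (metis measure_empty less_irrefl)
  then obtain \<omega> where "transcript_of \<sigma> \<omega> = \<tau>" by auto
  then show "enat (\<Sum>m\<leftarrow>\<tau>. length m) \<le> enat (\<Sum>i<d. k i)"
    using bits_hist[of \<omega> d] by (simp add: transcript_hist)
qed

definition result1 :: "('s \<Rightarrow> 't) \<Rightarrow> ('x, 'y, real, real, real) outcome \<Rightarrow> 't" where
  "result1 f = (\<lambda>((x, y), u, a, b). f (fst (joint_state sn1 up1 sn2 up2 s0 x y (decode R u) d)))"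
definition result2 :: "('s \<Rightarrow> 't) \<Rightarrow> ('x, 'y, real, real, real) outcome \<Rightarrow> 't" where
  "result2 f = (\<lambda>((x, y), u, a, b). f (snd (joint_state sn1 up1 sn2 up2 s0 x y (decode R u) d)))"

lemma recoverable: "recoverable1 P \<sigma> (result1 f)" "recoverable2 P \<sigma> (result2 f)"
proof -
  show "recoverable1 P \<sigma> (result1 f)" unfolding recoverable1_def
  proof (rule exI[of _ "\<lambda>x a u \<tau>. f (party_state (\<lambda>j. up1 j (decode R u) x) s0 \<tau> d)"], intro conjI allI)
    show "(\<lambda>(a, u). f (party_state (\<lambda>j. up1 j (decode R u) x) s0 \<tau> d))
      \<in> private_rand (party1 \<sigma>) \<Otimes>\<^sub>M public_rand \<sigma> \<rightarrow>\<^sub>M count_space UNIV" for x \<tau>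
      by (auto simp: \<sigma>_defs intro!: measurable_const_fst)
  qed (auto simp: result1_def transcript_hist final_states)
  show "recoverable2 P \<sigma> (result2 f)" unfolding recoverable2_def
  proof (rule exI[of _ "\<lambda>y a u \<tau>. f (party_state (\<lambda>j. up2 j (decode R u) y) s0 \<tau> d)"], intro conjI allI)
    show "(\<lambda>(a, u). f (party_state (\<lambda>j. up2 j (decode R u) y) s0 \<tau> d))
      \<in> private_rand (party2 \<sigma>) \<Otimes>\<^sub>M public_rand \<sigma> \<rightarrow>\<^sub>M count_space UNIV" for y \<tau>
      by (auto simp: \<sigma>_defs intro!: measurable_const_fst)
  qed (auto simp: result2_def transcript_hist final_states)
qed

definition results :: "('s \<Rightarrow> 't) \<Rightarrow> ('t \<times> 't \<times> 'x \<times> 'y) pmf" where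
  "results f = bind_pmf P (\<lambda>(x, y). map_pmf (\<lambda>z. let (s1, s2) = joint_state sn1 up1 sn2 up2 s0 x y z d in (f s1, f s2, x, y)) R)"

lemma distr_results:
  \<comment> \<open>The outputs depend only on the inputs and the public seed: the private
    randomness integrates out, and \<open>decode\<close> undoes \<open>encode\<close> on the
    support.\<close>
  fixes f :: "'s \<Rightarrow> 't::countable"
  shows "distr (execution_space P \<sigma>) (count_space UNIV) (\<lambda>\<omega>. (result1 f \<omega>, result2 f \<omega>, input1 \<omega>, input2 \<omega>))
    = measure_pmf (results f)"
proof -
  let ?out = "\<lambda>\<omega>. (result1 f \<omega>, result2 f \<omega>, input1 \<omega>, input2 \<omega>)"
  let ?AB = "private_rand (party1 \<sigma>) \<Otimes>\<^sub>M private_rand (party2 \<sigma>)"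
  interpret AB: prob_space ?AB
    by (intro prob_space_pair) (simp_all add: \<sigma>_defs measure_pmf.prob_space_axioms)
  have U: "public_rand \<sigma> = measure_pmf (map_pmf (encode R) R)" by (simp add: \<sigma>_defs)
  define g where "g z u = (let (s1, s2) = joint_state sn1 up1 sn2 up2 s0 (fst z) (snd z) (decode R u) d in (f s1, f s2, fst z, snd z))" for z u
  have out: "?out ((x, y), u, a, b) = g (x, y) u" for x y u a b
    by (simp add: result1_def result2_def input1_def input2_def g_def case_prod_beta)
  have m: "?out \<in> execution_space P \<sigma> \<rightarrow>\<^sub>M count_space UNIV"
  proof -
    note ip = interactive_measurable[OF interactive]
    have "?out \<in> execution_space P \<sigma> \<rightarrow>\<^sub>M count_space UNIV \<Otimes>\<^sub>M (count_space UNIV \<Otimes>\<^sub>M (count_space UNIV \<Otimes>\<^sub>M count_space UNIV))"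
      using measurable_recoverable1[OF ip recoverable(1)] measurable_recoverable2[OF ip recoverable(2)]
        measurable_input1 measurable_input2 by (intro measurable_Pair)
    then show ?thesis by (simp add: pair_measure_countable)
  qed
  have ip: "prob_space (randomness \<sigma>)"
    using prob_space_execution(1)[OF interactive] .
  have sN: "sigma_finite_measure (randomness \<sigma>)" using ip
    by (rule prob_space_imp_sigma_finite)
  have "emeasure (distr (execution_space P \<sigma>) (count_space UNIV) ?out) X = emeasure (results f) X" for X
  proof -
    have S: "?out -` X \<inter> space (execution_space P \<sigma>) \<in> sets (measure_pmf P \<Otimes>\<^sub>M randomness \<sigma>)"
      unfolding execution_space_alt[symmetric] by (rule measurable_sets[OF m]) simp
    have "emeasure (distr (execution_space P \<sigma>) (count_space UNIV) ?out) X
        = emeasure (measure_pmf P \<Otimes>\<^sub>M randomness \<sigma>) (?out -` X \<inter> space (execution_space P \<sigma>))"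
      unfolding execution_space_alt[symmetric] by (rule emeasure_distr[OF m]) simp
    also have "\<dots> = (\<integral>\<^sup>+z. emeasure (randomness \<sigma>) (Pair z -` (?out -` X \<inter> space (execution_space P \<sigma>))) \<partial>P)"
      by (rule sigma_finite_measure.emeasure_pair_measure_alt[OF sN S])
    also have "\<dots> = (\<integral>\<^sup>+z. emeasure (public_rand \<sigma> \<Otimes>\<^sub>M ?AB) ({u. g z u \<in> X} \<times> space ?AB) \<partial>P)"
    proof (intro nn_integral_cong arg_cong2[where f = emeasure] refl)
      fix z
      have "space (public_rand \<sigma>) = UNIV" by (simp add: U)
      then show "Pair z -` (?out -` X \<inter> space (execution_space P \<sigma>)) = {u. g z u \<in> X} \<times> space ?AB"
        using out[of "fst z" "snd z"] by (auto simp: space_execution space_pair_measure)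
    qed
    also have "\<dots> = (\<integral>\<^sup>+z. emeasure (map_pmf (encode R) R) {u. g z u \<in> X} \<partial>P)"
      by (subst AB.emeasure_pair_measure_Times) (simp_all add: U AB.emeasure_space_1 del: map_pmf_rep_eq)
    also have "\<dots> = (\<integral>\<^sup>+z. emeasure (case z of (x, y) \<Rightarrow> map_pmf (\<lambda>z. let (s1, s2) = joint_state sn1 up1 sn2 up2 s0 x y z d in (f s1, f s2, x, y)) R) X \<partial>P)"
    proof (intro nn_integral_cong)
      fix z :: "'x \<times> 'y"
      have "emeasure (map_pmf (encode R) R) {u. g z u \<in> X} = emeasure (map_pmf (g z \<circ> encode R) R) X"
        by (simp add: vimage_def)
      also have "map_pmf (g z \<circ> encode R) R = (case z of (x, y) \<Rightarrow> map_pmf (\<lambda>z. let (s1, s2) = joint_state sn1 up1 sn2 up2 s0 x y z d in (f s1, f s2, x, y)) R)"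
        by (cases z) (auto intro!: map_pmf_cong simp: g_def decode_encode)
      finally show "emeasure (map_pmf (encode R) R) {u. g z u \<in> X} = emeasure (case z of (x, y) \<Rightarrow> map_pmf (\<lambda>z. let (s1, s2) = joint_state sn1 up1 sn2 up2 s0 x y z d in (f s1, f s2, x, y)) R) X" .
    qed
    also have "\<dots> = emeasure (results f) X"
      unfolding results_def emeasure_bind_pmf ..
    finally show "emeasure (distr (execution_space P \<sigma>) (count_space UNIV) ?out) X = emeasure (results f) X" .
  qed
  then show ?thesis by (intro measure_eqI) simp_all
qed

text \<open>An inequality, since other final states may lead to the same outputs;
  \<open>d_var_le_overlap\<close> asks for a lower bound.\<close>

lemma pmf_results_ge:
  "pmf (results f) (t, t, x, y) \<ge> pmf P (x, y) * measure_pmf.prob R {z. joint_state sn1 up1 sn2 up2 s0 x y z d = (s, s)}"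
  if "f s = t"
proof -
  have "ennreal (pmf P (x, y) * measure_pmf.prob R {z. joint_state sn1 up1 sn2 up2 s0 x y z d = (s, s)})
      = (\<integral>\<^sup>+q. ennreal (measure_pmf.prob R {z. joint_state sn1 up1 sn2 up2 s0 x y z d = (s, s)}) * indicator {(x, y)} q \<partial>P)"
    by (subst nn_integral_cmult_indicator) (simp_all add: emeasure_pmf_single ennreal_mult mult.commute)
  also have "\<dots> \<le> emeasure (results f) {(t, t, x, y)}"
    unfolding results_def emeasure_bind_pmf
  proof (intro nn_integral_mono)
    fix q :: "'x \<times> 'y"
    show "ennreal (measure_pmf.prob R {z. joint_state sn1 up1 sn2 up2 s0 x y z d = (s, s)}) * indicator {(x, y)} q
      \<le> emeasure (case q of (x, y) \<Rightarrow> map_pmf (\<lambda>z. let (s1, s2) = joint_state sn1 up1 sn2 up2 s0 x y z d in (f s1, f s2, x, y)) R) {(t, t, x, y)}"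
    proof (cases "q = (x, y)")
      case True
      have "measure_pmf.prob R {z. joint_state sn1 up1 sn2 up2 s0 x y z d = (s, s)}
        \<le> measure_pmf.prob R ((\<lambda>z. let (s1, s2) = joint_state sn1 up1 sn2 up2 s0 x y z d in (f s1, f s2, x, y)) -` {(t, t, x, y)})"
        using that by (intro measure_pmf.finite_measure_mono) auto
      then show ?thesis using True by (simp add: measure_pmf.emeasure_eq_measure ennreal_leI)
    qed simp
  qed
  finally show ?thesis by (simp add: emeasure_pmf_single)
qed

end

section \<open>Simulating a chain of states\<close>

lemma finite_support_approx:
  assumes "\<eta> > 0"
  obtains Z where "finite Z" "Z \<subseteq> A \<inter> set_pmf p" "measure_pmf.prob p Z \<ge> measure_pmf.prob p A - \<eta>"
proof -
  have "Infinite_Set_Sum.abs_summable_on (pmf p) A" by (rule pmf_abs_summable)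
  then have "Infinite_Sum.abs_summable_on (pmf p) A" by (simp only: abs_summable_equivalent)
  then have "pmf p summable_on A" by (rule abs_summable_summable)
  moreover have "infsum (pmf p) A = measure_pmf.prob p A"
    by (simp add: measure_pmf_conv_infsetsum infsetsum_infsum pmf_abs_summable)
  ultimately have "(pmf p has_sum measure_pmf.prob p A) A"
    using has_sum_infsum by metis
  then have "\<forall>\<^sub>F F in finite_subsets_at_top A. dist (sum (pmf p) F) (measure_pmf.prob p A) < \<eta>"
    unfolding has_sum_def using assms by (rule tendstoD)
  then obtain F where F: "finite F" "F \<subseteq> A" "dist (sum (pmf p) F) (measure_pmf.prob p A) < \<eta>"
    unfolding eventually_finite_subsets_at_top by blast
  then have "measure_pmf.prob p A - \<eta> \<le> measure_pmf.prob p (F \<inter> set_pmf p)"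
    by (simp add: measure_Int_set_pmf measure_measure_pmf_finite dist_real_def)
  then show ?thesis using that[of "F \<inter> set_pmf p"] F by auto
qed

lemma finite_real_bound:
  fixes f :: "'q \<Rightarrow> real"
  assumes "finite F"
  obtains T :: nat where "\<And>q. q \<in> F \<Longrightarrow> f q \<le> T"
proof -
  have "bdd_above (f ` F)" using assms by (intro bdd_above_finite) auto
  then obtain b where "\<And>q. q \<in> F \<Longrightarrow> f q \<le> b" by (auto simp: bdd_above_def)
  then have "f q \<le> real (nat \<lceil>b\<rceil>)" if "q \<in> F" for q
    using that by (smt (verit) real_nat_ceiling_ge)
  then show ?thesis using that by blast
qed

definition chosen :: "bool \<Rightarrow> 'q \<Rightarrow> 'q \<Rightarrow> 'q" where
  "chosen b p q = (if b then p else q)"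

definition sim_send where
  "sim_send k M T W i rs x s = fst (send (k i) M T (W i x s) (rs ! i))"

text \<open>\<open>R\<close> marks the rounds in which the party listens, the odd positions for
  Party 1. In its own rounds the party moves to the state it selected, otherwise to the one it
  decodes from the hash \<open>b\<close>.\<close>

definition sim_update where
  "sim_update k M T c W R i rs x s b =
     (if R i then receive M T (c i) (W i x s) (rs ! i) b else snd (send (k i) M T (W i x s) (rs ! i)))"

lemma joint_state_follows:
  fixes s :: "nat \<Rightarrow> 's"
  assumes "\<And>i. i < n \<Longrightarrow> rs ! i \<in> {r.
      snd (send (k i) M T (chosen (even i) (W1 i x (s i)) (W2 i y (s i))) r) = s (Suc i) \<and>
      receive M T (c i) (chosen (even i) (W2 i y (s i)) (W1 i x (s i))) r
        (fst (send (k i) M T (chosen (even i) (W1 i x (s i)) (W2 i y (s i))) r)) = s (Suc i)}"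
  shows "joint_state (sim_send k M T W1) (sim_update k M T c W1 odd) (sim_send k M T W2) (sim_update k M T c W2 even)
    (s 0) x y rs n = (s n, s n)"
  using assms
proof (induction n)
  case (Suc n)
  then have IH: "joint_state (sim_send k M T W1) (sim_update k M T c W1 odd) (sim_send k M T W2) (sim_update k M T c W2 even)
    (s 0) x y rs n = (s n, s n)" by simp
  show ?case
    using Suc.prems[of n] by (cases "even n") (simp_all add: IH Let_def, simp_all add: sim_send_def sim_update_def chosen_def)
qed simp

text \<open>Along a path, \<open>w i\<close> is the speaker's and \<open>v i\<close> the listener's
  probability of the next state; by \<open>markov\<close> the speakers' probabilities multiply to
  the conditional law of the transcript. On paths with \<open>w i <= c i * v i\<close> in all
  rounds, both parties follow the path with probability at least \<open>(1 - \<theta>) ^ d\<close>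
  times that law.\<close>

lemma one_shot_simulation:
  fixes Q :: "('t::countable \<times> 'x::countable \<times> 'y::countable) pmf"
    and st :: "nat \<Rightarrow> 't \<Rightarrow> 's" and W1 :: "nat \<Rightarrow> 'x \<Rightarrow> 's \<Rightarrow> 's pmf" and W2 :: "nat \<Rightarrow> 'y \<Rightarrow> 's \<Rightarrow> 's pmf"
  defines "w \<equiv> \<lambda>i (\<tau>, x, y). pmf (chosen (even i) (W1 i x (st i \<tau>)) (W2 i y (st i \<tau>))) (st (Suc i) \<tau>)"
    and "v \<equiv> \<lambda>i (\<tau>, x, y). pmf (chosen (even i) (W2 i y (st i \<tau>)) (W1 i x (st i \<tau>))) (st (Suc i) \<tau>)"
  assumes d: "d > 0"
    and start: "\<And>\<tau> x y. (\<tau>, x, y) \<in> set_pmf Q \<Longrightarrow> st 0 \<tau> = s0"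
    and out: "\<And>\<tau> x y. (\<tau>, x, y) \<in> set_pmf Q \<Longrightarrow> out (st d \<tau>) = \<tau>"
    and markov: "\<And>\<tau> x y. (\<tau>, x, y) \<in> set_pmf Q \<Longrightarrow>
      pmf Q (\<tau>, x, y) = pmf (inputs_law Q) (x, y) * (\<Prod>i<d. w i (\<tau>, x, y))"
    and \<theta>: "\<And>i. \<eta> + 2 * c i / 2 ^ k i \<le> \<theta>" "\<theta> \<le> 1" and \<eta>: "\<eta> > 0" and c: "\<And>i. c i \<ge> 0"
    and \<epsilon>: "1 - (1 - \<theta>) ^ d * (measure_pmf.prob Q {z. \<forall>i<d. w i z \<le> c i * v i z} - \<eta>) \<le> \<epsilon>"
  shows "\<exists>\<sigma> :: ('x, 'y, real, real, real) protocol. is_simulation \<epsilon> (inputs_law Q) (measure_pmf Q) \<sigma> \<and>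
    protocol_length (inputs_law Q) \<sigma> \<le> enat (\<Sum>i<d. k i)"
proof -
  define G where "G = {z. \<forall>i<d. w i z \<le> c i * v i z}"
  \<comment> \<open>Passing to finitely many paths allows a single finite set \<open>M\<close> and a
    single grid size \<open>T\<close> for all rounds; the price is \<eta>.\<close>
  obtain Z where Z: "finite Z" "Z \<subseteq> G \<inter> set_pmf Q" "measure_pmf.prob Q Z \<ge> measure_pmf.prob Q G - \<eta>"
    using finite_support_approx[OF \<eta>] .
  define wp where "wp i = (\<lambda>(\<tau>, x, y). chosen (even i) (W1 i x (st i \<tau>)) (W2 i y (st i \<tau>)))" for i
  have w_wp: "w i (\<tau>, x, y) = pmf (wp i (\<tau>, x, y)) (st (Suc i) \<tau>)" for i \<tau> x y
    by (simp add: w_def wp_def)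
  have "\<exists>M. finite M \<and> measure_pmf.prob p M \<ge> 3/4" for p :: "'s pmf"
  proof -
    obtain F where "finite F" "measure_pmf.prob p F \<ge> measure_pmf.prob p UNIV - 1/4"
      using finite_support_approx[of "1/4" UNIV p] by auto
    then show ?thesis by (intro exI[of _ F]) simp
  qed
  then obtain N where N: "\<And>p :: 's pmf. finite (N p)" "\<And>p. measure_pmf.prob p (N p) \<ge> 3/4" by metis
  \<comment> \<open>\<open>M\<close> holds all states after the initial one on the paths in
    \<open>Z\<close>, and three quarters of each speaker's law met there, as
    \<open>transmission\<close> demands.\<close>
  define M where "M = (\<Union>z\<in>Z. \<Union>i<d. insert (st (Suc i) (fst z)) (N (wp i z)))"
  have finM: "finite M" using Z(1) N by (simp add: M_def)
  have M_prob: "measure_pmf.prob (wp i z) M \<ge> 3/4" if "z \<in> Z" "i < d" for z i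
  proof -
    have "N (wp i z) \<subseteq> M" using that by (auto simp: M_def)
    then have "measure_pmf.prob (wp i z) (N (wp i z)) \<le> measure_pmf.prob (wp i z) M"
      by (intro measure_pmf.finite_measure_mono) auto
    then show ?thesis using N(2)[of "wp i z"] by linarith
  qed
  \<comment> \<open>\<open>T0\<close> makes one cell small compared with the least likely transition
    on the chosen paths.\<close>
  obtain T0 :: nat where T0: "\<And>q. q \<in> Z \<times> {..<d} \<Longrightarrow> 1 / (\<eta> * w (snd q) (fst q)) \<le> T0"
    using finite_real_bound[of "Z \<times> {..<d}" "\<lambda>q. 1 / (\<eta> * w (snd q) (fst q))"] Z(1) by auto
  define T where "T = T0 + 4 * card M"
  define R where "R = list_pmf (map (\<lambda>i. random_seed (k i) (cells M T)) [0..<d])"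
  interpret S: seeded "inputs_law Q" d k R "sim_send k M T W1" "sim_update k M T c W1 odd"
    "sim_send k M T W2" "sim_update k M T c W2 even" s0
    by unfold_locales (simp_all add: d sim_send_def length_send)
  have wpos: "w i z > 0" if "z \<in> set_pmf Q" "i < d" for z i
  proof (rule ccontr)
    obtain \<tau> x y where z: "z = (\<tau>, x, y)" by (cases z) auto
    assume "\<not> w i z > 0"
    then have "w i z = 0" by (auto simp: w_def z less_le)
    then have "(\<Prod>i<d. w i z) = 0" using that by auto
    then show False using markov[of \<tau> x y] that by (auto simp: z set_pmf_iff)
  qed
  have path: "(\<Prod>i<d. w i z * (1 - \<theta>)) \<le> measure_pmf.prob R {rs. joint_state (sim_send k M T W1) (sim_update k M T c W1 odd)
      (sim_send k M T W2) (sim_update k M T c W2 even) s0 x y rs d = (st d \<tau>, st d \<tau>)}"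
    if z: "z \<in> Z" "z = (\<tau>, x, y)" for z \<tau> x y
  proof -
    define E where "E i = {r.
      snd (send (k i) M T (chosen (even i) (W1 i x (st i \<tau>)) (W2 i y (st i \<tau>))) r) = st (Suc i) \<tau> \<and>
      receive M T (c i) (chosen (even i) (W2 i y (st i \<tau>)) (W1 i x (st i \<tau>))) r
        (fst (send (k i) M T (chosen (even i) (W1 i x (st i \<tau>)) (W2 i y (st i \<tau>))) r)) = st (Suc i) \<tau>}" for i
    have zQ: "z \<in> set_pmf Q" "z \<in> G" using z Z(2) by auto
    have "w i z * (1 - \<theta>) \<le> measure_pmf.prob (random_seed (k i) (cells M T)) (E i)" if i: "i < d" for i
    proof -
      have "w i z * (1 - \<theta>) \<le> w i z * (1 - \<eta> - 2 * c i / 2 ^ k i)"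
        using \<theta>(1)[of i] wpos[OF zQ(1) i] by (intro mult_left_mono) auto
      also have "\<dots> \<le> measure_pmf.prob (random_seed (k i) (cells M T)) (E i)"
        unfolding E_def z(2) w_def prod.case
      proof (rule transmission)
        show "st (Suc i) \<tau> \<in> M" using z i by (force simp: M_def)
        show "3 / 4 \<le> measure_pmf.prob (chosen (even i) (W1 i x (st i \<tau>)) (W2 i y (st i \<tau>))) M"
          using M_prob[OF z(1) i] by (simp add: z wp_def)
        have "1 / (\<eta> * w i z) \<le> T" using T0[of "(z, i)"] z i by (simp add: T_def)
        then have "1 \<le> \<eta> * (T * w i z)" using \<eta> wpos[OF zQ(1) i] by (simp add: field_simps)
        then show "1 \<le> \<eta> * (T * pmf (chosen (even i) (W1 i x (st i \<tau>)) (W2 i y (st i \<tau>))) (st (Suc i) \<tau>))"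
          by (simp add: z w_def)
        show "pmf (chosen (even i) (W1 i x (st i \<tau>)) (W2 i y (st i \<tau>))) (st (Suc i) \<tau>)
          \<le> c i * pmf (chosen (even i) (W2 i y (st i \<tau>)) (W1 i x (st i \<tau>))) (st (Suc i) \<tau>)"
          using zQ(2) i by (simp add: G_def z w_def v_def)
      qed (use finM c in \<open>auto simp: T_def\<close>)
      finally show ?thesis .
    qed
    then have "(\<Prod>i<d. w i z * (1 - \<theta>)) \<le> (\<Prod>i<d. measure_pmf.prob (random_seed (k i) (cells M T)) (E i))"
      using \<theta>(2) by (intro prod_mono) (simp add: z(2) w_def)
    also have "\<dots> = measure_pmf.prob R {rs. length rs = d \<and> (\<forall>i<d. rs ! i \<in> E i)}"
      using prob_list_pmf[of "map (\<lambda>i. random_seed (k i) (cells M T)) [0..<d]" E] by (simp add: R_def)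
    also have "\<dots> \<le> measure_pmf.prob R {rs. joint_state (sim_send k M T W1) (sim_update k M T c W1 odd)
      (sim_send k M T W2) (sim_update k M T c W2 even) s0 x y rs d = (st d \<tau>, st d \<tau>)}"
    proof (intro measure_pmf.finite_measure_mono subsetI CollectI)
      fix rs assume "rs \<in> {rs. length rs = d \<and> (\<forall>i<d. rs ! i \<in> E i)}"
      then have "rs ! i \<in> E i" if "i < d" for i using that by auto
      then show "joint_state (sim_send k M T W1) (sim_update k M T c W1 odd)
        (sim_send k M T W2) (sim_update k M T c W2 even) s0 x y rs d = (st d \<tau>, st d \<tau>)"
        using joint_state_follows[of d rs k M T W1 x "\<lambda>i. st i \<tau>" W2 y c] start[of \<tau> x y] zQ(1)
        by (simp add: E_def z(2))
    qed auto
    finally show ?thesis .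
  qed
  let ?dup = "\<lambda>(\<tau>, x, y). (\<tau>, \<tau>, x, y)"
  have dv: "d_var (measure_pmf (map_pmf ?dup Q)) (measure_pmf (S.results out))
    \<le> 1 - (1 - \<theta>) ^ d * measure_pmf.prob (map_pmf ?dup Q) (?dup ` Z)"
  proof (rule d_var_le_overlap)
    have "0 \<le> \<theta>" using \<theta>(1)[of 0] \<eta> c[of 0] by (smt (verit) divide_nonneg_nonneg zero_le_power)
    then show "0 \<le> (1 - \<theta>) ^ d" "(1 - \<theta>) ^ d \<le> 1" using \<theta>(2) by (auto simp: power_le_one)
    fix q assume "q \<in> ?dup ` Z"
    then obtain \<tau> x y where q: "q = (\<tau>, \<tau>, x, y)" and z: "(\<tau>, x, y) \<in> Z" by auto
    have zQ: "(\<tau>, x, y) \<in> set_pmf Q" using z Z(2) by auto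
    have "inj ?dup" by (auto simp: inj_on_def)
    then have "pmf (map_pmf ?dup Q) q = pmf Q (\<tau>, x, y)"
      using pmf_map_inj'[of ?dup Q "(\<tau>, x, y)"] by (simp add: q)
    also have "\<dots> = pmf (inputs_law Q) (x, y) * (\<Prod>i<d. w i (\<tau>, x, y))" by (rule markov[OF zQ])
    finally have "(1 - \<theta>) ^ d * pmf (map_pmf ?dup Q) q = pmf (inputs_law Q) (x, y) * (\<Prod>i<d. w i (\<tau>, x, y) * (1 - \<theta>))"
      by (simp add: prod.distrib)
    also have "\<dots> \<le> pmf (inputs_law Q) (x, y) * measure_pmf.prob R {rs. joint_state (sim_send k M T W1) (sim_update k M T c W1 odd)
      (sim_send k M T W2) (sim_update k M T c W2 even) s0 x y rs d = (st d \<tau>, st d \<tau>)}"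
      by (intro mult_left_mono path[OF z]) auto
    also have "\<dots> \<le> pmf (S.results out) q"
      unfolding q by (rule S.pmf_results_ge) (rule out[OF zQ])
    finally show "(1 - \<theta>) ^ d * pmf (map_pmf ?dup Q) q \<le> pmf (S.results out) q" .
  qed
  have "?dup -` (?dup ` Z) = Z" by (auto simp: image_iff)
  then have dup: "measure_pmf.prob (map_pmf ?dup Q) (?dup ` Z) = measure_pmf.prob Q Z"
    by (simp only: measure_map_pmf)
  have "(1 - \<theta>) ^ d * (measure_pmf.prob Q G - \<eta>) \<le> (1 - \<theta>) ^ d * measure_pmf.prob Q Z"
    using Z(3) \<theta>(2) by (intro mult_left_mono) auto
  then have "d_var (measure_pmf (map_pmf ?dup Q)) (measure_pmf (S.results out)) \<le> \<epsilon>"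
    using dv[unfolded dup] \<epsilon> unfolding G_def by linarith
  then have "is_simulation \<epsilon> (inputs_law Q) (measure_pmf Q) S.\<sigma>"
    unfolding is_simulation_def
    by (intro conjI S.interactive S.prefix_free exI[of _ "S.result1 out"] exI[of _ "S.result2 out"] S.recoverable)
      (simp add: S.distr_results map_pmf_rep_eq)
  then show ?thesis using S.length_le by blast
qed

section \<open>Laws of large numbers and densities\<close>

lemma replicate_pmf_Suc_pair:
  "replicate_pmf (Suc n) p = map_pmf (\<lambda>(x, xs). x # xs) (pair_pmf p (replicate_pmf n p))"
  by (simp add: replicate_pmf_conv_list_pmf)

text \<open>The second moments add up because the cross terms vanish with the mean. The second
  moment is stated as an \<open>nn_integral\<close>, so that its finiteness, and hence square
  integrability, is carried along by the induction.\<close>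

lemma sum_list_replicate_pmf:
  fixes g :: "'z \<Rightarrow> real"
  assumes int: "integrable (measure_pmf p) g" and mean: "measure_pmf.expectation p g = 0"
    and sq: "integrable (measure_pmf p) (\<lambda>z. (g z)\<^sup>2)"
  defines "S \<equiv> \<lambda>zs. \<Sum>z\<leftarrow>zs. g z"
  shows "integrable (measure_pmf (replicate_pmf n p)) S \<and> measure_pmf.expectation (replicate_pmf n p) S = 0 \<and>
    (\<integral>\<^sup>+zs. ennreal ((S zs)\<^sup>2) \<partial>replicate_pmf n p) = ennreal (real n * measure_pmf.expectation p (\<lambda>z. (g z)\<^sup>2))"
proof (induction n)
  case 0
  then show ?case by (simp add: S_def integrable_measure_pmf_finite)
next
  case (Suc n)
  let ?R = "replicate_pmf n p" and ?v = "measure_pmf.expectation p (\<lambda>z. (g z)\<^sup>2)"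
  have v: "?v \<ge> 0" by simp
  have S_Cons: "S (z # zs) = g z + S zs" for z zs by (simp add: S_def)
  have intS: "integrable ?R S" and meanS: "measure_pmf.expectation ?R S = 0"
    and sqS: "(\<integral>\<^sup>+zs. ennreal ((S zs)\<^sup>2) \<partial>?R) = ennreal (real n * ?v)"
    using Suc.IH by auto
  have int_sqS: "integrable ?R (\<lambda>zs. (S zs)\<^sup>2)"
    by (rule integrableI_nonneg) (auto simp: sqS)
  have exp_sqS: "measure_pmf.expectation ?R (\<lambda>zs. (S zs)\<^sup>2) = real n * ?v"
    using nn_integral_eq_integral[OF int_sqS] sqS v by (simp add: ennreal_inj)
  have i1: "integrable (pair_pmf p ?R) (\<lambda>q. g (fst q))" "measure_pmf.expectation (pair_pmf p ?R) (\<lambda>q. g (fst q)) = 0"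
    using int mean integrable_map_pmf_eq[of fst "pair_pmf p ?R" g] integral_map_pmf[of fst "pair_pmf p ?R" g]
    by (simp_all add: map_fst_pair_pmf)
  have i2: "integrable (pair_pmf p ?R) (\<lambda>q. S (snd q))" "measure_pmf.expectation (pair_pmf p ?R) (\<lambda>q. S (snd q)) = 0"
    using intS meanS integrable_map_pmf_eq[of snd "pair_pmf p ?R" S] integral_map_pmf[of snd "pair_pmf p ?R" S]
    by (simp_all add: map_snd_pair_pmf)
  have "integrable (replicate_pmf (Suc n) p) S \<longleftrightarrow> integrable (pair_pmf p ?R) (\<lambda>q. g (fst q) + S (snd q))"
    unfolding replicate_pmf_Suc_pair integrable_map_pmf_eq by (simp add: case_prod_beta S_Cons)
  then have a: "integrable (replicate_pmf (Suc n) p) S" using i1 i2 by simp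
  have "measure_pmf.expectation (replicate_pmf (Suc n) p) S = measure_pmf.expectation (pair_pmf p ?R) (\<lambda>q. g (fst q) + S (snd q))"
    unfolding replicate_pmf_Suc_pair integral_map_pmf by (simp add: case_prod_beta S_Cons)
  also have "\<dots> = 0" using i1 i2 by simp
  finally have b: "measure_pmf.expectation (replicate_pmf (Suc n) p) S = 0" .
  have "(\<integral>\<^sup>+zs. ennreal ((S zs)\<^sup>2) \<partial>replicate_pmf (Suc n) p)
      = (\<integral>\<^sup>+z. \<integral>\<^sup>+zs. ennreal ((g z + S zs)\<^sup>2) \<partial>?R \<partial>p)"
    unfolding replicate_pmf_Suc_pair nn_integral_map_pmf nn_integral_pair_pmf' by (simp add: S_Cons)
  also have "\<dots> = (\<integral>\<^sup>+z. ennreal ((g z)\<^sup>2 + real n * ?v) \<partial>p)"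
  proof (intro nn_integral_cong)
    fix z
    have eq: "(\<lambda>zs. (g z + S zs)\<^sup>2) = (\<lambda>zs. (g z)\<^sup>2 + 2 * g z * S zs + (S zs)\<^sup>2)"
      by (simp add: power2_sum algebra_simps)
    have "integrable ?R (\<lambda>zs. (g z + S zs)\<^sup>2)"
      unfolding eq using intS int_sqS by auto
    then have "(\<integral>\<^sup>+zs. ennreal ((g z + S zs)\<^sup>2) \<partial>?R) = ennreal (measure_pmf.expectation ?R (\<lambda>zs. (g z + S zs)\<^sup>2))"
      by (rule nn_integral_eq_integral) simp
    also have "measure_pmf.expectation ?R (\<lambda>zs. (g z + S zs)\<^sup>2) = (g z)\<^sup>2 + real n * ?v"
      unfolding eq using intS int_sqS by (simp add: meanS exp_sqS)
    finally show "(\<integral>\<^sup>+zs. ennreal ((g z + S zs)\<^sup>2) \<partial>?R) = ennreal ((g z)\<^sup>2 + real n * ?v)" .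
  qed
  also have "\<dots> = ennreal (measure_pmf.expectation p (\<lambda>z. (g z)\<^sup>2 + real n * ?v))"
    using sq v by (intro nn_integral_eq_integral) auto
  also have "measure_pmf.expectation p (\<lambda>z. (g z)\<^sup>2 + real n * ?v) = real (Suc n) * ?v"
    using sq by (simp add: algebra_simps)
  finally show ?case using a b by simp
qed

text \<open>Chebyshev's inequality for the centred sum, whose second moment is
  \<open>n * v\<close>.\<close>

lemma weak_law_of_large_numbers:
  fixes f :: "'z \<Rightarrow> real"
  assumes int: "integrable (measure_pmf p) f" and sq: "integrable (measure_pmf p) (\<lambda>z. (f z)\<^sup>2)" and \<delta>: "\<delta> > 0"
  shows "(\<lambda>n. measure_pmf.prob (replicate_pmf n p) {zs. \<bar>(\<Sum>z\<leftarrow>zs. f z) - real n * measure_pmf.expectation p f\<bar> \<ge> real n * \<delta>}) \<longlonglongrightarrow> 0"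
proof -
  let ?\<mu> = "measure_pmf.expectation p f"
  define g where "g z = f z - ?\<mu>" for z
  define v where "v = measure_pmf.expectation p (\<lambda>z. (g z)\<^sup>2)"
  have g_sq: "(\<lambda>z. (g z)\<^sup>2) = (\<lambda>z. (f z)\<^sup>2 - 2 * ?\<mu> * f z + ?\<mu>\<^sup>2)"
    by (simp add: g_def power2_diff algebra_simps)
  have g: "integrable (measure_pmf p) g" "measure_pmf.expectation p g = 0" "integrable (measure_pmf p) (\<lambda>z. (g z)\<^sup>2)"
    using int sq unfolding g_sq by (auto simp: g_def[abs_def])
  have v: "v \<ge> 0" by (simp add: v_def)
  have bound: "measure_pmf.prob (replicate_pmf n p) {zs. \<bar>(\<Sum>z\<leftarrow>zs. f z) - real n * ?\<mu>\<bar> \<ge> real n * \<delta>} \<le> (v / \<delta>\<^sup>2) * inverse (real n)"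
    if n: "n > 0" for n
  proof -
    let ?R = "replicate_pmf n p" and ?S = "\<lambda>zs. (\<Sum>z\<leftarrow>zs. g z)"
    have nn: "(\<integral>\<^sup>+zs. ennreal ((?S zs)\<^sup>2) \<partial>?R) = ennreal (real n * v)"
      using sum_list_replicate_pmf[OF g, of n] by (simp add: v_def)
    have "measure_pmf.prob ?R {zs. \<bar>(\<Sum>z\<leftarrow>zs. f z) - real n * ?\<mu>\<bar> \<ge> real n * \<delta>} \<le> measure_pmf.prob ?R {zs. (?S zs)\<^sup>2 \<ge> (real n * \<delta>)\<^sup>2}"
    proof (rule prob_mono_support)
      fix zs assume zs: "zs \<in> set_pmf ?R" "zs \<in> {zs. \<bar>(\<Sum>z\<leftarrow>zs. f z) - real n * ?\<mu>\<bar> \<ge> real n * \<delta>}"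
      then have "length zs = n" by (auto simp: set_replicate_pmf)
      then have "?S zs = (\<Sum>z\<leftarrow>zs. f z) - real n * ?\<mu>"
        by (simp add: g_def sum_list_subtractf sum_list_triv)
      then have "real n * \<delta> \<le> \<bar>?S zs\<bar>" using zs by simp
      then have "(real n * \<delta>)\<^sup>2 \<le> \<bar>?S zs\<bar>\<^sup>2" using \<delta> by (intro power_mono) auto
      then show "zs \<in> {zs. (?S zs)\<^sup>2 \<ge> (real n * \<delta>)\<^sup>2}" by simp
    qed
    also have "\<dots> \<le> (v / \<delta>\<^sup>2) * inverse (real n)"
    proof -
      have "ennreal (measure_pmf.prob ?R {zs. (?S zs)\<^sup>2 \<ge> (real n * \<delta>)\<^sup>2}) = emeasure ?R {zs. (?S zs)\<^sup>2 \<ge> (real n * \<delta>)\<^sup>2}"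
        by (simp add: measure_pmf.emeasure_eq_measure)
      also have "\<dots> = emeasure ?R ({zs. 1 \<le> ennreal (1 / (real n * \<delta>)\<^sup>2) * ennreal ((?S zs)\<^sup>2)} \<inter> UNIV)"
        using n \<delta> by (intro arg_cong2[where f = emeasure]) (auto simp: field_simps simp flip: ennreal_mult ennreal_1)
      also have "\<dots> \<le> ennreal (1 / (real n * \<delta>)\<^sup>2) * (\<integral>\<^sup>+zs. ennreal ((?S zs)\<^sup>2) * indicator UNIV zs \<partial>?R)"
        using nn_integral_Markov_inequality[where u = "\<lambda>zs. ennreal ((?S zs)\<^sup>2)" and M = "measure_pmf ?R"
            and A = UNIV and c = "ennreal (1 / (real n * \<delta>)\<^sup>2)"]
        by simp
      also have "\<dots> = ennreal (1 / (real n * \<delta>)\<^sup>2 * (real n * v))"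
        using v by (simp add: nn ennreal_mult[symmetric])
      also have "1 / (real n * \<delta>)\<^sup>2 * (real n * v) = (v / \<delta>\<^sup>2) * inverse (real n)"
        using n by (simp add: power2_eq_square field_simps)
      finally show ?thesis using v by (simp add: ennreal_le_iff)
    qed
    finally show ?thesis .
  qed
  have "(\<lambda>n. (v / \<delta>\<^sup>2) * inverse (real n)) \<longlonglongrightarrow> 0"
    by (intro tendsto_mult_right_zero lim_inverse_n)
  then show ?thesis
  proof (rule Lim_null_comparison[rotated])
    show "\<forall>\<^sub>F n in sequentially. norm (measure_pmf.prob (replicate_pmf n p)
        {zs. \<bar>(\<Sum>z\<leftarrow>zs. f z) - real n * ?\<mu>\<bar> \<ge> real n * \<delta>}) \<le> (v / \<delta>\<^sup>2) * inverse (real n)"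
      using eventually_gt_at_top[of 0]
      by eventually_elim (simp only: real_norm_def abs_of_nonneg[OF measure_nonneg] bound)
  qed
qed

section \<open>Relative densities and their moments\<close>

lemma ln_square_le:
  fixes t C :: real
  assumes "0 < t" "t \<le> C"
  shows "(ln t)\<^sup>2 \<le> (ln (max 1 C))\<^sup>2 + 4 / t"
proof (cases "t \<ge> 1")
  case True
  then have "0 \<le> ln t" "ln t \<le> ln (max 1 C)" using assms by auto
  then have "(ln t)\<^sup>2 \<le> (ln (max 1 C))\<^sup>2" by (intro power_mono) auto
  then show ?thesis using assms by (simp add: add_increasing2)
next
  case False
  \<comment> \<open>The bound \<open>ln s <= s - 1\<close> alone would give the order
    \<open>1 / t^2\<close> after squaring; with \<open>s = 1 / sqrt t\<close> the square is of order
    \<open>1 / t\<close>, and \<open>ln t = - 2 ln s\<close> yields the factor 4.\<close>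
  define s where "s = inverse (sqrt t)"
  have s: "s > 0" "1 / t = s\<^sup>2" using assms by (simp_all add: s_def power_inverse inverse_eq_divide power_divide)
  have s1: "s \<ge> 1" using False assms unfolding s_def by (intro one_le_inverse) auto
  have "ln t = - (2 * ln s)" using assms by (simp add: s_def ln_inverse ln_sqrt)
  then have "(ln t)\<^sup>2 = 4 * (ln s)\<^sup>2" by (simp add: power_mult_distrib)
  also have "(ln s)\<^sup>2 \<le> s\<^sup>2" using ln_le_minus_one[OF s(1)] s1 by (intro power_mono) auto
  finally have "(ln t)\<^sup>2 \<le> 4 / t" using s(2) by simp
  then show ?thesis by (simp add: add_increasing)
qed

definition rel_density :: "'z pmf \<Rightarrow> 'z pmf \<Rightarrow> 'z \<Rightarrow> real" where
  "rel_density p q z = log 2 (pmf p z / pmf q z)"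

text \<open>An inequality only, because \<open>q\<close> may have mass outside the support of
  \<open>p\<close>.\<close>

lemma nn_integral_ratio_le_1: "(\<integral>\<^sup>+z. ennreal (pmf q z / pmf p z) \<partial>measure_pmf p) \<le> 1"
proof -
  have "(\<integral>\<^sup>+z. ennreal (pmf q z / pmf p z) \<partial>measure_pmf p)
      = (\<integral>\<^sup>+z. ennreal (pmf p z) * ennreal (pmf q z / pmf p z) \<partial>count_space UNIV)"
    by (rule nn_integral_measure_pmf)
  also have "\<dots> \<le> (\<integral>\<^sup>+z. ennreal (pmf q z) \<partial>count_space UNIV)"
    by (intro nn_integral_mono) (simp flip: ennreal_mult)
  also have "\<dots> = 1" by (simp add: nn_integral_pmf)
  finally show ?thesis .
qed

lemma integrable_ratio: "integrable (measure_pmf p) (\<lambda>z. pmf q z / pmf p z)"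
  and expectation_ratio_le_1: "measure_pmf.expectation p (\<lambda>z. pmf q z / pmf p z) \<le> 1"
proof -
  show i: "integrable (measure_pmf p) (\<lambda>z. pmf q z / pmf p z)"
    using nn_integral_ratio_le_1[where p = p and q = q] by (intro integrableI_nonneg) (auto simp: le_less_trans)
  show "measure_pmf.expectation p (\<lambda>z. pmf q z / pmf p z) \<le> 1"
    using nn_integral_ratio_le_1[where p = p and q = q] nn_integral_eq_integral[OF i] by (simp add: ennreal_le_1)
qed

text \<open>The ratio \<open>p / q\<close> is at most \<open>C\<close>, which bounds its logarithm
  from above. Where the ratio is small, its squared natural logarithm is at most 4 times the inverse
  ratio, which is integrable.\<close>

lemma integrable_rel_density:
  assumes "\<And>z. z \<in> set_pmf p \<Longrightarrow> pmf p z \<le> C * pmf q z"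
  shows "integrable (measure_pmf p) (\<lambda>z. (rel_density p q z)\<^sup>2)" "integrable (measure_pmf p) (rel_density p q)"
proof -
  have bound: "(rel_density p q z)\<^sup>2 \<le> ((ln (max 1 C))\<^sup>2 + 4 * (pmf q z / pmf p z)) / (ln 2)\<^sup>2"
    if "z \<in> set_pmf p" for z
  proof -
    have p: "pmf p z > 0" using that by (simp add: pmf_positive)
    then have q: "pmf q z > 0" using assms[OF that] by (metis mult_zero_right not_le pmf_nonneg less_eq_real_def)
    have "(ln (pmf p z / pmf q z))\<^sup>2 \<le> (ln (max 1 C))\<^sup>2 + 4 / (pmf p z / pmf q z)"
      using p q assms[OF that] by (intro ln_square_le) (auto simp: field_simps)
    then show ?thesis by (simp add: rel_density_def log_def power_divide divide_right_mono)
  qed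
  have "integrable (measure_pmf p) (\<lambda>z. ((ln (max 1 C))\<^sup>2 + 4 * (pmf q z / pmf p z)) / (ln 2)\<^sup>2)"
    by (intro Bochner_Integration.integrable_divide_zero Bochner_Integration.integrable_add
        Bochner_Integration.integrable_mult_right integrable_ratio) simp_all
  then show sq: "integrable (measure_pmf p) (\<lambda>z. (rel_density p q z)\<^sup>2)"
    by (rule Bochner_Integration.integrable_bound) (auto intro!: AE_pmfI order_trans[OF bound] abs_ge_self)
  show "integrable (measure_pmf p) (rel_density p q)"
    by (rule measure_pmf.square_integrable_imp_integrable[OF _ sq]) simp
qed

text \<open>Gibbs' inequality, from \<open>ln u <= u - 1\<close> applied to
  \<open>u = q / p\<close>, whose expectation is at most 1.\<close>

lemma expectation_rel_density_nonneg:
  assumes int: "integrable (measure_pmf p) (rel_density p q)"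
    and pos: "\<And>z. z \<in> set_pmf p \<Longrightarrow> pmf q z > 0"
  shows "measure_pmf.expectation p (rel_density p q) \<ge> 0"
proof -
  have "0 \<le> (1 - measure_pmf.expectation p (\<lambda>z. pmf q z / pmf p z)) / ln 2"
    using expectation_ratio_le_1[where p = p and q = q] by simp
  also have "\<dots> = measure_pmf.expectation p (\<lambda>z. (1 - pmf q z / pmf p z) / ln 2)"
    using integrable_ratio[where p = p and q = q] by simp
  also have "\<dots> \<le> measure_pmf.expectation p (rel_density p q)"
  proof (rule integral_mono_AE)
    show "AE z in measure_pmf p. (1 - pmf q z / pmf p z) / ln 2 \<le> rel_density p q z"
    proof (intro AE_pmfI)
      fix z assume z: "z \<in> set_pmf p"
      then have p: "pmf p z > 0" "pmf q z > 0" using pos by (auto simp: pmf_positive)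
      have "ln (pmf q z / pmf p z) \<le> pmf q z / pmf p z - 1" using p by (intro ln_le_minus_one) auto
      then have "1 - pmf q z / pmf p z \<le> ln (pmf p z / pmf q z)" using p by (simp add: ln_div)
      then show "(1 - pmf q z / pmf p z) / ln 2 \<le> rel_density p q z"
        by (simp add: rel_density_def log_def divide_right_mono)
    qed
  qed (use integrable_ratio[where p = p and q = q] int in auto)
  finally show ?thesis .
qed

section \<open>Conditional and joint laws\<close>

definition cond_law :: "('a \<times> 'b) pmf \<Rightarrow> 'a \<Rightarrow> 'b pmf" where
  "cond_law K a = map_pmf snd (cond_pmf K {z. fst z = a})"

lemma pmf_cond_law:
  assumes "pmf (map_pmf fst K) a > 0"
  shows "pmf (cond_law K a) b = pmf K (a, b) / pmf (map_pmf fst K) a"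
proof -
  have ne: "set_pmf K \<inter> {z. fst z = a} \<noteq> {}"
    using assms by (auto simp: pmf_positive_iff)
  have "pmf (cond_law K a) b = measure_pmf.prob (cond_pmf K {z. fst z = a}) {(a, b)}"
    unfolding cond_law_def pmf_map
  proof (rule measure_eq_AE)
    show "AE z in measure_pmf (cond_pmf K {z. fst z = a}). (z \<in> snd -` {b}) = (z \<in> {(a, b)})"
      using set_cond_pmf[OF ne] by (intro AE_pmfI) auto
  qed auto
  also have "\<dots> = pmf K (a, b) / measure_pmf.prob K {z. fst z = a}"
    using pmf_cond[OF ne] by (simp add: measure_pmf_single)
  finally show ?thesis by (simp add: pmf_map vimage_def)
qed

definition joint_law :: "'z pmf \<Rightarrow> ('z \<Rightarrow> 's pmf) \<Rightarrow> ('s \<times> 'z) pmf" where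
  "joint_law P \<kappa> = bind_pmf P (\<lambda>z. map_pmf (\<lambda>s. (s, z)) (\<kappa> z))"

lemma pmf_joint_law: "pmf (joint_law P \<kappa>) (s, z) = pmf P z * pmf (\<kappa> z) s"
proof -
  have "ennreal (pmf (joint_law P \<kappa>) (s, z)) = (\<integral>\<^sup>+z'. ennreal (pmf (\<kappa> z) s) * indicator {z} z' \<partial>P)"
    unfolding joint_law_def ennreal_pmf_bind
  proof (intro nn_integral_cong)
    fix z'
    show "ennreal (pmf (map_pmf (\<lambda>s. (s, z')) (\<kappa> z')) (s, z)) = ennreal (pmf (\<kappa> z) s) * indicator {z} z'"
    proof (cases "z' = z")
      case True
      have "pmf (map_pmf (\<lambda>s. (s, z)) (\<kappa> z)) (s, z) = pmf (\<kappa> z) s"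
        using pmf_map_inj'[of "\<lambda>s. (s, z)" "\<kappa> z" s] by (simp add: inj_on_def)
      then show ?thesis using True by simp
    next
      case False
      then have "(s, z) \<notin> set_pmf (map_pmf (\<lambda>s. (s, z')) (\<kappa> z'))" by auto
      then show ?thesis using False by (simp add: pmf_eq_0_set_pmf)
    qed
  qed
  also have "\<dots> = ennreal (pmf P z * pmf (\<kappa> z) s)"
    by (subst nn_integral_cmult_indicator) (simp_all add: emeasure_pmf_single ennreal_mult mult.commute)
  finally show ?thesis by simp
qed

section \<open>Private coin protocols\<close>

lemma emeasure_pair_AE_const:
  assumes "prob_space U" "AE u in U. u = c" "sigma_finite_measure N" "S \<in> sets (U \<Otimes>\<^sub>M N)"
  shows "emeasure (U \<Otimes>\<^sub>M N) S = emeasure N (Pair c -` S)"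
proof -
  interpret U: prob_space U by fact
  have "emeasure (U \<Otimes>\<^sub>M N) S = (\<integral>\<^sup>+u. emeasure N (Pair u -` S) \<partial>U)"
    by (rule sigma_finite_measure.emeasure_pair_measure_alt[OF assms(3,4)])
  also have "\<dots> = (\<integral>\<^sup>+u. emeasure N (Pair c -` S) \<partial>U)"
    using assms(2) by (intro nn_integral_cong_AE) auto
  also have "\<dots> = emeasure N (Pair c -` S)" by (simp add: U.emeasure_space_1)
  finally show ?thesis .
qed

lemma emeasure_pmf_pair_section:
  assumes "sigma_finite_measure N" "S \<in> sets (measure_pmf P \<Otimes>\<^sub>M N)"
  shows "emeasure (measure_pmf P \<Otimes>\<^sub>M N) S \<ge> ennreal (pmf P z) * emeasure N (Pair z -` S)"
    and "(\<And>z' r. (z', r) \<in> S \<Longrightarrow> z' = z) \<Longrightarrow>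
      emeasure (measure_pmf P \<Otimes>\<^sub>M N) S = ennreal (pmf P z) * emeasure N (Pair z -` S)"
proof -
  have *: "emeasure (measure_pmf P \<Otimes>\<^sub>M N) S = (\<integral>\<^sup>+z. emeasure N (Pair z -` S) \<partial>P)"
    by (rule sigma_finite_measure.emeasure_pair_measure_alt[OF assms])
  have ind: "(\<integral>\<^sup>+z'. emeasure N (Pair z -` S) * indicator {z} z' \<partial>P) = ennreal (pmf P z) * emeasure N (Pair z -` S)"
    by (subst nn_integral_cmult_indicator) (simp_all add: emeasure_pmf_single mult.commute)
  show "emeasure (measure_pmf P \<Otimes>\<^sub>M N) S \<ge> ennreal (pmf P z) * emeasure N (Pair z -` S)"
    unfolding * ind[symmetric] by (intro nn_integral_mono) (auto simp: indicator_def)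
  assume only: "\<And>z' r. (z', r) \<in> S \<Longrightarrow> z' = z"
  show "emeasure (measure_pmf P \<Otimes>\<^sub>M N) S = ennreal (pmf P z) * emeasure N (Pair z -` S)"
    unfolding * ind[symmetric]
  proof (intro nn_integral_cong)
    fix z'
    show "emeasure N (Pair z' -` S) = emeasure N (Pair z -` S) * indicator {z} z'"
    proof (cases "z' = z")
      case False
      then have "Pair z' -` S = {}" using only by auto
      then show ?thesis using False by simp
    qed simp
  qed
qed

text \<open>Both sides have total mass 1, so no inequality can be strict. Thanks to this,
  \<open>product_law_eq\<close> can be proved by one inclusion of events.\<close>

lemma pmf_eq_of_le:
  assumes "\<And>z. pmf p z \<le> pmf q z"
  shows "p = q"
  using pmf_neq_exists_less[of q p] assms by (metis not_le)

text \<open>The state after \<open>i\<close> rounds read off the complete transcript. A finished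
  transcript is repeated, so that transcripts with different numbers of rounds all become chains of
  equal length.\<close>

definition state_at :: "nat \<Rightarrow> transcript \<Rightarrow> transcript \<times> next_state" where
  "state_at i \<tau> = (if length \<tau> \<le> i then (\<tau>, Stop) else (take i \<tau>, Continue))"

lemma run_state_at:
  assumes "terminates \<pi> \<omega>"
  shows "run \<pi> \<omega> i = state_at i (transcript_of \<pi> \<omega>)"
proof -
  note r = terminates_run[OF assms]
  show ?thesis
  proof (cases "length (transcript_of \<pi> \<omega>) \<le> i")
    case True
    then show ?thesis
      using run_Stop_mono[OF r, of "i - length (transcript_of \<pi> \<omega>)"] by (simp add: state_at_def)
  next
    case False
    then show ?thesis using run_history(2)[OF r, of i] by (simp add: state_at_def)
  qed
qed

lemma valid_state_at: "\<tau> \<noteq> [] \<Longrightarrow> valid_state i (state_at i \<tau>)"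
  by (auto simp: valid_state_def state_at_def)

text \<open>The part of \<open>run \<pi> \<omega> i = hs\<close> that depends on the view of one party; in the rounds selected by
  \<open>own\<close> it speaks, and in those selected by \<open>cb\<close> its codebook determines the next state.\<close>

definition view_fits :: "(nat \<Rightarrow> bool) \<Rightarrow> (nat \<Rightarrow> bool) \<Rightarrow> ('i, 'r, 'u) party \<Rightarrow> 'i \<Rightarrow> transcript \<times> next_state
    \<Rightarrow> 'r \<Rightarrow> 'u \<Rightarrow> bool" where
  "view_fits own cb p x hs r u \<longleftrightarrow> (\<forall>j<length (fst hs).
     (own j \<longrightarrow> message_of p x r u (take j (fst hs)) = fst hs ! j) \<and>
     (cb j \<longrightarrow> (codebook_of p x r u (take j (fst hs)) (fst hs ! j) = Some Continue) = goes_on hs j))"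

text \<open>The event that a run is in state \<open>hs\<close> is a condition on Party 1's view
  together with a condition on Party 2's view. \<open>cb\<close> chooses whose codebook is consulted
  in each round; agreement is assumed where Party 2's replaces the codebook used by
  \<open>run\<close>.\<close>

lemma run_eq_iff_views:
  assumes agree: "\<And>j h. run \<pi> ((x, y), u, a, b) j = (h, Continue) \<Longrightarrow> \<not> cb j \<Longrightarrow>
      codebook1 \<pi> ((x, y), u, a, b) h = codebook2 \<pi> ((x, y), u, a, b) h"
  shows "run \<pi> ((x, y), u, a, b) i = hs \<longleftrightarrow> valid_state i hs \<and>
     view_fits even cb (party1 \<pi>) x hs a u \<and> view_fits odd (\<lambda>j. \<not> cb j) (party2 \<pi>) y hs b u"
proof -
  let ?\<omega> = "((x, y), u, a, b)"
  obtain h s where hs: "hs = (h, s)" by fastforce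
  have len: "length (take j h) = j" if "j < length h" for j using that by simp
  show ?thesis
  proof
    assume "run \<pi> ?\<omega> i = hs"
    then have r: "run \<pi> ?\<omega> i = (h, s)" by (simp add: hs)
    note H = run_history[OF r]
    have "(even j \<longrightarrow> message_of (party1 \<pi>) x a u (take j h) = h ! j) \<and>
      (odd j \<longrightarrow> message_of (party2 \<pi>) y b u (take j h) = h ! j) \<and>
      (cb j \<longrightarrow> (codebook_of (party1 \<pi>) x a u (take j h) (h ! j) = Some Continue) = goes_on hs j) \<and>
      (\<not> cb j \<longrightarrow> (codebook_of (party2 \<pi>) y b u (take j h) (h ! j) = Some Continue) = goes_on hs j)"
      if j: "j < length h" for j
      using H(2)[OF j] agree[of j "take j h"] len[OF j] by (auto simp: hs)
    then show "valid_state i hs \<and> view_fits even cb (party1 \<pi>) x hs a u \<and> view_fits odd (\<lambda>j. \<not> cb j) (party2 \<pi>) y hs b u"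
      using H(1) by (simp add: hs view_fits_def)
  next
    assume R: "valid_state i hs \<and> view_fits even cb (party1 \<pi>) x hs a u \<and> view_fits odd (\<lambda>j. \<not> cb j) (party2 \<pi>) y hs b u"
    show "run \<pi> ?\<omega> i = hs"
      unfolding hs
    proof (rule runI)
      show "valid_state i (h, s)" using R by (simp add: hs)
      fix j assume j: "j < length h"
      show "sent_message \<pi> ?\<omega> (take j h) = h ! j"
        using R j len[OF j] by (simp add: hs view_fits_def)
      assume "run \<pi> ?\<omega> j = (take j h, Continue)"
      from agree[OF this] show "(codebook1 \<pi> ?\<omega> (take j h) (h ! j) = Some Continue) = goes_on (h, s) j"
        using R j by (cases "cb j") (simp_all add: hs view_fits_def)
    qed
  qed
qed

lemma measurable_view_fits:
  assumes "measurable_party U p"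
  shows "Measurable.pred (private_rand p \<Otimes>\<^sub>M U) (\<lambda>(r, u). view_fits own cb p x hs r u)"
proof -
  have m: "Measurable.pred (private_rand p \<Otimes>\<^sub>M U) (\<lambda>q. message_of p x (fst q) (snd q) h = v)" for h v
    using assms measurable_compose[of "\<lambda>(r, u). message_of p x r u h" "private_rand p \<Otimes>\<^sub>M U" "count_space UNIV" "\<lambda>m. m = v" "count_space UNIV"]
    by (simp add: measurable_party_def case_prod_beta')
  have c: "Measurable.pred (private_rand p \<Otimes>\<^sub>M U) (\<lambda>q. (codebook_of p x (fst q) (snd q) h m = Some Continue) = g)" for h m g
    using assms measurable_compose[of "\<lambda>(r, u). codebook_of p x r u h m" "private_rand p \<Otimes>\<^sub>M U" "count_space UNIV" "\<lambda>m. (m = Some Continue) = g" "count_space UNIV"]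
    by (simp add: measurable_party_def case_prod_beta')
  have "Measurable.pred (private_rand p \<Otimes>\<^sub>M U) (\<lambda>q. \<forall>j\<in>{..<length (fst hs)}.
     (own j \<longrightarrow> message_of p x (fst q) (snd q) (take j (fst hs)) = fst hs ! j) \<and>
     (cb j \<longrightarrow> (codebook_of p x (fst q) (snd q) (take j (fst hs)) (fst hs ! j) = Some Continue) = goes_on hs j))"
    unfolding pred_def
  proof (intro sets.sets_Collect_finite_All sets.sets_Collect_conj)
    fix j
    show "{q \<in> space (private_rand p \<Otimes>\<^sub>M U). own j \<longrightarrow> message_of p x (fst q) (snd q) (take j (fst hs)) = fst hs ! j}
      \<in> sets (private_rand p \<Otimes>\<^sub>M U)"
      using m[of "take j (fst hs)" "fst hs ! j"] by (cases "own j") (simp_all add: pred_def)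
    show "{q \<in> space (private_rand p \<Otimes>\<^sub>M U). cb j \<longrightarrow>
        (codebook_of p x (fst q) (snd q) (take j (fst hs)) (fst hs ! j) = Some Continue) = goes_on hs j}
      \<in> sets (private_rand p \<Otimes>\<^sub>M U)"
      using c[of "take j (fst hs)" "fst hs ! j" "goes_on hs j"] by (cases "cb j") (simp_all add: pred_def)
  qed simp
  moreover have "(\<lambda>(r, u). view_fits own cb p x hs r u) = (\<lambda>q. \<forall>j\<in>{..<length (fst hs)}.
     (own j \<longrightarrow> message_of p x (fst q) (snd q) (take j (fst hs)) = fst hs ! j) \<and>
     (cb j \<longrightarrow> (codebook_of p x (fst q) (snd q) (take j (fst hs)) (fst hs ! j) = Some Continue) = goes_on hs j))"
    by (auto simp: view_fits_def fun_eq_iff)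
  ultimately show ?thesis by (simp only:)
qed

section \<open>The law of the states of a private coin protocol\<close>

locale private_coin_protocol =
  fixes P :: "('x::finite \<times> 'y::finite) pmf" and \<pi> :: "('x, 'y, 'a, 'b, 'u) protocol" and c :: 'u and d :: nat
  assumes ip: "interactive_protocol P \<pi>"
    and coin: "AE u in public_rand \<pi>. u = c"
    and rounds: "AE \<omega> in execution_space P \<pi>. length (transcript_of \<pi> \<omega>) \<le> d"
begin

abbreviation "U \<equiv> public_rand \<pi>"
abbreviation "A \<equiv> private_rand (party1 \<pi>)"
abbreviation "B \<equiv> private_rand (party2 \<pi>)"
abbreviation "E \<equiv> execution_space P \<pi>"

lemma probs: "prob_space U" "prob_space A" "prob_space B" "prob_space E" "prob_space (A \<Otimes>\<^sub>M B)" "prob_space (randomness \<pi>)"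
  using ip prob_space_execution[OF ip] by (auto simp: interactive_protocol_def intro: prob_space_pair)

lemma meas: "measurable_protocol \<pi>" "measurable_party U (party1 \<pi>)" "measurable_party U (party2 \<pi>)"
  using interactive_measurable[OF ip] by (auto simp: measurable_protocol_def)

lemma c_space: "c \<in> space U"
proof -
  have "AE u in U. c \<in> space U" using coin AE_space by eventually_elim auto
  then show ?thesis by (simp add: prob_space.AE_const[OF probs(1)])
qed

text \<open>Likelihood factors of the two parties: with the public coin fixed at \<open>c\<close>,
  the probability that private randomness makes a party with the given input behave as in
  \<open>hs\<close>.\<close>

definition \<alpha> :: "(nat \<Rightarrow> bool) \<Rightarrow> 'x \<Rightarrow> transcript \<times> next_state \<Rightarrow> real" where
  "\<alpha> cb x hs = measure A {a \<in> space A. view_fits even cb (party1 \<pi>) x hs a c}"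
definition \<beta> :: "(nat \<Rightarrow> bool) \<Rightarrow> 'y \<Rightarrow> transcript \<times> next_state \<Rightarrow> real" where
  "\<beta> cb y hs = measure B {b \<in> space B. view_fits odd (\<lambda>j. \<not> cb j) (party2 \<pi>) y hs b c}"

lemma sets_fits:
  "{a \<in> space A. view_fits own cb (party1 \<pi>) x hs a c} \<in> sets A"
  "{b \<in> space B. view_fits own cb (party2 \<pi>) y hs b c} \<in> sets B"
proof -
  have "(\<lambda>a. (a, c)) \<in> A \<rightarrow>\<^sub>M A \<Otimes>\<^sub>M U" "(\<lambda>b. (b, c)) \<in> B \<rightarrow>\<^sub>M B \<Otimes>\<^sub>M U"
    using c_space by (auto intro: measurable_Pair2')
  from measurable_compose[OF this(1) measurable_view_fits[OF meas(2), of own cb x hs]]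
    measurable_compose[OF this(2) measurable_view_fits[OF meas(3), of own cb y hs]]
  show "{a \<in> space A. view_fits own cb (party1 \<pi>) x hs a c} \<in> sets A"
    "{b \<in> space B. view_fits own cb (party2 \<pi>) y hs b c} \<in> sets B"
    by (simp_all add: pred_def)
qed

text \<open>Once the public coin is fixed, the event is a rectangle in the two independent spaces of
  private randomness.\<close>

lemma measure_views:
  defines "S \<equiv> \<lambda>cb x y hs. {\<omega> \<in> space E. input1 \<omega> = x \<and> input2 \<omega> = y \<and>
     (case \<omega> of (z, u, a, b) \<Rightarrow> view_fits even cb (party1 \<pi>) x hs a u \<and> view_fits odd (\<lambda>j. \<not> cb j) (party2 \<pi>) y hs b u)}"
  shows "S cb x y hs \<in> sets E" "measure E (S cb x y hs) = pmf P (x, y) * (\<alpha> cb x hs * \<beta> cb y hs)"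
proof -
  let ?V = "{r \<in> space (randomness \<pi>). case r of (u, a, b) \<Rightarrow>
    view_fits even cb (party1 \<pi>) x hs a u \<and> view_fits odd (\<lambda>j. \<not> cb j) (party2 \<pi>) y hs b u}"
  have S: "S cb x y hs = {(x, y)} \<times> ?V"
    by (auto simp: S_def space_execution input1_def input2_def)
  have "Measurable.pred (randomness \<pi>) (\<lambda>(u, a, b). view_fits even cb (party1 \<pi>) x hs a u)"
    "Measurable.pred (randomness \<pi>) (\<lambda>(u, a, b). view_fits odd (\<lambda>j. \<not> cb j) (party2 \<pi>) y hs b u)"
    by (intro measurable_view1 measurable_view2 measurable_view_fits meas)+
  then have "Measurable.pred (randomness \<pi>) (\<lambda>r. (case r of (u, a, b) \<Rightarrow> view_fits even cb (party1 \<pi>) x hs a u) \<and>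
      (case r of (u, a, b) \<Rightarrow> view_fits odd (\<lambda>j. \<not> cb j) (party2 \<pi>) y hs b u))"
    by (rule pred_intros_logic)
  then have V: "?V \<in> sets (randomness \<pi>)" by (simp add: pred_def case_prod_beta')
  interpret AB: prob_space "A \<Otimes>\<^sub>M B" by (rule probs)
  interpret B: prob_space B by (rule probs)
  interpret A: prob_space A by (rule probs)
  show "S cb x y hs \<in> sets E" unfolding S execution_space_alt using V by (intro pair_measureI) auto
  have "emeasure E (S cb x y hs) = emeasure (measure_pmf P) {(x, y)} * emeasure (randomness \<pi>) ?V"
    unfolding S execution_space_alt using V
    by (intro sigma_finite_measure.emeasure_pair_measure_Times[OF prob_space_imp_sigma_finite[OF probs(6)]]) auto
  also have "emeasure (randomness \<pi>) ?V = emeasure (A \<Otimes>\<^sub>M B) (Pair c -` ?V)"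
    by (rule emeasure_pair_AE_const[OF probs(1) coin prob_space_imp_sigma_finite[OF probs(5)] V])
  also have "Pair c -` ?V = {a \<in> space A. view_fits even cb (party1 \<pi>) x hs a c} \<times> {b \<in> space B. view_fits odd (\<lambda>j. \<not> cb j) (party2 \<pi>) y hs b c}"
    using c_space by (auto simp: space_pair_measure)
  also have "emeasure (A \<Otimes>\<^sub>M B) \<dots> = ennreal (\<alpha> cb x hs) * ennreal (\<beta> cb y hs)"
    unfolding \<alpha>_def \<beta>_def using sets_fits
    by (subst B.emeasure_pair_measure_Times) (auto simp: A.emeasure_eq_measure B.emeasure_eq_measure)
  also have "emeasure (measure_pmf P) {(x, y)} * (ennreal (\<alpha> cb x hs) * ennreal (\<beta> cb y hs))
      = ennreal (pmf P (x, y) * (\<alpha> cb x hs * \<beta> cb y hs))"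
    by (simp add: emeasure_pmf_single ennreal_mult \<alpha>_def \<beta>_def)
  finally show "measure E (S cb x y hs) = pmf P (x, y) * (\<alpha> cb x hs * \<beta> cb y hs)"
    by (simp add: measure_def \<alpha>_def \<beta>_def)
qed

lemma AE_regular: "AE \<omega> in E. terminates \<pi> \<omega> \<and> length (transcript_of \<pi> \<omega>) \<le> d \<and>
    (\<forall>i h. run \<pi> \<omega> i = (h, Continue) \<longrightarrow> codebook1 \<pi> \<omega> h = codebook2 \<pi> \<omega> h)"
proof -
  have "AE \<omega> in E. terminates \<pi> \<omega>" "AE \<omega> in E. \<forall>i h. run \<pi> \<omega> i = (h, Continue) \<longrightarrow>
        codebook1 \<pi> \<omega> h = codebook2 \<pi> \<omega> h \<and> sent_message \<pi> \<omega> h \<in> dom (codebook1 \<pi> \<omega> h)"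
    using ip by (simp_all add: interactive_protocol_def)
  then show ?thesis using rounds by eventually_elim blast
qed

text \<open>The law called \<open>Q\<close> in the overview.\<close>

definition J :: "(transcript \<times> 'x \<times> 'y) pmf" where
  "J = (SOME p. measure_pmf p = distr E (count_space UNIV) (\<lambda>\<omega>. (transcript_of \<pi> \<omega>, input1 \<omega>, input2 \<omega>)))"

lemma meas_J: "(\<lambda>\<omega>. (transcript_of \<pi> \<omega>, input1 \<omega>, input2 \<omega>)) \<in> E \<rightarrow>\<^sub>M count_space UNIV"
proof -
  have "(\<lambda>\<omega>. (transcript_of \<pi> \<omega>, input1 \<omega>, input2 \<omega>)) \<in> E \<rightarrow>\<^sub>M count_space UNIV \<Otimes>\<^sub>M (count_space UNIV \<Otimes>\<^sub>M count_space UNIV)"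
    using measurable_transcript_of[OF meas(1)] measurable_input1 measurable_input2 by (intro measurable_Pair)
  then show ?thesis by (simp add: pair_measure_countable)
qed

lemma J: "measure_pmf J = distr E (count_space UNIV) (\<lambda>\<omega>. (transcript_of \<pi> \<omega>, input1 \<omega>, input2 \<omega>))"
proof -
  have "prob_space (distr E (count_space UNIV) (\<lambda>\<omega>. (transcript_of \<pi> \<omega>, input1 \<omega>, input2 \<omega>)))"
    by (rule prob_space.prob_space_distr[OF probs(4) meas_J])
  then obtain p where "measure_pmf p = distr E (count_space UNIV) (\<lambda>\<omega>. (transcript_of \<pi> \<omega>, input1 \<omega>, input2 \<omega>))"
    by (rule prob_space_countable_pmf) simp
  then show ?thesis unfolding J_def by (rule someI)
qed

lemma AE_J: "(AE z in measure_pmf J. Q z) \<longleftrightarrow> (AE \<omega> in E. Q (transcript_of \<pi> \<omega>, input1 \<omega>, input2 \<omega>))"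
  unfolding J by (rule AE_distr_iff[OF meas_J]) simp

lemma support_J:
  assumes "(\<tau>, x, y) \<in> set_pmf J"
  shows "\<tau> \<noteq> []" "length \<tau> \<le> d"
proof -
  have "AE z in measure_pmf J. fst z \<noteq> [] \<and> length (fst z) \<le> d"
    unfolding AE_J using AE_regular
  proof eventually_elim
    case (elim \<omega>)
    then show ?case using run_history(1)[OF terminates_run[of \<pi> \<omega>]] by (auto simp: valid_state_def)
  qed
  then show "\<tau> \<noteq> []" "length \<tau> \<le> d" using assms by (auto simp: AE_measure_pmf_iff)
qed

definition Jst :: "nat \<Rightarrow> ((transcript \<times> next_state) \<times> 'x \<times> 'y) pmf" where
  "Jst i = map_pmf (\<lambda>(\<tau>, x, y). (state_at i \<tau>, x, y)) J"

text \<open>The two choices of \<open>cb\<close> serve different purposes. With \<open>even\<close>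
  the speaker's codebook decides, so that the listener's factor does not change in a round. With the
  constant \<open>True\<close> the codebook is the one used by \<open>run\<close> itself, so the
  identification of runs holds without any exceptional set.\<close>

lemma pmf_Jst:
  assumes valid: "valid_state i hs" and cb: "cb = even \<or> cb = (\<lambda>_. True)"
  shows "pmf (Jst i) (hs, x, y) = pmf P (x, y) * (\<alpha> cb x hs * \<beta> cb y hs)"
proof -
  let ?S = "{\<omega> \<in> space E. input1 \<omega> = x \<and> input2 \<omega> = y \<and>
     (case \<omega> of (z, u, a, b) \<Rightarrow> view_fits even cb (party1 \<pi>) x hs a u \<and> view_fits odd (\<lambda>j. \<not> cb j) (party2 \<pi>) y hs b u)}"
  let ?out = "\<lambda>\<omega>. (transcript_of \<pi> \<omega>, input1 \<omega>, input2 \<omega>)"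
  have "pmf (Jst i) (hs, x, y) = measure (measure_pmf J) ((\<lambda>(\<tau>, x, y). (state_at i \<tau>, x, y)) -` {(hs, x, y)})"
    by (simp add: Jst_def pmf_map)
  also have "\<dots> = measure E (?out -` ((\<lambda>(\<tau>, x, y). (state_at i \<tau>, x, y)) -` {(hs, x, y)}) \<inter> space E)"
    unfolding J by (rule measure_distr[OF meas_J]) simp
  also have "\<dots> = measure E ?S"
  proof (rule measure_eq_AE)
    show "AE \<omega> in E. (\<omega> \<in> ?out -` ((\<lambda>(\<tau>, x, y). (state_at i \<tau>, x, y)) -` {(hs, x, y)}) \<inter> space E) = (\<omega> \<in> ?S)"
      using AE_regular AE_space
    proof eventually_elim
      case (elim \<omega>)
      obtain x' y' u a b where \<omega>: "\<omega> = ((x', y'), u, a, b)" by (metis prod.exhaust)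
      have r: "run \<pi> \<omega> i = state_at i (transcript_of \<pi> \<omega>)" using elim by (intro run_state_at) simp
      have agree: "run \<pi> \<omega> j = (h, Continue) \<Longrightarrow> codebook1 \<pi> \<omega> h = codebook2 \<pi> \<omega> h" for j h
        using elim by blast
      have "state_at i (transcript_of \<pi> \<omega>) = hs \<longleftrightarrow>
        view_fits even cb (party1 \<pi>) x' hs a u \<and> view_fits odd (\<lambda>j. \<not> cb j) (party2 \<pi>) y' hs b u"
        unfolding r[symmetric] unfolding \<omega>
        by (subst run_eq_iff_views[where cb = cb]) (use agree valid in \<open>auto simp: \<omega>\<close>)
      then show ?case using elim by (auto simp: \<omega> input1_def input2_def)
    qed
    show "?out -` ((\<lambda>(\<tau>, x, y). (state_at i \<tau>, x, y)) -` {(hs, x, y)}) \<inter> space E \<in> sets E"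
      by (rule measurable_sets[OF meas_J]) simp
    show "?S \<in> sets E" by (rule measure_views)
  qed
  also have "\<dots> = pmf P (x, y) * (\<alpha> cb x hs * \<beta> cb y hs)" by (rule measure_views)
  finally show ?thesis .
qed

lemma view_fits_step:
  assumes "\<not> own i" "\<not> cb i"
  shows "view_fits own cb p x (state_at (Suc i) \<tau>) r u = view_fits own cb p x (state_at i \<tau>) r u"
proof (cases "length \<tau> \<le> i")
  case True
  then show ?thesis by (simp add: state_at_def)
next
  case False
  define hs where "hs = state_at (Suc i) \<tau>"
  have h: "fst hs = take (Suc i) \<tau>" and i: "i < length \<tau>"
    using False by (auto simp: hs_def state_at_def)
  have less: "(\<forall>j<Suc i. own j \<or> cb j \<longrightarrow> Q j) = (\<forall>j<i. own j \<or> cb j \<longrightarrow> Q j)" for Q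
    using assms by (auto simp: less_Suc_eq)
  \<comment> \<open>Positions before \<open>i\<close> are followed by \<open>Continue\<close> in
    both states, so no earlier constraint changes.\<close>
  have on: "goes_on hs j" if "j < i" for j
    using that h i by (cases hs) (auto simp: goes_on_def)
  have "view_fits own cb p x hs r u \<longleftrightarrow> (\<forall>j<Suc i. own j \<or> cb j \<longrightarrow>
     (own j \<longrightarrow> message_of p x r u (take j \<tau>) = \<tau> ! j) \<and>
     (cb j \<longrightarrow> (codebook_of p x r u (take j \<tau>) (\<tau> ! j) = Some Continue) = goes_on hs j))"
    using i by (auto simp: view_fits_def h min_absorb1)
  also have "\<dots> \<longleftrightarrow> (\<forall>j<i. own j \<or> cb j \<longrightarrow>
     (own j \<longrightarrow> message_of p x r u (take j \<tau>) = \<tau> ! j) \<and>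
     (cb j \<longrightarrow> (codebook_of p x r u (take j \<tau>) (\<tau> ! j) = Some Continue) = goes_on hs j))"
    by (rule less)
  also have "\<dots> \<longleftrightarrow> view_fits own cb p x (take i \<tau>, Continue) r u"
    using i on by (auto simp: view_fits_def min_absorb1 goes_on_def)
  finally show ?thesis using False by (simp add: hs_def state_at_def)
qed

lemma pmf_law1_finite: "pmf (law1 K) (t, x) = (\<Sum>y\<in>UNIV. pmf K (t, x, y))" for K :: "('s \<times> 'x \<times> 'y) pmf"
proof -
  have "pmf (law1 K) (t, x) = measure_pmf.prob K ((\<lambda>y. (t, x, y)) ` UNIV)"
    unfolding law1_def pmf_map by (rule arg_cong[where f = "measure_pmf.prob K"]) auto
  also have "\<dots> = (\<Sum>y\<in>UNIV. pmf K (t, x, y))"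
    by (subst measure_measure_pmf_finite) (auto simp: sum.reindex inj_on_def)
  finally show ?thesis .
qed

lemma pmf_law2_finite: "pmf (law2 K) (t, y) = (\<Sum>x\<in>UNIV. pmf K (t, x, y))" for K :: "('s \<times> 'x \<times> 'y) pmf"
proof -
  have "pmf (law2 K) (t, y) = measure_pmf.prob K ((\<lambda>x. (t, x, y)) ` UNIV)"
    unfolding law2_def pmf_map by (rule arg_cong[where f = "measure_pmf.prob K"]) auto
  also have "\<dots> = (\<Sum>x\<in>UNIV. pmf K (t, x, y))"
    by (subst measure_measure_pmf_finite) (auto simp: sum.reindex inj_on_def)
  finally show ?thesis .
qed

text \<open>In a round of Party 1 only the \<alpha> factor changes, by an amount that depends on
  \<open>x\<close> and not on \<open>y\<close>. Hence the next state is independent of Party 2's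
  input given \<open>x\<close> and the current state, which is written here without
  division.\<close>

lemma markov1:
  assumes "even i" "\<tau> \<noteq> []"
  shows "pmf (Jst (Suc i)) (state_at (Suc i) \<tau>, x, y) * pmf (law1 (Jst i)) (state_at i \<tau>, x)
    = pmf (Jst i) (state_at i \<tau>, x, y) * pmf (law1 (Jst (Suc i))) (state_at (Suc i) \<tau>, x)"
proof -
  have "\<beta> even y' (state_at (Suc i) \<tau>) = \<beta> even y' (state_at i \<tau>)" for y'
    unfolding \<beta>_def using assms by (subst view_fits_step) auto
  moreover have "pmf (Jst (Suc i)) (state_at (Suc i) \<tau>, x, y') = pmf P (x, y') * (\<alpha> even x (state_at (Suc i) \<tau>) * \<beta> even y' (state_at (Suc i) \<tau>))"
    "pmf (Jst i) (state_at i \<tau>, x, y') = pmf P (x, y') * (\<alpha> even x (state_at i \<tau>) * \<beta> even y' (state_at i \<tau>))" for y'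
    using assms by (intro pmf_Jst valid_state_at disjI1 refl; simp)+
  ultimately show ?thesis
    by (simp add: pmf_law1_finite sum_distrib_left sum_distrib_right mult_ac)
qed

lemma markov2:
  assumes "odd i" "\<tau> \<noteq> []"
  shows "pmf (Jst (Suc i)) (state_at (Suc i) \<tau>, x, y) * pmf (law2 (Jst i)) (state_at i \<tau>, y)
    = pmf (Jst i) (state_at i \<tau>, x, y) * pmf (law2 (Jst (Suc i))) (state_at (Suc i) \<tau>, y)"
proof -
  have "\<alpha> even x' (state_at (Suc i) \<tau>) = \<alpha> even x' (state_at i \<tau>)" for x'
    unfolding \<alpha>_def using assms by (subst view_fits_step) auto
  moreover have "pmf (Jst (Suc i)) (state_at (Suc i) \<tau>, x', y) = pmf P (x', y) * (\<alpha> even x' (state_at (Suc i) \<tau>) * \<beta> even y (state_at (Suc i) \<tau>))"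
    "pmf (Jst i) (state_at i \<tau>, x', y) = pmf P (x', y) * (\<alpha> even x' (state_at i \<tau>) * \<beta> even y (state_at i \<tau>))" for x'
    using assms by (intro pmf_Jst valid_state_at disjI1 refl; simp)+
  ultimately show ?thesis
    by (simp add: pmf_law2_finite sum_distrib_left sum_distrib_right mult_ac)
qed

end

section \<open>Product protocols\<close>

definition unzip3 :: "('t \<times> 'x \<times> 'y) list \<Rightarrow> 't list \<times> 'x list \<times> 'y list" where
  "unzip3 zs = (map fst zs, map (fst \<circ> snd) zs, map (snd \<circ> snd) zs)"

definition nfold :: "nat \<Rightarrow> ('t \<times> 'x \<times> 'y) pmf \<Rightarrow> ('t list \<times> 'x list \<times> 'y list) pmf" where
  "nfold n Q = map_pmf unzip3 (replicate_pmf n Q)"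

lemma inj_unzip3: "inj unzip3"
proof (rule injI)
  fix us vs :: "('t \<times> 'x \<times> 'y) list"
  assume "unzip3 us = unzip3 vs"
  then have eq: "map fst us = map fst vs" "map (fst \<circ> snd) us = map (fst \<circ> snd) vs" "map (snd \<circ> snd) us = map (snd \<circ> snd) vs"
    by (auto simp: unzip3_def)
  then have len: "length us = length vs" using map_eq_imp_length_eq by blast
  then show "us = vs"
  proof (rule nth_equalityI)
    fix i assume "i < length us"
    then show "us ! i = vs ! i"
      using len arg_cong[OF eq(1), of "\<lambda>l. l ! i"] arg_cong[OF eq(2), of "\<lambda>l. l ! i"] arg_cong[OF eq(3), of "\<lambda>l. l ! i"]
      by (simp add: prod_eq_iff)
  qed
qed

lemma inj_unzip2: "inj (\<lambda>zs. (map fst zs, map snd zs))"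
proof (rule injI)
  fix us vs :: "('x \<times> 'y) list"
  assume "(map fst us, map snd us) = (map fst vs, map snd vs)"
  then have "zip (map fst us) (map snd us) = zip (map fst vs) (map snd vs)" by simp
  then show "us = vs" by (simp only: zip_map_fst_snd)
qed

lemma pmf_nfold:
  assumes "length zs = n"
  shows "pmf (nfold n Q) (unzip3 zs) = (\<Prod>i<n. pmf Q (zs ! i))"
  unfolding nfold_def pmf_map_inj'[OF inj_unzip3] by (rule pmf_replicate_pmf[OF assms])

lemma set_nfold:
  "set_pmf (nfold n Q) = unzip3 ` {zs. length zs = n \<and> set zs \<subseteq> set_pmf Q}"
  by (auto simp: nfold_def set_replicate_pmf)

lemma pmf_iid_inputs:
  assumes "length zs = n"
  shows "pmf (iid_inputs n P) (map fst zs, map snd zs) = (\<Prod>i<n. pmf P (zs ! i))"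
  unfolding iid_inputs_def using pmf_map_inj'[OF inj_unzip2, of "replicate_pmf n P" zs] assms
  by (simp add: pmf_replicate_pmf)

lemma measurable_map_countable:
  fixes g :: "'i \<Rightarrow> 'w \<Rightarrow> 't::countable"
  assumes "\<And>i. i \<in> set is \<Longrightarrow> g i \<in> M \<rightarrow>\<^sub>M count_space UNIV"
  shows "(\<lambda>\<omega>. map (\<lambda>i. g i \<omega>) is) \<in> M \<rightarrow>\<^sub>M count_space UNIV"
  using assms
proof (induction "is")
  case (Cons i "is")
  have "(\<lambda>\<omega>. (\<lambda>t \<omega>. t # map (\<lambda>i. g i \<omega>) is) (g i \<omega>) \<omega>) \<in> M \<rightarrow>\<^sub>M count_space UNIV"
  proof (rule measurable_compose_countable[where f = "\<lambda>t \<omega>. t # map (\<lambda>i. g i \<omega>) is" and g = "g i"])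
    fix t :: 't
    show "(\<lambda>\<omega>. t # map (\<lambda>i. g i \<omega>) is) \<in> M \<rightarrow>\<^sub>M count_space UNIV"
      using Cons by (intro measurable_compose[of "\<lambda>\<omega>. map (\<lambda>i. g i \<omega>) is" M "count_space UNIV" "\<lambda>ts. t # ts"]) auto
  qed (use Cons in auto)
  then show ?case by simp
qed simp

context private_coin_protocol
begin

lemma pmf_J_views:
  assumes "(\<tau>, x, y) \<in> set_pmf J"
  shows "pmf J (\<tau>, x, y) = pmf P (x, y) * (\<alpha> (\<lambda>_. True) x (\<tau>, Stop) * \<beta> (\<lambda>_. True) y (\<tau>, Stop))"
    and "pmf (Jst d) ((\<tau>, Stop), x, y) = pmf J (\<tau>, x, y)"
proof -
  have "(\<lambda>(\<tau>, x, y). (state_at d \<tau>, x, y)) -` {((\<tau>, Stop), x, y)} = {(\<tau>, x, y)}"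
    using support_J[OF assms] by (auto simp: state_at_def split: if_splits)
  then show eq: "pmf (Jst d) ((\<tau>, Stop), x, y) = pmf J (\<tau>, x, y)"
    by (simp add: Jst_def pmf_map measure_pmf_single)
  have "valid_state d (\<tau>, Stop)" using support_J[OF assms] by (auto simp: valid_state_def)
  from pmf_Jst[OF this] show "pmf J (\<tau>, x, y) = pmf P (x, y) * (\<alpha> (\<lambda>_. True) x (\<tau>, Stop) * \<beta> (\<lambda>_. True) y (\<tau>, Stop))"
    by (simp add: eq[symmetric])
qed

lemma measurable_transcript_section:
  "(\<lambda>r. transcript_of \<pi> (z, r)) \<in> randomness \<pi> \<rightarrow>\<^sub>M count_space UNIV"
proof -
  have "(\<lambda>r. (z, r)) \<in> randomness \<pi> \<rightarrow>\<^sub>M measure_pmf P \<Otimes>\<^sub>M randomness \<pi>"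
    by (rule measurable_Pair1') simp
  from measurable_compose[OF this measurable_transcript_of[OF meas(1), unfolded execution_space_alt]]
  show ?thesis .
qed

abbreviation "powA n \<equiv> \<Pi>\<^sub>M i\<in>{..<n}. A"
abbreviation "powB n \<equiv> \<Pi>\<^sub>M i\<in>{..<n}. B"

lemma prob_space_powers: "prob_space (powA n)" "prob_space (powB n)" "prob_space (powA n \<Otimes>\<^sub>M powB n)"
proof -
  show a: "prob_space (powA n)" "prob_space (powB n)" by (intro prob_space_PiM probs)+
  then show "prob_space (powA n \<Otimes>\<^sub>M powB n)" by (rule prob_space_pair)
qed

definition transcripts :: "nat \<Rightarrow> ('x list \<times> 'y list) \<times> 'u \<times> (nat \<Rightarrow> 'a) \<times> (nat \<Rightarrow> 'b) \<Rightarrow> transcript list \<times> 'x list \<times> 'y list" where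
  "transcripts n = (\<lambda>((xs, ys), u, a, b).
     (map (\<lambda>i. transcript_of \<pi> ((xs ! i, ys ! i), u, a i, b i)) [0..<n], xs, ys))"

lemma measurable_transcripts:
  "transcripts n \<in> measure_pmf (iid_inputs n P) \<Otimes>\<^sub>M (U \<Otimes>\<^sub>M (powA n \<Otimes>\<^sub>M powB n)) \<rightarrow>\<^sub>M count_space UNIV"
proof (rule measurable_countable_fst)
  fix q :: "'x list \<times> 'y list"
  obtain xs ys where q: "q = (xs, ys)" by fastforce
  let ?N = "U \<Otimes>\<^sub>M (powA n \<Otimes>\<^sub>M powB n)"
  have "(\<lambda>r. map (\<lambda>i. transcript_of \<pi> ((xs ! i, ys ! i), fst r, fst (snd r) i, snd (snd r) i)) [0..<n]) \<in> ?N \<rightarrow>\<^sub>M count_space UNIV"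
  proof (rule measurable_map_countable)
    fix i assume "i \<in> set [0..<n]"
    then have i: "i \<in> {..<n}" by simp
    have "(\<lambda>r. (fst r, fst (snd r) i, snd (snd r) i)) \<in> ?N \<rightarrow>\<^sub>M randomness \<pi>"
    proof (intro measurable_Pair)
      show "fst \<in> ?N \<rightarrow>\<^sub>M U" by (rule measurable_fst)
      have a: "(\<lambda>r. fst (snd r)) \<in> ?N \<rightarrow>\<^sub>M powA n" "(\<lambda>r. snd (snd r)) \<in> ?N \<rightarrow>\<^sub>M powB n"
        by (rule measurable_compose[OF measurable_snd measurable_fst] measurable_compose[OF measurable_snd measurable_snd])+
      show "(\<lambda>r. fst (snd r) i) \<in> ?N \<rightarrow>\<^sub>M A"
        by (rule measurable_compose[OF a(1) measurable_component_singleton[OF i]])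
      show "(\<lambda>r. snd (snd r) i) \<in> ?N \<rightarrow>\<^sub>M B"
        by (rule measurable_compose[OF a(2) measurable_component_singleton[OF i]])
    qed
    from measurable_compose[OF this measurable_transcript_section]
    show "(\<lambda>r. transcript_of \<pi> ((xs ! i, ys ! i), fst r, fst (snd r) i, snd (snd r) i)) \<in> ?N \<rightarrow>\<^sub>M count_space UNIV" .
  qed
  from measurable_compose[OF this, of "\<lambda>ts. (ts, xs, ys)" "count_space UNIV"]
  have "(\<lambda>r. (map (\<lambda>i. transcript_of \<pi> ((xs ! i, ys ! i), fst r, fst (snd r) i, snd (snd r) i)) [0..<n], xs, ys)) \<in> ?N \<rightarrow>\<^sub>M count_space UNIV"
    by (simp only: measurable_count_space)
  moreover have "(\<lambda>r. transcripts n (q, r)) = (\<lambda>r. (map (\<lambda>i. transcript_of \<pi> ((xs ! i, ys ! i), fst r, fst (snd r) i, snd (snd r) i)) [0..<n], xs, ys))"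
    by (auto simp: transcripts_def q)
  ultimately show "(\<lambda>r. transcripts n (q, r)) \<in> ?N \<rightarrow>\<^sub>M count_space UNIV" by (simp only:)
qed

text \<open>The product of the rectangles of private randomness that produce the individual
  transcripts is contained in the event of producing the whole list, and its probability is already
  the value of \<open>nfold\<close>. By \<open>pmf_eq_of_le\<close> this inequality is an
  equality.\<close>

lemma product_law_eq: "product_law n P \<pi> = measure_pmf (nfold n J)"
proof -
  let ?I = "iid_inputs n P" and ?N = "U \<Otimes>\<^sub>M (powA n \<Otimes>\<^sub>M powB n)"
  have law: "product_law n P \<pi> = distr (measure_pmf ?I \<Otimes>\<^sub>M ?N) (count_space UNIV) (transcripts n)"
    by (simp only: product_law_def transcripts_def)
  have pN: "prob_space ?N" by (intro prob_space_pair probs prob_space_powers)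
  have "prob_space (measure_pmf ?I \<Otimes>\<^sub>M ?N)"
    by (intro prob_space_pair measure_pmf.prob_space_axioms pN)
  then have "prob_space (product_law n P \<pi>)"
    unfolding law by (rule prob_space.prob_space_distr[OF _ measurable_transcripts])
  then obtain q where q: "measure_pmf q = product_law n P \<pi>"
    by (rule prob_space_countable_pmf) (simp add: law)
  have "nfold n J = q"
  proof (rule pmf_eq_of_le)
    fix pt
    show "pmf (nfold n J) pt \<le> pmf q pt"
    proof (cases "pt \<in> set_pmf (nfold n J)")
      case False
      then show ?thesis by (simp add: set_pmf_iff)
    next
      case True
      then obtain zs where zs: "pt = unzip3 zs" "length zs = n" "set zs \<subseteq> set_pmf J" by (auto simp: set_nfold)
      define \<tau> where "\<tau> i = fst (zs ! i)" for i
      define x where "x i = fst (snd (zs ! i))" for i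
      define y where "y i = snd (snd (zs ! i))" for i
      have z: "(\<tau> i, x i, y i) = zs ! i" "(\<tau> i, x i, y i) \<in> set_pmf J" if "i < n" for i
        using that zs(2) subsetD[OF zs(3) nth_mem[of i zs]] by (simp_all add: \<tau>_def x_def y_def)
      define SA where "SA i = {a \<in> space A. view_fits even (\<lambda>_. True) (party1 \<pi>) (x i) (\<tau> i, Stop) a c}" for i
      define SB where "SB i = {b \<in> space B. view_fits odd (\<lambda>j. \<not> True) (party2 \<pi>) (y i) (\<tau> i, Stop) b c}" for i
      define q0 where "q0 = (map x [0..<n], map y [0..<n])"
      have pt: "pt = (map \<tau> [0..<n], map x [0..<n], map y [0..<n])"
        using zs(2) by (auto simp: zs(1) unzip3_def \<tau>_def x_def y_def intro!: nth_equalityI)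
      define S where "S = transcripts n -` {pt} \<inter> space (measure_pmf ?I \<Otimes>\<^sub>M ?N)"
      have S: "S \<in> sets (measure_pmf ?I \<Otimes>\<^sub>M ?N)"
        unfolding S_def by (rule measurable_sets[OF measurable_transcripts]) simp
      have S': "Pair q0 -` S \<in> sets ?N" by (rule sets_Pair1[OF S])
      have S'': "Pair c -` Pair q0 -` S \<in> sets (powA n \<Otimes>\<^sub>M powB n)" by (rule sets_Pair1[OF S'])
      have sub: "PiE {..<n} SA \<times> PiE {..<n} SB \<subseteq> Pair c -` Pair q0 -` S"
      proof clarify
        fix a b assume a: "a \<in> PiE {..<n} SA" and b: "b \<in> PiE {..<n} SB"
        have "transcript_of \<pi> ((x i, y i), c, a i, b i) = \<tau> i" if i: "i < n" for i
        proof (rule transcript_of_eqI)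
          have "a i \<in> SA i" "b i \<in> SB i" using a b i by (auto simp: PiE_iff)
          moreover have "valid_state d (\<tau> i, Stop)"
            using support_J[OF z(2)[OF i]] by (auto simp: valid_state_def)
          \<comment> \<open>Consulting Party 1's codebook in all rounds makes the agreement
            hypothesis vacuous, so the run is identified at every point of the rectangle.\<close>
          ultimately show "run \<pi> ((x i, y i), c, a i, b i) d = (\<tau> i, Stop)"
            by (subst run_eq_iff_views[where cb = "\<lambda>_. True"]) (auto simp: SA_def SB_def)
        qed
        then have "transcripts n (q0, c, a, b) = pt"
          by (auto simp: transcripts_def q0_def pt)
        moreover have "a \<in> space (powA n)" "b \<in> space (powB n)"
          using a b by (auto simp: space_PiM PiE_iff SA_def SB_def)
        ultimately show "(a, b) \<in> Pair c -` Pair q0 -` S"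
          using c_space
          by (simp add: S_def space_pair_measure)
      qed
      interpret PA: product_sigma_finite "\<lambda>_. A"
        by unfold_locales (rule sigma_finite_measure.sigma_finite_countable[OF prob_space_imp_sigma_finite[OF probs(2)]])
      interpret PB: product_sigma_finite "\<lambda>_. B"
        by unfold_locales (rule sigma_finite_measure.sigma_finite_countable[OF prob_space_imp_sigma_finite[OF probs(3)]])
      have sets: "SA i \<in> sets A" "SB i \<in> sets B" for i
        unfolding SA_def SB_def by (rule sets_fits)+
      have fm: "finite_measure A" "finite_measure B" using probs by (auto intro: prob_space.finite_measure)
      have eA: "emeasure (powA n) (PiE {..<n} SA) = ennreal (\<Prod>i<n. \<alpha> (\<lambda>_. True) (x i) (\<tau> i, Stop))"
        using PA.emeasure_PiM[of "{..<n}" SA] sets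
        by (simp add: finite_measure.emeasure_eq_measure[OF fm(1)] prod_ennreal \<alpha>_def SA_def)
      have eB: "emeasure (powB n) (PiE {..<n} SB) = ennreal (\<Prod>i<n. \<beta> (\<lambda>_. True) (y i) (\<tau> i, Stop))"
        using PB.emeasure_PiM[of "{..<n}" SB] sets
        by (simp add: finite_measure.emeasure_eq_measure[OF fm(2)] prod_ennreal \<beta>_def SB_def)
      have \<alpha>\<beta>: "\<alpha> cb u v \<ge> 0" "\<beta> cb u' v \<ge> 0" for cb u u' v by (simp_all add: \<alpha>_def \<beta>_def)
      have "ennreal (pmf (nfold n J) pt) = ennreal (\<Prod>i<n. pmf P (x i, y i) * (\<alpha> (\<lambda>_. True) (x i) (\<tau> i, Stop) * \<beta> (\<lambda>_. True) (y i) (\<tau> i, Stop)))"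
        unfolding zs(1) pmf_nfold[OF zs(2)]
        by (intro arg_cong[where f = ennreal] prod.cong refl) (simp add: z(1)[symmetric] pmf_J_views(1)[OF z(2)])
      also have "\<dots> = ennreal (\<Prod>i<n. pmf P (x i, y i)) * (emeasure (powA n) (PiE {..<n} SA) * emeasure (powB n) (PiE {..<n} SB))"
        unfolding prod.distrib eA eB by (simp add: ennreal_mult \<alpha>\<beta> prod_nonneg)
      also have "emeasure (powA n) (PiE {..<n} SA) * emeasure (powB n) (PiE {..<n} SB)
          = emeasure (powA n \<Otimes>\<^sub>M powB n) (PiE {..<n} SA \<times> PiE {..<n} SB)"
        using sets by (intro sigma_finite_measure.emeasure_pair_measure_Times[symmetric]
            prob_space_imp_sigma_finite prob_space_powers sets_PiM_I_finite) auto
      also have "(\<Prod>i<n. pmf P (x i, y i)) = pmf ?I q0"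
        using pmf_iid_inputs[of "map (\<lambda>i. (x i, y i)) [0..<n]" n P] by (simp add: q0_def comp_def)
      also have "ennreal (pmf ?I q0) * emeasure (powA n \<Otimes>\<^sub>M powB n) (PiE {..<n} SA \<times> PiE {..<n} SB)
          \<le> ennreal (pmf ?I q0) * emeasure (powA n \<Otimes>\<^sub>M powB n) (Pair c -` Pair q0 -` S)"
        by (intro mult_left_mono emeasure_mono sub S'') simp
      also have "emeasure (powA n \<Otimes>\<^sub>M powB n) (Pair c -` Pair q0 -` S) = emeasure ?N (Pair q0 -` S)"
        by (rule emeasure_pair_AE_const[OF probs(1) coin prob_space_imp_sigma_finite[OF prob_space_powers(3)] S', symmetric])
      also have "ennreal (pmf ?I q0) * emeasure ?N (Pair q0 -` S) \<le> emeasure (measure_pmf ?I \<Otimes>\<^sub>M ?N) S"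
        by (rule emeasure_pmf_pair_section[OF prob_space_imp_sigma_finite[OF pN] S])
      also have "\<dots> = emeasure (measure_pmf q) {pt}"
        unfolding q law S_def by (rule emeasure_distr[OF measurable_transcripts, symmetric]) simp
      finally show ?thesis by (simp add: emeasure_pmf_single)
    qed
  qed
  then show ?thesis using q by simp
qed

end

section \<open>Information complexity density\<close>

definition swap_inputs :: "'t \<times> 'x \<times> 'y \<Rightarrow> 't \<times> 'y \<times> 'x" where
  "swap_inputs = (\<lambda>(t, x, y). (t, y, x))"

text \<open>The logarithm of Q(t | x, y) / Q(t | y), with expectation I(T ; X | Y). The factors are
  arranged as in the general formula for conditional mutual information used below.\<close>

definition dens1 :: "('t \<times> 'x \<times> 'y) pmf \<Rightarrow> 't \<times> 'x \<times> 'y \<Rightarrow> real" where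
  "dens1 K = (\<lambda>(t, x, y). log 2 (pmf K (t, x, y) / (pmf (law2 K) (t, y) * (pmf (inputs_law K) (x, y) / pmf (in2 K) y))))"

definition dens2 :: "('t \<times> 'x \<times> 'y) pmf \<Rightarrow> 't \<times> 'x \<times> 'y \<Rightarrow> real" where
  "dens2 K = (\<lambda>(t, x, y). log 2 (pmf K (t, x, y) / (pmf (law1 K) (t, x) * (pmf (inputs_law K) (x, y) / pmf (in1 K) x))))"

lemma inj_swap_inputs: "inj swap_inputs"
  by (auto simp: inj_on_def swap_inputs_def)

lemma pmf_swap: "pmf (map_pmf swap_inputs K) (t, y, x) = pmf K (t, x, y)"
  using pmf_map_inj'[OF inj_swap_inputs, of K "(t, x, y)"] by (simp add: swap_inputs_def)

lemma pmf_swap_marginals: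
  "law2 (map_pmf swap_inputs K) = law1 K" "in2 (map_pmf swap_inputs K) = in1 K"
  "pmf (inputs_law (map_pmf swap_inputs K)) (y, x) = pmf (inputs_law K) (x, y)"
proof -
  have "inputs_law (map_pmf swap_inputs K) = map_pmf prod.swap (inputs_law K)"
    by (simp add: inputs_law_def swap_inputs_def map_pmf_comp case_prod_unfold prod.swap_def)
  then show "pmf (inputs_law (map_pmf swap_inputs K)) (y, x) = pmf (inputs_law K) (x, y)"
    using pmf_map_inj'[of prod.swap "inputs_law K" "(x, y)"] by simp
qed (simp_all add: law1_def law2_def in1_def in2_def swap_inputs_def map_pmf_comp case_prod_unfold)

lemma dens2_swap: "dens2 K z = dens1 (map_pmf swap_inputs K) (swap_inputs z)"
  by (cases z) (simp add: dens1_def dens2_def swap_inputs_def[THEN fun_cong] pmf_swap pmf_swap_marginals)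

text \<open>Points outside the support add \<open>1 / 0 = 0\<close> to the sum that serves as the
  constant. Through this constant the finiteness of the input alphabets enters the integrability
  proofs.\<close>

lemma finite_pmf_lower_bound:
  fixes P :: "'q::finite pmf"
  shows "\<exists>C\<ge>0. \<forall>q\<in>set_pmf P. 1 \<le> C * pmf P q"
proof (intro exI conjI ballI)
  show "(\<Sum>q\<in>UNIV. 1 / pmf P q) \<ge> 0" by (intro sum_nonneg) simp
  fix q assume q: "q \<in> set_pmf P"
  have "1 / pmf P q \<le> (\<Sum>q\<in>UNIV. 1 / pmf P q)" by (rule member_le_sum) auto
  then show "1 \<le> (\<Sum>q\<in>UNIV. 1 / pmf P q) * pmf P q" using pmf_positive[OF q] by (simp add: field_simps)
qed

lemma pmf_pair_fst_snd: "pmf (pair_pmf p q) z = pmf p (fst z) * pmf q (snd z)"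
  by (cases z) (simp add: pmf_pair)

lemma integrable_pmf_cong:
  fixes f g :: "'z \<Rightarrow> real"
  assumes "\<And>z. z \<in> set_pmf K \<Longrightarrow> f z = g z"
  shows "integrable (measure_pmf K) f \<longleftrightarrow> integrable (measure_pmf K) g"
  using assms by (intro integrable_cong_AE AE_pmfI) auto

lemma expectation_pmf_cong:
  fixes f g :: "'z \<Rightarrow> real"
  assumes "\<And>z. z \<in> set_pmf K \<Longrightarrow> f z = g z"
  shows "measure_pmf.expectation K f = measure_pmf.expectation K g"
  using assms by (intro integral_cong_AE AE_pmfI) auto

lemma pmf_le_marginal: "pmf K z \<le> pmf (map_pmf h K) (h z)"
  unfolding pmf_map by (simp add: measure_pmf_single[symmetric] measure_pmf.finite_measure_mono)

text \<open>The comparison law \<open>R\<close> draws the inputs and then \<open>t\<close> given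
  \<open>y\<close> only. On the support, \<open>K(t, x, y) <= K(t | y) <= C * R(t, x, y)\<close>, so
  \<open>integrable_rel_density\<close> applies to \<open>K\<close> against
  \<open>R\<close>.\<close>

lemma integrable_dens1:
  fixes K :: "('t \<times> 'x::finite \<times> 'y::finite) pmf"
  shows "integrable (measure_pmf K) (\<lambda>z. (dens1 K z)\<^sup>2)" "integrable (measure_pmf K) (dens1 K)"
proof -
  define L where "L = map_pmf (\<lambda>(t, x, y). (y, t)) K"
  define R where "R = joint_law (inputs_law K) (\<lambda>(x, y). cond_law L y)"
  have L: "map_pmf fst L = in2 K" "pmf L (y, t) = pmf (law2 K) (t, y)" for y t
  proof -
    show "map_pmf fst L = in2 K" by (simp add: L_def in2_def map_pmf_comp case_prod_unfold)
    have "L = map_pmf prod.swap (law2 K)" by (simp add: L_def law2_def map_pmf_comp case_prod_unfold prod.swap_def)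
    then show "pmf L (y, t) = pmf (law2 K) (t, y)"
      using pmf_map_inj'[of prod.swap "law2 K" "(t, y)"] by simp
  qed
  have R: "pmf R (t, x, y) = pmf (inputs_law K) (x, y) * (pmf (law2 K) (t, y) / pmf (in2 K) y)"
    if "pmf (in2 K) y > 0" for t x y
    using that by (simp add: R_def pmf_joint_law pmf_cond_law L)
  have pos: "pmf (in2 K) y > 0" "pmf (inputs_law K) (x, y) > 0" if "(t, x, y) \<in> set_pmf K" for t x y
    using that by (auto simp: in2_def inputs_law_def pmf_positive_iff image_iff intro!: bexI[of _ "(t, x, y)"])
  obtain C where C: "C \<ge> 0" "\<And>q. q \<in> set_pmf (inputs_law K) \<Longrightarrow> 1 \<le> C * pmf (inputs_law K) q"
    using finite_pmf_lower_bound[of "inputs_law K"] by blast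
  have dens: "rel_density K R z = dens1 K z" if "z \<in> set_pmf K" for z
    using that pos by (cases z) (simp add: rel_density_def dens1_def R field_simps)
  have le: "pmf K z \<le> C * pmf R z" if z: "z \<in> set_pmf K" for z
  proof -
    obtain t x y where zz: "z = (t, x, y)" by (cases z) auto
    note p = pos[OF z[unfolded zz]]
    have "pmf K z \<le> pmf (law2 K) (t, y)"
      using pmf_le_marginal[of K z "\<lambda>(t, x, y). (t, y)"] by (simp add: law2_def zz)
    also have "\<dots> \<le> pmf (law2 K) (t, y) / pmf (in2 K) y"
      using p by (simp add: field_simps mult_left_le_one_le pmf_le_1)
    also have "\<dots> \<le> (C * pmf (inputs_law K) (x, y)) * (pmf (law2 K) (t, y) / pmf (in2 K) y)"
      using mult_right_mono[OF C(2)[of "(x, y)"], of "pmf (law2 K) (t, y) / pmf (in2 K) y"] p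
      by (simp add: pmf_positive_iff)
    finally show ?thesis using p by (simp add: zz R)
  qed
  have "integrable (measure_pmf K) (\<lambda>z. (rel_density K R z)\<^sup>2)" "integrable (measure_pmf K) (rel_density K R)"
    using integrable_rel_density[OF le] by auto
  then show "integrable (measure_pmf K) (\<lambda>z. (dens1 K z)\<^sup>2)" "integrable (measure_pmf K) (dens1 K)"
    using integrable_pmf_cong[of K "\<lambda>z. (rel_density K R z)\<^sup>2" "\<lambda>z. (dens1 K z)\<^sup>2"]
      integrable_pmf_cong[of K "rel_density K R" "dens1 K"] dens by auto
qed

lemma integrable_dens2:
  fixes K :: "('t \<times> 'x::finite \<times> 'y::finite) pmf"
  shows "integrable (measure_pmf K) (\<lambda>z. (dens2 K z)\<^sup>2)" "integrable (measure_pmf K) (dens2 K)"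
  using integrable_dens1[of "map_pmf swap_inputs K"] unfolding integrable_map_pmf_eq dens2_swap[symmetric] .

lemma integrable_pmf_count_space:
  fixes f :: "'z \<Rightarrow> real"
  shows "integrable (count_space UNIV) (\<lambda>z. pmf K z * f z) \<longleftrightarrow> integrable (measure_pmf K) f"
    and "integral\<^sup>L (count_space UNIV) (\<lambda>z. pmf K z * f z) = measure_pmf.expectation K f"
  by (subst measure_pmf_eq_density, subst integrable_real_density integral_real_density; simp)+

lemma cond_mutual_info_eq:
  fixes X :: "'w \<Rightarrow> 't::countable" and Y :: "'w \<Rightarrow> 'x::finite" and Z :: "'w \<Rightarrow> 'y::finite"
  assumes "prob_space M" and XYZ: "X \<in> M \<rightarrow>\<^sub>M count_space UNIV" "Y \<in> M \<rightarrow>\<^sub>M count_space UNIV" "Z \<in> M \<rightarrow>\<^sub>M count_space UNIV"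
    and K: "measure_pmf K = distr M (count_space UNIV) (\<lambda>\<omega>. (X \<omega>, Y \<omega>, Z \<omega>))"
  shows "cond_mutual_info M X Y Z = measure_pmf.expectation K (dens1 K)"
proof -
  interpret prob_space M by fact
  interpret information_space M 2 by unfold_locales simp
  have m3: "(\<lambda>\<omega>. (X \<omega>, Y \<omega>, Z \<omega>)) \<in> M \<rightarrow>\<^sub>M count_space UNIV"
  proof -
    have "(\<lambda>\<omega>. (X \<omega>, Y \<omega>, Z \<omega>)) \<in> M \<rightarrow>\<^sub>M count_space UNIV \<Otimes>\<^sub>M (count_space UNIV \<Otimes>\<^sub>M count_space UNIV)"
      by (intro measurable_Pair XYZ)
    then show ?thesis by (simp add: pair_measure_countable)
  qed
  have D: "distributed M (count_space UNIV) (\<lambda>\<omega>. h (X \<omega>, Y \<omega>, Z \<omega>)) (\<lambda>q. ennreal (pmf (map_pmf h K) q))" for h :: "_ \<Rightarrow> 'q"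
  proof -
    have "distr M (count_space UNIV) (\<lambda>\<omega>. h (X \<omega>, Y \<omega>, Z \<omega>)) = distr (distr M (count_space UNIV) (\<lambda>\<omega>. (X \<omega>, Y \<omega>, Z \<omega>))) (count_space UNIV) h"
      by (subst distr_distr[OF _ m3]) (auto simp: comp_def)
    also have "\<dots> = measure_pmf (map_pmf h K)" by (simp add: K[symmetric] map_pmf_rep_eq)
    also have "\<dots> = density (count_space UNIV) (\<lambda>q. ennreal (pmf (map_pmf h K) q))"
      by (rule measure_pmf_eq_density)
    finally show ?thesis
      unfolding distributed_def using measurable_compose[OF m3, of h "count_space UNIV"] by simp
  qed
  have D3: "distributed M (count_space UNIV \<Otimes>\<^sub>M count_space UNIV \<Otimes>\<^sub>M count_space UNIV) (\<lambda>\<omega>. (X \<omega>, Y \<omega>, Z \<omega>)) (\<lambda>q. ennreal (pmf K q))"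
    using D[of "\<lambda>q. q"] by (simp add: pair_measure_countable)
  have D2: "distributed M (count_space UNIV \<Otimes>\<^sub>M count_space UNIV) (\<lambda>\<omega>. (X \<omega>, Z \<omega>)) (\<lambda>q. ennreal (pmf (law2 K) q))"
    using D[of "\<lambda>(t, x, y). (t, y)"] by (simp add: pair_measure_countable law2_def)
  have DI: "distributed M (count_space UNIV \<Otimes>\<^sub>M count_space UNIV) (\<lambda>\<omega>. (Y \<omega>, Z \<omega>)) (\<lambda>q. ennreal (pmf (inputs_law K) q))"
    using D[of snd] by (simp add: pair_measure_countable inputs_law_def)
  have DX: "distributed M (count_space UNIV) X (\<lambda>q. ennreal (pmf (map_pmf fst K) q))" using D[of fst] by simp
  have DZ: "distributed M (count_space UNIV) Z (\<lambda>q. ennreal (pmf (in2 K) q))"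
    using D[of "\<lambda>(t, x, y). y"] by (simp add: in2_def)
  have sf: "sigma_finite_measure (count_space (UNIV :: 'q::countable set))"
    by (rule sigma_finite_measure_count_space)
  \<comment> \<open>The two integrability side conditions concern densities against products of
    marginals, which dominate the joint laws up to a constant since the inputs are finite.\<close>
  have I1: "integrable (measure_pmf K) (\<lambda>(x, y, z). log 2 (pmf K (x, y, z) / (pmf (map_pmf fst K) x * pmf (inputs_law K) (y, z))))"
  proof -
    obtain C where C: "C \<ge> 0" "\<And>q. q \<in> set_pmf (inputs_law K) \<Longrightarrow> 1 \<le> C * pmf (inputs_law K) q"
      using finite_pmf_lower_bound[of "inputs_law K"] by blast
    have "pmf K q \<le> C * pmf (pair_pmf (map_pmf fst K) (inputs_law K)) q" if "q \<in> set_pmf K" for q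
    proof -
      have "snd q \<in> set_pmf (inputs_law K)" using that by (auto simp: inputs_law_def)
      have "pmf K q \<le> pmf (map_pmf fst K) (fst q)" by (rule pmf_le_marginal)
      also have "\<dots> \<le> pmf (map_pmf fst K) (fst q) * (C * pmf (inputs_law K) (snd q))"
        using mult_left_mono[OF C(2)[OF \<open>snd q \<in> set_pmf (inputs_law K)\<close>], of "pmf (map_pmf fst K) (fst q)"] by simp
      finally show ?thesis by (cases q) (simp add: pmf_pair mult_ac)
    qed
    from integrable_rel_density(2)[OF this] show ?thesis
      by (simp add: rel_density_def[abs_def] case_prod_beta' pmf_pair_fst_snd)
  qed
  have I2: "integrable (measure_pmf K) (\<lambda>(x, y, z). log 2 (pmf (law2 K) (x, z) / (pmf (map_pmf fst K) x * pmf (in2 K) z)))"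
  proof -
    obtain C where C: "C \<ge> 0" "\<And>q. q \<in> set_pmf (in2 K) \<Longrightarrow> 1 \<le> C * pmf (in2 K) q"
      using finite_pmf_lower_bound[of "in2 K"] by blast
    have "pmf (law2 K) q \<le> C * pmf (pair_pmf (map_pmf fst K) (in2 K)) q" if "q \<in> set_pmf (law2 K)" for q
    proof -
      have "snd q \<in> set_pmf (in2 K)" using that by (force simp: law2_def in2_def)
      have "pmf (law2 K) q \<le> pmf (map_pmf fst (law2 K)) (fst q)" by (rule pmf_le_marginal)
      also have "map_pmf fst (law2 K) = map_pmf fst K" by (simp add: law2_def map_pmf_comp case_prod_unfold)
      also have "pmf (map_pmf fst K) (fst q) \<le> pmf (map_pmf fst K) (fst q) * (C * pmf (in2 K) (snd q))"
        using mult_left_mono[OF C(2)[OF \<open>snd q \<in> set_pmf (in2 K)\<close>], of "pmf (map_pmf fst K) (fst q)"] by simp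
      finally show ?thesis by (cases q) (simp add: pmf_pair mult_ac)
    qed
    from integrable_rel_density(2)[OF this]
    have "integrable (measure_pmf (law2 K)) (\<lambda>q. log 2 (pmf (law2 K) q / (pmf (map_pmf fst K) (fst q) * pmf (in2 K) (snd q))))"
      by (simp add: rel_density_def[abs_def] pmf_pair_fst_snd case_prod_beta')
    then have "integrable (measure_pmf (map_pmf (\<lambda>(t, x, y). (t, y)) K)) (\<lambda>q. log 2 (pmf (law2 K) q / (pmf (map_pmf fst K) (fst q) * pmf (in2 K) (snd q))))"
      by (simp only: law2_def)
    then show ?thesis unfolding integrable_map_pmf_eq by (simp add: case_prod_beta')
  qed
  have "cond_mutual_info M X Y Z = (\<integral>(x, y, z). pmf K (x, y, z) * log 2 (pmf K (x, y, z) / (pmf (law2 K) (x, z) * (pmf (inputs_law K) (y, z) / pmf (in2 K) z)))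
      \<partial>(count_space UNIV \<Otimes>\<^sub>M count_space UNIV \<Otimes>\<^sub>M count_space UNIV))"
    unfolding cond_mutual_info_def
  proof (rule conditional_mutual_information_generic_eq[OF sf sf sf DX _ DZ _ DI _ D2 _ D3])
    show "integrable (count_space UNIV \<Otimes>\<^sub>M count_space UNIV \<Otimes>\<^sub>M count_space UNIV)
      (\<lambda>(x, y, z). pmf K (x, y, z) * log 2 (pmf K (x, y, z) / (pmf (map_pmf fst K) x * pmf (inputs_law K) (y, z))))"
      using integrable_pmf_count_space(1)[of K "\<lambda>(x, y, z). log 2 (pmf K (x, y, z) / (pmf (map_pmf fst K) x * pmf (inputs_law K) (y, z)))"] I1
      by (simp add: pair_measure_countable case_prod_beta')
    show "integrable (count_space UNIV \<Otimes>\<^sub>M count_space UNIV \<Otimes>\<^sub>M count_space UNIV)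
      (\<lambda>(x, y, z). pmf K (x, y, z) * log 2 (pmf (law2 K) (x, z) / (pmf (map_pmf fst K) x * pmf (in2 K) z)))"
      using integrable_pmf_count_space(1)[of K "\<lambda>(x, y, z). log 2 (pmf (law2 K) (x, z) / (pmf (map_pmf fst K) x * pmf (in2 K) z))"] I2
      by (simp add: pair_measure_countable case_prod_beta')
  qed simp_all
  also have "\<dots> = measure_pmf.expectation K (dens1 K)"
    using integrable_pmf_count_space(2)[of K "dens1 K"]
    by (simp add: pair_measure_countable case_prod_beta' dens1_def)
  finally show ?thesis .
qed

section \<open>The asymptotic rate\<close>

lemma map_replicate_pmf: "map_pmf (map f) (replicate_pmf n p) = replicate_pmf n (map_pmf f p)"
proof (induction n)
  case (Suc n)
  show ?case by (simp add: Suc.IH[symmetric] map_bind_pmf bind_map_pmf map_return_pmf)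
qed simp

lemma nfold_marginals:
  "inputs_law (nfold n Q) = iid_inputs n (inputs_law Q)"
  "law1 (nfold n Q) = map_pmf (\<lambda>zs. (map fst zs, map snd zs)) (replicate_pmf n (law1 Q))"
  "law2 (nfold n Q) = map_pmf (\<lambda>zs. (map fst zs, map snd zs)) (replicate_pmf n (law2 Q))"
  "in1 (nfold n Q) = replicate_pmf n (in1 Q)"
  "in2 (nfold n Q) = replicate_pmf n (in2 Q)"
  by (simp_all add: inputs_law_def law1_def law2_def in1_def in2_def nfold_def iid_inputs_def unzip3_def
      map_replicate_pmf[symmetric] map_pmf_comp comp_def case_prod_unfold)

lemma pmf_unzip2:
  assumes "length zs = n"
  shows "pmf (map_pmf (\<lambda>zs. (map fst zs, map snd zs)) (replicate_pmf n p)) (map fst zs, map snd zs) = (\<Prod>i<n. pmf p (zs ! i))"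
  using pmf_iid_inputs[OF assms, of p] by (simp add: iid_inputs_def)

lemma pmf_nfold_marginals:
  assumes "length zs = n" and "unzip3 zs = (ts, xs, ys)"
  shows "pmf (inputs_law (nfold n Q)) (xs, ys) = (\<Prod>i<n. pmf (inputs_law Q) (snd (zs ! i)))"
    and "pmf (law1 (nfold n Q)) (ts, xs) = (\<Prod>i<n. pmf (law1 Q) (fst (zs ! i), fst (snd (zs ! i))))"
    and "pmf (law2 (nfold n Q)) (ts, ys) = (\<Prod>i<n. pmf (law2 Q) (fst (zs ! i), snd (snd (zs ! i))))"
    and "pmf (in1 (nfold n Q)) xs = (\<Prod>i<n. pmf (in1 Q) (fst (snd (zs ! i))))"
    and "pmf (in2 (nfold n Q)) ys = (\<Prod>i<n. pmf (in2 Q) (snd (snd (zs ! i))))"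
proof -
  have eq: "ts = map fst zs" "xs = map (\<lambda>z. fst (snd z)) zs" "ys = map (\<lambda>z. snd (snd z)) zs"
    using assms(2) by (auto simp: unzip3_def)
  show "pmf (inputs_law (nfold n Q)) (xs, ys) = (\<Prod>i<n. pmf (inputs_law Q) (snd (zs ! i)))"
    using pmf_iid_inputs[of "map snd zs" n "inputs_law Q"] assms(1) by (simp add: nfold_marginals eq comp_def)
  show "pmf (law1 (nfold n Q)) (ts, xs) = (\<Prod>i<n. pmf (law1 Q) (fst (zs ! i), fst (snd (zs ! i))))"
    using pmf_unzip2[of "map (\<lambda>z. (fst z, fst (snd z))) zs" n "law1 Q"] assms(1) by (simp add: nfold_marginals eq comp_def)
  show "pmf (law2 (nfold n Q)) (ts, ys) = (\<Prod>i<n. pmf (law2 Q) (fst (zs ! i), snd (snd (zs ! i))))"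
    using pmf_unzip2[of "map (\<lambda>z. (fst z, snd (snd z))) zs" n "law2 Q"] assms(1) by (simp add: nfold_marginals eq comp_def)
  show "pmf (in1 (nfold n Q)) xs = (\<Prod>i<n. pmf (in1 Q) (fst (snd (zs ! i))))"
    "pmf (in2 (nfold n Q)) ys = (\<Prod>i<n. pmf (in2 Q) (snd (snd (zs ! i))))"
    using assms(1) by (simp_all add: nfold_marginals eq pmf_replicate_pmf)
qed

definition icd :: "('t \<times> 'x \<times> 'y) pmf \<Rightarrow> 't \<times> 'x \<times> 'y \<Rightarrow> real" where
  "icd K z = dens1 K z + dens2 K z"

lemma pmf_marginals_pos:
  assumes "(t, x, y) \<in> set_pmf K"
  shows "pmf K (t, x, y) > 0" "pmf (inputs_law K) (x, y) > 0" "pmf (law1 K) (t, x) > 0" "pmf (law2 K) (t, y) > 0"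
    "pmf (in1 K) x > 0" "pmf (in2 K) y > 0"
  using assms by (auto simp: pmf_positive_iff inputs_law_def law1_def law2_def in1_def in2_def intro!: image_eqI[of _ _ "(t, x, y)"])

lemma icd_powr:
  assumes "z \<in> set_pmf K" "z = (t, x, y)"
  shows "2 powr icd K z * (pmf (inputs_law K) (x, y))\<^sup>2 * pmf (law1 K) (t, x) * pmf (law2 K) (t, y)
    = (pmf K z)\<^sup>2 * pmf (in1 K) x * pmf (in2 K) y"
proof -
  note pos = pmf_marginals_pos[OF assms(1)[unfolded assms(2)]]
  have "2 powr icd K z = (pmf K (t, x, y) / (pmf (law2 K) (t, y) * (pmf (inputs_law K) (x, y) / pmf (in2 K) y)))
     * (pmf K (t, x, y) / (pmf (law1 K) (t, x) * (pmf (inputs_law K) (x, y) / pmf (in1 K) x)))"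
    using pos by (simp add: icd_def dens1_def dens2_def assms(2) powr_add)
  then show ?thesis using pos by (simp add: assms(2) power2_eq_square field_simps)
qed

text \<open>All marginals of the n-fold law are products over the coordinates, so its density is the
  sum of the densities of the coordinates.\<close>

lemma high_density_nfold:
  assumes zs: "length zs = n" "set zs \<subseteq> set_pmf K" and l: "l \<le> (\<Sum>z\<leftarrow>zs. icd K z)"
  shows "unzip3 zs \<in> high_density l (nfold n K)"
proof -
  obtain ts xs ys where u: "unzip3 zs = (ts, xs, ys)" by (metis prod.exhaust)
  note m = pmf_nfold_marginals[OF zs(1) u]
  have mem: "zs ! i \<in> set_pmf K" if "i < n" for i using that zs(1) subsetD[OF zs(2) nth_mem[of i zs]] by simp
  have pos: "pmf (nfold n K) (ts, xs, ys) > 0"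
    unfolding u[symmetric] pmf_nfold[OF zs(1)] using mem by (intro prod_pos) (simp add: pmf_positive_iff)
  have sum: "(\<Sum>z\<leftarrow>zs. icd K z) = (\<Sum>i<n. icd K (zs ! i))"
    using zs(1) by (simp add: sum_list_sum_nth atLeast0LessThan)
  have "2 powr l * (pmf (inputs_law (nfold n K)) (xs, ys))\<^sup>2 * pmf (law1 (nfold n K)) (ts, xs) * pmf (law2 (nfold n K)) (ts, ys)
    \<le> 2 powr (\<Sum>z\<leftarrow>zs. icd K z) * (pmf (inputs_law (nfold n K)) (xs, ys))\<^sup>2 * pmf (law1 (nfold n K)) (ts, xs) * pmf (law2 (nfold n K)) (ts, ys)"
    using l by (intro mult_right_mono) auto
  also have "\<dots> = (\<Prod>i<n. 2 powr icd K (zs ! i) * (pmf (inputs_law K) (snd (zs ! i)))\<^sup>2 *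
      pmf (law1 K) (fst (zs ! i), fst (snd (zs ! i))) * pmf (law2 K) (fst (zs ! i), snd (snd (zs ! i))))"
    by (simp add: m prod.distrib sum powr_sum prod_power_distrib)
  also have "\<dots> = (\<Prod>i<n. (pmf K (zs ! i))\<^sup>2 * pmf (in1 K) (fst (snd (zs ! i))) * pmf (in2 K) (snd (snd (zs ! i))))"
  proof (intro prod.cong refl)
    fix i assume "i \<in> {..<n}"
    then show "2 powr icd K (zs ! i) * (pmf (inputs_law K) (snd (zs ! i)))\<^sup>2 *
      pmf (law1 K) (fst (zs ! i), fst (snd (zs ! i))) * pmf (law2 K) (fst (zs ! i), snd (snd (zs ! i)))
      = (pmf K (zs ! i))\<^sup>2 * pmf (in1 K) (fst (snd (zs ! i))) * pmf (in2 K) (snd (snd (zs ! i)))"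
      using icd_powr[of "zs ! i" K "fst (zs ! i)" "fst (snd (zs ! i))" "snd (snd (zs ! i))"] mem[of i] by simp
  qed
  also have "\<dots> = (pmf (nfold n K) (ts, xs, ys))\<^sup>2 * pmf (in1 (nfold n K)) xs * pmf (in2 (nfold n K)) ys"
    by (simp add: m pmf_nfold[OF zs(1)] u[symmetric] prod.distrib prod_power_distrib)
  finally show ?thesis using pos by (simp add: u high_density_def)
qed

text \<open>A state contains its past, so the joint law of two consecutive states is the law of the
  later one.\<close>

lemma state_at_determines:
  "state_at (Suc i) \<tau> = state_at (Suc i) \<tau>' \<Longrightarrow> state_at i \<tau> = state_at i \<tau>'"
proof -
  assume eq: "state_at (Suc i) \<tau> = state_at (Suc i) \<tau>'"
  show "state_at i \<tau> = state_at i \<tau>'"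
  proof (cases "length \<tau> \<le> Suc i")
    case True
    then have "\<tau> = \<tau>'" using eq by (auto simp: state_at_def split: if_splits)
    then show ?thesis by simp
  next
    case False
    then have l: "\<not> length \<tau>' \<le> Suc i" "take (Suc i) \<tau> = take (Suc i) \<tau>'" using eq by (auto simp: state_at_def split: if_splits)
    then have "take i \<tau> = take i \<tau>'" by (metis le_SucI min.absorb1 order_refl take_take)
    then show ?thesis using False l by (simp add: state_at_def)
  qed
qed

section \<open>The increments of the density, round by round\<close>

context private_coin_protocol
begin

text \<open>The law of the next state given Party 1's input and the current state: exact in its own
  rounds by \<open>markov1\<close>, an estimate when it listens.\<close>

definition c1 :: "nat \<Rightarrow> 'x \<Rightarrow> transcript \<times> next_state \<Rightarrow> (transcript \<times> next_state) pmf" where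
  "c1 i x s = cond_law (map_pmf (\<lambda>(\<tau>, x, y). ((x, state_at i \<tau>), state_at (Suc i) \<tau>)) J) (x, s)"
definition c2 :: "nat \<Rightarrow> 'y \<Rightarrow> transcript \<times> next_state \<Rightarrow> (transcript \<times> next_state) pmf" where
  "c2 i y s = cond_law (map_pmf (\<lambda>(\<tau>, x, y). ((y, state_at i \<tau>), state_at (Suc i) \<tau>)) J) (y, s)"

definition at_round :: "nat \<Rightarrow> transcript \<times> 'x \<times> 'y \<Rightarrow> (transcript \<times> next_state) \<times> 'x \<times> 'y" where
  "at_round i = (\<lambda>(\<tau>, x, y). (state_at i \<tau>, x, y))"

lemma Jst_at: "Jst i = map_pmf (at_round i) J"
  by (simp add: Jst_def at_round_def)

lemma at_in_Jst: "(\<tau>, x, y) \<in> set_pmf J \<Longrightarrow> (state_at i \<tau>, x, y) \<in> set_pmf (Jst i)"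
  by (force simp: Jst_def)

lemma Jst_marginals: "inputs_law (Jst i) = inputs_law J" "in1 (Jst i) = in1 J" "in2 (Jst i) = in2 J"
  "law1 (Jst i) = map_pmf (\<lambda>(\<tau>, x, y). (state_at i \<tau>, x)) J" "law2 (Jst i) = map_pmf (\<lambda>(\<tau>, x, y). (state_at i \<tau>, y)) J"
  by (simp_all add: inputs_law_def in1_def in2_def law1_def law2_def Jst_def map_pmf_comp case_prod_unfold)

lemma inputs_law_J: "inputs_law J = P"
proof (rule pmf_eqI)
  fix q
  interpret R: prob_space "randomness \<pi>" by (rule probs)
  have "pmf (inputs_law J) q = measure (measure_pmf J) (snd -` {q})"
    by (simp add: inputs_law_def pmf_map)
  also have "\<dots> = measure E ((\<lambda>\<omega>. (transcript_of \<pi> \<omega>, input1 \<omega>, input2 \<omega>)) -` (snd -` {q}) \<inter> space E)"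
    unfolding J by (rule measure_distr[OF meas_J]) simp
  also have "(\<lambda>\<omega>. (transcript_of \<pi> \<omega>, input1 \<omega>, input2 \<omega>)) -` (snd -` {q}) \<inter> space E = {q} \<times> space (randomness \<pi>)"
    by (auto simp: space_execution input1_def input2_def)
  also have "emeasure E ({q} \<times> space (randomness \<pi>)) = ennreal (pmf P q)"
    unfolding execution_space_alt
    by (subst R.emeasure_pair_measure_Times) (auto simp: R.emeasure_space_1 emeasure_pmf_single)
  then have "measure E ({q} \<times> space (randomness \<pi>)) = pmf P q" by (simp add: measure_def)
  finally show "pmf (inputs_law J) q = pmf P q" .
qed

lemma pmf_c1:
  assumes "(\<tau>, x, y) \<in> set_pmf J"
  shows "pmf (c1 i x (state_at i \<tau>)) (state_at (Suc i) \<tau>)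
    = pmf (law1 (Jst (Suc i))) (state_at (Suc i) \<tau>, x) / pmf (law1 (Jst i)) (state_at i \<tau>, x)"
proof -
  let ?K = "map_pmf (\<lambda>(\<tau>, x, y). ((x, state_at i \<tau>), state_at (Suc i) \<tau>)) J"
  have "map_pmf fst ?K = map_pmf prod.swap (law1 (Jst i))"
    by (simp add: Jst_marginals map_pmf_comp case_prod_unfold prod.swap_def)
  then have fst: "pmf (map_pmf fst ?K) (x, state_at i \<tau>) = pmf (law1 (Jst i)) (state_at i \<tau>, x)"
    using pmf_map_inj'[of prod.swap "law1 (Jst i)" "(state_at i \<tau>, x)"] by simp
  have "pmf ?K ((x, state_at i \<tau>), state_at (Suc i) \<tau>) = pmf (law1 (Jst (Suc i))) (state_at (Suc i) \<tau>, x)"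
    unfolding Jst_marginals pmf_map
    by (rule arg_cong[where f = "measure_pmf.prob J"]) (auto dest: state_at_determines[of i])
  moreover have "pmf (law1 (Jst i)) (state_at i \<tau>, x) > 0"
    by (rule pmf_marginals_pos[OF at_in_Jst[OF assms]])
  ultimately show ?thesis unfolding c1_def by (subst pmf_cond_law) (simp_all add: fst)
qed

lemma pmf_c2:
  assumes "(\<tau>, x, y) \<in> set_pmf J"
  shows "pmf (c2 i y (state_at i \<tau>)) (state_at (Suc i) \<tau>)
    = pmf (law2 (Jst (Suc i))) (state_at (Suc i) \<tau>, y) / pmf (law2 (Jst i)) (state_at i \<tau>, y)"
proof -
  let ?K = "map_pmf (\<lambda>(\<tau>, x, y). ((y, state_at i \<tau>), state_at (Suc i) \<tau>)) J"
  have "map_pmf fst ?K = map_pmf prod.swap (law2 (Jst i))"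
    by (simp add: Jst_marginals map_pmf_comp case_prod_unfold prod.swap_def)
  then have fst: "pmf (map_pmf fst ?K) (y, state_at i \<tau>) = pmf (law2 (Jst i)) (state_at i \<tau>, y)"
    using pmf_map_inj'[of prod.swap "law2 (Jst i)" "(state_at i \<tau>, y)"] by simp
  have "pmf ?K ((y, state_at i \<tau>), state_at (Suc i) \<tau>) = pmf (law2 (Jst (Suc i))) (state_at (Suc i) \<tau>, y)"
    unfolding Jst_marginals pmf_map
    by (rule arg_cong[where f = "measure_pmf.prob J"]) (auto dest: state_at_determines[of i])
  moreover have "pmf (law2 (Jst i)) (state_at i \<tau>, y) > 0"
    by (rule pmf_marginals_pos[OF at_in_Jst[OF assms]])
  ultimately show ?thesis unfolding c2_def by (subst pmf_cond_law) (simp_all add: fst)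
qed

definition w :: "nat \<Rightarrow> transcript \<times> 'x \<times> 'y \<Rightarrow> real" where
  "w i = (\<lambda>(\<tau>, x, y). pmf (chosen (even i) (c1 i x (state_at i \<tau>)) (c2 i y (state_at i \<tau>))) (state_at (Suc i) \<tau>))"
definition v :: "nat \<Rightarrow> transcript \<times> 'x \<times> 'y \<Rightarrow> real" where
  "v i = (\<lambda>(\<tau>, x, y). pmf (chosen (even i) (c2 i y (state_at i \<tau>)) (c1 i x (state_at i \<tau>))) (state_at (Suc i) \<tau>))"
definition ic :: "nat \<Rightarrow> transcript \<times> 'x \<times> 'y \<Rightarrow> real" where
  "ic i z = icd (Jst i) (at_round i z)"

text \<open>Write \<open>a\<close>, \<open>f\<close>, \<open>g\<close> for the probabilities of the
  state with both inputs, with \<open>x\<close> and with \<open>y\<close>. The increment of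
  \<open>ic\<close> is \<open>2 log (a'/a) - log (f'/f) - log (g'/g)\<close>. The Markov property
  gives \<open>a'/a = w\<close>, while \<open>f'/f\<close> and \<open>g'/g\<close> are
  \<open>w\<close> and \<open>v\<close> in some order, which leaves
  \<open>log (w/v)\<close>.\<close>

lemma
  assumes "z \<in> set_pmf J"
  shows w_pos: "w i z > 0" and v_pos: "v i z > 0"
    and Jst_step: "pmf (Jst (Suc i)) (at_round (Suc i) z) = pmf (Jst i) (at_round i z) * w i z"
    and log_ratio: "log 2 (w i z / v i z) = ic (Suc i) z - ic i z"
proof -
  obtain \<tau> x y where z: "z = (\<tau>, x, y)" by (cases z) auto
  have zJ: "(\<tau>, x, y) \<in> set_pmf J" using assms by (simp add: z)
  define a where "a = pmf (Jst i) (state_at i \<tau>, x, y)"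
  define a' where "a' = pmf (Jst (Suc i)) (state_at (Suc i) \<tau>, x, y)"
  define f where "f = pmf (law1 (Jst i)) (state_at i \<tau>, x)"
  define f' where "f' = pmf (law1 (Jst (Suc i))) (state_at (Suc i) \<tau>, x)"
  define g where "g = pmf (law2 (Jst i)) (state_at i \<tau>, y)"
  define g' where "g' = pmf (law2 (Jst (Suc i))) (state_at (Suc i) \<tau>, y)"
  define p where "p = pmf (inputs_law J) (x, y)"
  define p1 where "p1 = pmf (in1 J) x"
  define p2 where "p2 = pmf (in2 J) y"
  have pos: "a > 0" "a' > 0" "f > 0" "f' > 0" "g > 0" "g' > 0" "p > 0" "p1 > 0" "p2 > 0"
    using pmf_marginals_pos[OF at_in_Jst[OF zJ, of i]] pmf_marginals_pos[OF at_in_Jst[OF zJ, of "Suc i"]]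
    by (simp_all add: a_def a'_def f_def f'_def g_def g'_def p_def p1_def p2_def Jst_marginals(1-3))
  have ne: "\<tau> \<noteq> []" using support_J[OF zJ] by simp
  have wv: "w i z = (if even i then f' / f else g' / g)" "v i z = (if even i then g' / g else f' / f)"
    using pmf_c1[OF zJ, of i] pmf_c2[OF zJ, of i]
    by (simp_all add: w_def v_def z chosen_def f_def f'_def g_def g'_def)
  show "w i z > 0" "v i z > 0" using wv pos by simp_all
  have step: "a' = a * w i z"
  proof (cases "even i")
    case True
    have "a' * f = a * f'" using markov1[OF True ne, of x y] by (simp add: a_def a'_def f_def f'_def)
    then have "a' = a * (f' / f)" using pos by (simp add: field_simps)
    then show ?thesis using True by (simp add: wv)
  next
    case False
    have "a' * g = a * g'" using markov2[OF False ne, of x y] by (simp add: a_def a'_def g_def g'_def)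
    then have "a' = a * (g' / g)" using pos by (simp add: field_simps)
    then show ?thesis using False by (simp add: wv)
  qed
  then show "pmf (Jst (Suc i)) (at_round (Suc i) z) = pmf (Jst i) (at_round i z) * w i z"
    by (simp add: a_def a'_def at_round_def z)
  have ici: "ic i z = log 2 (a / (g * (p / p2))) + log 2 (a / (f * (p / p1)))"
    "ic (Suc i) z = log 2 (a' / (g' * (p / p2))) + log 2 (a' / (f' * (p / p1)))"
    by (simp_all add: ic_def icd_def at_round_def z dens1_def dens2_def Jst_marginals(1-3)
        a_def a'_def f_def f'_def g_def g'_def p_def p1_def p2_def)
  have "log 2 a' = log 2 a + log 2 (w i z)" using step pos \<open>w i z > 0\<close> by (simp add: log_mult_pos)
  then show "log 2 (w i z / v i z) = ic (Suc i) z - ic i z"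
    using pos wv by (simp add: ici log_divide_pos log_mult_pos)
qed

abbreviation "s_init \<equiv> ([] :: transcript, Continue)"

lemma state_at_0: "(\<tau>, x, y) \<in> set_pmf J \<Longrightarrow> state_at 0 \<tau> = s_init"
  using support_J(1)[of \<tau> x y] by (simp add: state_at_def)

lemma Jst_0:
  "Jst 0 = map_pmf (Pair s_init) (inputs_law J)" "law1 (Jst 0) = map_pmf (Pair s_init) (in1 J)"
  "law2 (Jst 0) = map_pmf (Pair s_init) (in2 J)"
  unfolding Jst_marginals unfolding inputs_law_def Jst_def in1_def in2_def map_pmf_comp
  by (auto intro!: map_pmf_cong simp: state_at_0)

lemma pmf_map_Pair: "pmf (map_pmf (Pair s) p) (s, q) = pmf p q"
  by (rule pmf_map_inj') (simp add: inj_on_def)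

text \<open>The initial state is constant and carries no information.\<close>

lemma ic_0:
  assumes "z \<in> set_pmf J"
  shows "ic 0 z = 0"
proof -
  obtain \<tau> x y where z: "z = (\<tau>, x, y)" by (cases z) auto
  have s: "state_at 0 \<tau> = s_init" using state_at_0 assms z by blast
  note pos = pmf_marginals_pos[OF assms[unfolded z]]
  have "pmf (Jst 0) (s_init, x, y) = pmf (inputs_law J) (x, y)" "pmf (law1 (Jst 0)) (s_init, x) = pmf (in1 J) x"
    "pmf (law2 (Jst 0)) (s_init, y) = pmf (in2 J) y"
    unfolding Jst_0(2,3) by (simp_all only: Jst_0(1) pmf_map_Pair)
  then show ?thesis
    using pos by (simp add: ic_def icd_def at_round_def z s dens1_def dens2_def Jst_marginals(1-3))
qed

lemma pmf_J_prod:
  assumes "(\<tau>, x, y) \<in> set_pmf J"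
  shows "pmf J (\<tau>, x, y) = pmf P (x, y) * (\<Prod>i<d. w i (\<tau>, x, y))"
proof -
  have "pmf (Jst n) (at_round n (\<tau>, x, y)) = pmf P (x, y) * (\<Prod>i<n. w i (\<tau>, x, y))" for n
  proof (induction n)
    case 0
    show ?case using state_at_0[OF assms] by (simp add: at_round_def Jst_0 pmf_map_Pair inputs_law_J)
  next
    case (Suc n)
    then show ?case using Jst_step[OF assms, of n] by simp
  qed
  from this[of d] show ?thesis
    using pmf_J_views(2)[OF assms] support_J[OF assms] by (simp add: at_round_def state_at_def)
qed

text \<open>After \<open>d\<close> rounds every state on the support is
  \<open>(\<tau>, Stop)\<close>, so states and transcripts determine each other.\<close>

lemma ic_final:
  assumes "z \<in> set_pmf J"
  shows "ic d z = icd J z"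
proof -
  obtain \<tau> x y where z: "z = (\<tau>, x, y)" by (cases z) auto
  have zJ: "(\<tau>, x, y) \<in> set_pmf J" using assms by (simp add: z)
  have len: "length \<tau> \<le> d" by (rule support_J[OF zJ])
  have s: "state_at d \<tau> = (\<tau>, Stop)" using len by (simp add: state_at_def)
  have "pmf (law1 (Jst d)) ((\<tau>, Stop), x) = pmf (law1 J) (\<tau>, x)"
    unfolding Jst_marginals unfolding law1_def pmf_map
    by (rule arg_cong[where f = "measure_pmf.prob J"]) (use len in \<open>auto simp: state_at_def split: if_splits\<close>)
  moreover have "pmf (law2 (Jst d)) ((\<tau>, Stop), y) = pmf (law2 J) (\<tau>, y)"
    unfolding Jst_marginals unfolding law2_def pmf_map
    by (rule arg_cong[where f = "measure_pmf.prob J"]) (use len in \<open>auto simp: state_at_def split: if_splits\<close>)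
  ultimately show ?thesis
    using pmf_J_views(2)[OF zJ]
    by (simp add: ic_def icd_def at_round_def z s dens1_def dens2_def Jst_marginals(1-3))
qed

lemma integrable_ic: "integrable (measure_pmf J) (ic i)" "integrable (measure_pmf J) (\<lambda>z. (ic (Suc i) z - ic i z)\<^sup>2)"
proof -
  have i: "integrable (measure_pmf J) (\<lambda>z. dens1 (Jst i) (at_round i z))" "integrable (measure_pmf J) (\<lambda>z. dens2 (Jst i) (at_round i z))"
    "integrable (measure_pmf J) (\<lambda>z. (dens1 (Jst i) (at_round i z))\<^sup>2)" "integrable (measure_pmf J) (\<lambda>z. (dens2 (Jst i) (at_round i z))\<^sup>2)" for i
    using integrable_dens1[of "Jst i"] integrable_dens2[of "Jst i"]
    unfolding Jst_at[of i] integrable_map_pmf_eq unfolding Jst_at[symmetric] by auto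
  show "integrable (measure_pmf J) (ic i)"
    unfolding ic_def[abs_def] icd_def using i by (intro Bochner_Integration.integrable_add)
  \<comment> \<open>Cauchy-Schwarz with four terms; the difference of the two sides is the sum of
    the six squares below.\<close>
  have bound: "(a + b - (c + e))\<^sup>2 \<le> 4 * (a\<^sup>2 + b\<^sup>2 + c\<^sup>2 + e\<^sup>2)" for a b c e :: real
  proof -
    have "0 \<le> (a - b)\<^sup>2 + (a + c)\<^sup>2 + (a + e)\<^sup>2 + (b + c)\<^sup>2 + (b + e)\<^sup>2 + (c - e)\<^sup>2" by simp
    then show ?thesis by (simp add: power2_eq_square algebra_simps)
  qed
  have "integrable (measure_pmf J) (\<lambda>z. 4 * ((dens1 (Jst (Suc i)) (at_round (Suc i) z))\<^sup>2 + (dens2 (Jst (Suc i)) (at_round (Suc i) z))\<^sup>2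
      + (dens1 (Jst i) (at_round i z))\<^sup>2 + (dens2 (Jst i) (at_round i z))\<^sup>2))"
    using i by (intro Bochner_Integration.integrable_add Bochner_Integration.integrable_mult_right)
  then show "integrable (measure_pmf J) (\<lambda>z. (ic (Suc i) z - ic i z)\<^sup>2)"
    by (rule Bochner_Integration.integrable_bound) (auto simp: ic_def icd_def intro!: AE_I2 order_trans[OF bound])
qed

definition \<Delta> :: "nat \<Rightarrow> real" where
  "\<Delta> i = measure_pmf.expectation J (\<lambda>z. ic (Suc i) z - ic i z)"

text \<open>The expected increment is a relative entropy: \<open>A\<close> is the true law of next
  state, current state and inputs, and in \<open>B\<close> the next state is drawn from the
  listener's estimate.\<close>

lemma \<Delta>_nonneg: "\<Delta> i \<ge> 0"
proof -
  define A where "A = map_pmf (\<lambda>z. (state_at (Suc i) (fst z), at_round i z)) J"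
  define B where "B = joint_law (Jst i) (\<lambda>(s, x, y). chosen (even i) (c2 i y s) (c1 i x s))"
  let ?h = "\<lambda>z. (state_at (Suc i) (fst z), at_round i z)"
  have A: "pmf A (?h z) = pmf (Jst (Suc i)) (at_round (Suc i) z)" for z
    unfolding A_def Jst_at pmf_map
    by (cases z, rule arg_cong[where f = "measure_pmf.prob J"]) (auto simp: at_round_def dest: state_at_determines[of i])
  have B: "pmf B (?h z) = pmf (Jst i) (at_round i z) * v i z" for z
    by (cases z) (simp add: B_def pmf_joint_law at_round_def v_def)
  have eq: "rel_density A B (?h z) = ic (Suc i) z - ic i z" if z: "z \<in> set_pmf J" for z
  proof -
    have "pmf (Jst i) (at_round i z) > 0" using z by (simp add: Jst_at pmf_positive_iff)
    then have "rel_density A B (?h z) = log 2 (w i z / v i z)"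
      by (simp add: rel_density_def A B Jst_step[OF z])
    then show ?thesis by (simp add: log_ratio[OF z])
  qed
  have int: "integrable (measure_pmf J) (\<lambda>z. ic (Suc i) z - ic i z)"
    using integrable_ic(1) by auto
  then have "integrable (measure_pmf J) (\<lambda>z. rel_density A B (?h z))"
    using integrable_pmf_cong[of J "\<lambda>z. rel_density A B (?h z)" "\<lambda>z. ic (Suc i) z - ic i z"] eq by simp
  then have "integrable (measure_pmf A) (rel_density A B)" unfolding A_def by simp
  then have "0 \<le> measure_pmf.expectation A (rel_density A B)"
  proof (rule expectation_rel_density_nonneg)
    fix q assume "q \<in> set_pmf A"
    then obtain z where z: "z \<in> set_pmf J" "q = ?h z" by (auto simp: A_def)
    have "pmf (Jst i) (at_round i z) > 0" using z by (simp add: Jst_at pmf_positive_iff)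
    then show "pmf B q > 0" using v_pos[OF z(1), of i] by (simp add: z B)
  qed
  also have "\<dots> = measure_pmf.expectation J (\<lambda>z. rel_density A B (?h z))"
    using integral_map_pmf[of ?h J "rel_density A B"] by (simp add: A_def)
  also have "\<dots> = \<Delta> i" unfolding \<Delta>_def using eq by (rule expectation_pmf_cong)
  finally show ?thesis .
qed

lemma information_complexity_eq:
  "information_complexity P \<pi> = measure_pmf.expectation J (icd J)"
proof -
  note t = measurable_transcript_of[OF meas(1), of P]
  have "cond_mutual_info E (transcript_of \<pi>) input1 input2 = measure_pmf.expectation J (dens1 J)"
    by (rule cond_mutual_info_eq[OF probs(4) t measurable_input1 measurable_input2 J])
  moreover have "cond_mutual_info E (transcript_of \<pi>) input2 input1 = measure_pmf.expectation (map_pmf swap_inputs J) (dens1 (map_pmf swap_inputs J))"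
  proof (rule cond_mutual_info_eq[OF probs(4) t measurable_input2 measurable_input1])
    show "measure_pmf (map_pmf swap_inputs J) = distr E (count_space UNIV) (\<lambda>\<omega>. (transcript_of \<pi> \<omega>, input2 \<omega>, input1 \<omega>))"
      unfolding map_pmf_rep_eq J by (subst distr_distr[OF _ meas_J]) (simp_all add: comp_def swap_inputs_def)
  qed
  moreover have "measure_pmf.expectation (map_pmf swap_inputs J) (dens1 (map_pmf swap_inputs J)) = measure_pmf.expectation J (dens2 J)"
    unfolding integral_map_pmf by (simp add: dens2_swap[symmetric])
  ultimately show ?thesis
    unfolding information_complexity_def icd_def[abs_def]
    using integrable_dens1(2)[of J] integrable_dens2(2)[of J] by simp
qed

text \<open>Telescoping: \<open>ic\<close> starts at 0 and ends at the density of the whole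
  protocol.\<close>

lemma sum_\<Delta>: "(\<Sum>i<d. \<Delta> i) = information_complexity P \<pi>"
proof -
  have "(\<Sum>i<n. \<Delta> i) = measure_pmf.expectation J (ic n)" for n
  proof (induction n)
    case 0
    have "measure_pmf.expectation J (ic 0) = measure_pmf.expectation J (\<lambda>_. 0)"
      by (rule expectation_pmf_cong) (rule ic_0)
    then show ?case by simp
  next
    case (Suc n)
    then show ?case using integrable_ic(1) by (simp add: \<Delta>_def)
  qed
  from this[of d] show ?thesis
    unfolding information_complexity_eq using expectation_pmf_cong[of J "ic d" "icd J"] ic_final by simp
qed

section \<open>The converse for product protocols\<close>

lemma cost_eq:
  "simulation_cost \<epsilon> (iid_inputs n P) (product_law n P \<pi>) = simulation_cost \<epsilon> (inputs_law (nfold n J)) (measure_pmf (nfold n J))"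
  by (simp add: product_law_eq nfold_marginals inputs_law_J)

lemma cost_lower_bound:
  assumes \<epsilon>: "\<epsilon> < 1" and r: "r < information_complexity P \<pi>"
  shows "\<forall>\<^sub>F n in sequentially. ereal (real n * r) \<le> ereal_of_enat (simulation_cost \<epsilon> (iid_inputs n P) (product_law n P \<pi>))"
proof -
  \<comment> \<open>One \<delta> is given to the law of large numbers; the other separates
    \<open>n r\<close> from the density level \<open>l\<close>, so that
    \<open>2 powr ((m - l) / 2)\<close> decays exponentially.\<close>
  define \<delta> where "\<delta> = (information_complexity P \<pi> - r) / 2"
  have \<delta>: "\<delta> > 0" using r by (simp add: \<delta>_def)
  let ?\<mu> = "measure_pmf.expectation J (icd J)"
  have int: "integrable (measure_pmf J) (icd J)" "integrable (measure_pmf J) (\<lambda>z. (icd J z)\<^sup>2)"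
  proof -
    show "integrable (measure_pmf J) (icd J)"
      unfolding icd_def[abs_def] using integrable_dens1(2)[of J] integrable_dens2(2)[of J] by simp
    have "integrable (measure_pmf J) (\<lambda>z. 2 * ((dens1 J z)\<^sup>2 + (dens2 J z)\<^sup>2))"
      using integrable_dens1(1)[of J] integrable_dens2(1)[of J] by simp
    moreover have bound: "(a + b)\<^sup>2 \<le> 2 * (a\<^sup>2 + b\<^sup>2)" for a b :: real
      using zero_le_power2[of "a - b"] by (simp add: power2_eq_square algebra_simps)
    ultimately show "integrable (measure_pmf J) (\<lambda>z. (icd J z)\<^sup>2)"
      by (elim Bochner_Integration.integrable_bound) (auto simp: icd_def intro!: AE_I2 order_trans[OF bound])
  qed
  define b where "b n = measure_pmf.prob (replicate_pmf n J) {zs. \<bar>(\<Sum>z\<leftarrow>zs. icd J z) - real n * ?\<mu>\<bar> \<ge> real n * \<delta>}" for n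
  have "b \<longlonglongrightarrow> 0" unfolding b_def using weak_law_of_large_numbers[OF int \<delta>] .
  moreover have "(\<lambda>n. 2 powr (- (\<delta> / 2) * real n)) \<longlonglongrightarrow> 0"
    using \<delta> by real_asymp
  ultimately have "(\<lambda>n. b n + 2 powr (- (\<delta> / 2) * real n)) \<longlonglongrightarrow> 0 + 0" by (rule tendsto_add)
  then have "\<forall>\<^sub>F n in sequentially. b n + 2 powr (- (\<delta> / 2) * real n) < 1 - \<epsilon>"
    using \<epsilon> by (intro order_tendstoD) auto
  then show ?thesis
  proof eventually_elim
    case (elim n)
    show ?case
    proof (rule ccontr)
      assume less: "\<not> ereal (real n * r) \<le> ereal_of_enat (simulation_cost \<epsilon> (iid_inputs n P) (product_law n P \<pi>))"
      let ?Q = "nfold n J"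
      obtain m where m: "simulation_cost \<epsilon> (inputs_law ?Q) (measure_pmf ?Q) = enat m" "real m < real n * r"
        using less unfolding cost_eq by (cases "simulation_cost \<epsilon> (inputs_law ?Q) (measure_pmf ?Q)") auto
      \<comment> \<open>A strict bound yields a witness from the infimum, and being below
        \<open>m + 1\<close> means at most \<open>m\<close> bits.\<close>
      have "simulation_cost \<epsilon> (inputs_law ?Q) (measure_pmf ?Q) < enat (Suc m)" using m by simp
      then obtain \<sigma> :: "('x list, 'y list, real, real, real) protocol" where
        \<sigma>: "is_simulation \<epsilon> (inputs_law ?Q) (measure_pmf ?Q) \<sigma>" "protocol_length (inputs_law ?Q) \<sigma> < enat (Suc m)"
        unfolding simulation_cost_def INF_less_iff by auto
      then have len: "protocol_length (inputs_law ?Q) \<sigma> \<le> enat m"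
        by (cases "protocol_length (inputs_law ?Q) \<sigma>") auto
      have fin: "finite (set_pmf (inputs_law ?Q))"
      proof -
        have "set_pmf (inputs_law ?Q) \<subseteq> {xs. length xs = n} \<times> {ys. length ys = n}"
          by (auto simp: nfold_marginals iid_inputs_def set_replicate_pmf)
        moreover have "finite ({xs :: 'x list. length xs = n} \<times> {ys :: 'y list. length ys = n})"
          using finite_lists_length_eq[of "UNIV :: 'x set" n] finite_lists_length_eq[of "UNIV :: 'y set" n] by simp
        ultimately show ?thesis by (rule finite_subset)
      qed
      define l where "l = real n * (?\<mu> - \<delta>)"
      have "measure_pmf.prob ?Q (high_density l ?Q) \<le> \<epsilon> + 2 powr ((real m - l) / 2)"
        by (rule simulation_converse[OF \<sigma>(1) len fin])
      also have "2 powr ((real m - l) / 2) \<le> 2 powr (- (\<delta> / 2) * real n)"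
      proof -
        have r_eq: "r = ?\<mu> - 2 * \<delta>" by (simp add: \<delta>_def information_complexity_eq field_simps)
        have "real n * r = l - real n * \<delta>" unfolding l_def by (subst r_eq) (simp add: algebra_simps)
        then have "real m - l \<le> - (real n * \<delta>)" using m(2) by linarith
        then show ?thesis by (intro powr_mono) (simp_all add: mult.commute)
      qed
      finally have up: "measure_pmf.prob ?Q (high_density l ?Q) \<le> \<epsilon> + 2 powr (- (\<delta> / 2) * real n)" by simp
      have "1 - b n = measure_pmf.prob (replicate_pmf n J) (- {zs. \<bar>(\<Sum>z\<leftarrow>zs. icd J z) - real n * ?\<mu>\<bar> \<ge> real n * \<delta>})"
        unfolding b_def by (simp add: measure_pmf.prob_compl[symmetric] Compl_eq_Diff_UNIV)
      also have "\<dots> \<le> measure_pmf.prob (replicate_pmf n J) (unzip3 -` high_density l ?Q)"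
      proof (rule prob_mono_support)
        fix zs assume zs: "zs \<in> set_pmf (replicate_pmf n J)" "zs \<in> - {zs. \<bar>(\<Sum>z\<leftarrow>zs. icd J z) - real n * ?\<mu>\<bar> \<ge> real n * \<delta>}"
        have "l \<le> (\<Sum>z\<leftarrow>zs. icd J z)" using zs(2) by (auto simp: l_def algebra_simps)
        then show "zs \<in> unzip3 -` high_density l ?Q"
          using zs(1) high_density_nfold[of zs n J l] by (auto simp: set_replicate_pmf)
      qed
      also have "\<dots> = measure_pmf.prob ?Q (high_density l ?Q)" by (simp add: nfold_def)
      finally show False using up elim by linarith
    qed
  qed
qed

section \<open>Achievability for product protocols\<close>

definition W1 :: "nat \<Rightarrow> 'x list \<Rightarrow> (transcript \<times> next_state) list \<Rightarrow> (transcript \<times> next_state) list pmf" where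
  "W1 i xs ss = list_pmf (map2 (c1 i) xs ss)"
definition W2 :: "nat \<Rightarrow> 'y list \<Rightarrow> (transcript \<times> next_state) list \<Rightarrow> (transcript \<times> next_state) list pmf" where
  "W2 i ys ss = list_pmf (map2 (c2 i) ys ss)"

lemma pmf_W:
  assumes "length zs = n" "unzip3 zs = (\<tau>s, xs, ys)"
  shows "pmf (chosen (even i) (W1 i xs (map (state_at i) \<tau>s)) (W2 i ys (map (state_at i) \<tau>s))) (map (state_at (Suc i)) \<tau>s) = (\<Prod>j<n. w i (zs ! j))"
    and "pmf (chosen (even i) (W2 i ys (map (state_at i) \<tau>s)) (W1 i xs (map (state_at i) \<tau>s))) (map (state_at (Suc i)) \<tau>s) = (\<Prod>j<n. v i (zs ! j))"
proof -
  have eq: "\<tau>s = map fst zs" "xs = map (\<lambda>z. fst (snd z)) zs" "ys = map (\<lambda>z. snd (snd z)) zs"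
    using assms(2) by (auto simp: unzip3_def)
  have 1: "pmf (W1 i xs (map (state_at i) \<tau>s)) (map (state_at (Suc i)) \<tau>s)
      = (\<Prod>j<n. pmf (c1 i (fst (snd (zs ! j))) (state_at i (fst (zs ! j)))) (state_at (Suc i) (fst (zs ! j))))"
    unfolding W1_def using assms(1) by (subst pmf_list_pmf) (simp_all add: eq)
  have 2: "pmf (W2 i ys (map (state_at i) \<tau>s)) (map (state_at (Suc i)) \<tau>s)
      = (\<Prod>j<n. pmf (c2 i (snd (snd (zs ! j))) (state_at i (fst (zs ! j)))) (state_at (Suc i) (fst (zs ! j))))"
    unfolding W2_def using assms(1) by (subst pmf_list_pmf) (simp_all add: eq)
  show "pmf (chosen (even i) (W1 i xs (map (state_at i) \<tau>s)) (W2 i ys (map (state_at i) \<tau>s))) (map (state_at (Suc i)) \<tau>s) = (\<Prod>j<n. w i (zs ! j))"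
    "pmf (chosen (even i) (W2 i ys (map (state_at i) \<tau>s)) (W1 i xs (map (state_at i) \<tau>s))) (map (state_at (Suc i)) \<tau>s) = (\<Prod>j<n. v i (zs ! j))"
    by (simp_all add: chosen_def 1 2 w_def v_def case_prod_unfold)
qed

lemma d_pos: "d > 0"
proof -
  obtain z where "z \<in> set_pmf J" using set_pmf_not_empty[of J] by blast
  then show ?thesis using support_J[of "fst z" "fst (snd z)" "snd (snd z)"] by (cases "d = 0") auto
qed

lemma typical_ratio:
  assumes zs: "length zs = n" "set zs \<subseteq> set_pmf J" and le: "(\<Sum>z\<leftarrow>zs. ic (Suc i) z - ic i z) \<le> l"
  shows "(\<Prod>j<n. w i (zs ! j)) \<le> 2 powr l * (\<Prod>j<n. v i (zs ! j))"
proof -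
  have mem: "zs ! j \<in> set_pmf J" if "j < n" for j using that zs(1) subsetD[OF zs(2) nth_mem[of j zs]] by simp
  have "(\<Prod>j<n. w i (zs ! j)) = (\<Prod>j<n. 2 powr (ic (Suc i) (zs ! j) - ic i (zs ! j)) * v i (zs ! j))"
  proof (intro prod.cong refl)
    fix j assume "j \<in> {..<n}"
    then have z: "zs ! j \<in> set_pmf J" using mem by simp
    have "2 powr (ic (Suc i) (zs ! j) - ic i (zs ! j)) = w i (zs ! j) / v i (zs ! j)"
      unfolding log_ratio[OF z, symmetric] using w_pos[OF z, of i] v_pos[OF z, of i] by simp
    then show "w i (zs ! j) = 2 powr (ic (Suc i) (zs ! j) - ic i (zs ! j)) * v i (zs ! j)"
      using v_pos[OF z, of i] by simp
  qed
  also have "\<dots> = 2 powr (\<Sum>z\<leftarrow>zs. ic (Suc i) z - ic i z) * (\<Prod>j<n. v i (zs ! j))"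
    using zs(1) by (simp add: prod.distrib powr_sum sum_list_sum_nth atLeast0LessThan)
  also have "\<dots> \<le> 2 powr l * (\<Prod>j<n. v i (zs ! j))"
    using le by (intro mult_right_mono prod_nonneg) (simp_all add: less_imp_le[OF v_pos[OF mem]])
  finally show ?thesis .
qed

text \<open>In round \<open>i\<close> the log ratio of speaker and listener, summed over the
  coordinates, is at most \<open>n (\<Delta> i + \<delta>)\<close> with high probability. Hashing
  spends that many bits plus a constant, and the \<Delta> add up to the information
  complexity.\<close>

lemma cost_upper_bound:
  assumes \<epsilon>: "0 < \<epsilon>" "\<epsilon> < 1" and r: "information_complexity P \<pi> < r"
  shows "\<forall>\<^sub>F n in sequentially. ereal_of_enat (simulation_cost \<epsilon> (iid_inputs n P) (product_law n P \<pi>)) \<le> ereal (real n * r)"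
proof -
  \<comment> \<open>Room for one loss of \<theta> in each of the \<open>d\<close> rounds and one
    more for untypical inputs and the passage to finitely many paths. Half of each round's loss is
    the rounding error \<eta>, the other half collisions.\<close>
  define \<theta> where "\<theta> = \<epsilon> / (real d + 2)"
  have \<theta>: "0 < \<theta>" "\<theta> \<le> 1" using \<epsilon> by (auto simp: \<theta>_def field_simps)
  define \<eta> where "\<eta> = \<theta> / 2"
  \<comment> \<open>\<kappa> extra hash bits push the collision term
    \<open>2 * 2 powr l / 2 ^ k\<close> below \<theta>/2.\<close>
  obtain \<kappa> :: nat where \<kappa>: "(1/2) ^ \<kappa> < \<theta> / 4"
    using real_arch_pow_inv[of "\<theta> / 4" "1/2"] \<theta> by auto
  \<comment> \<open>The \<open>d\<close> slacks use half of the gap between \<open>r\<close> and the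
    information complexity; the other half pays for the \<open>d * (\<kappa> + 1)\<close> bits that
    do not grow with \<open>n\<close>.\<close>
  define \<delta> where "\<delta> = (r - information_complexity P \<pi>) / (2 * d)"
  have \<delta>: "\<delta> > 0" "d * \<delta> = (r - information_complexity P \<pi>) / 2"
    using r d_pos by (auto simp: \<delta>_def)
  define f where "f i z = ic (Suc i) z - ic i z" for i z
  define l where "l n i = real n * (\<Delta> i + \<delta>)" for n i
  define k where "k n i = nat \<lceil>l n i\<rceil> + \<kappa>" for n i
  define bad where "bad n i = {zs. \<bar>(\<Sum>z\<leftarrow>zs. f i z) - real n * \<Delta> i\<bar> \<ge> real n * \<delta>}" for n i
  have "(\<lambda>n. measure_pmf.prob (replicate_pmf n J) (bad n i)) \<longlonglongrightarrow> 0" for i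
    unfolding bad_def \<Delta>_def f_def
    by (rule weak_law_of_large_numbers) (use integrable_ic \<delta> in auto)
  then have "(\<lambda>n. \<Sum>i<d. measure_pmf.prob (replicate_pmf n J) (bad n i)) \<longlonglongrightarrow> (\<Sum>i<d. 0)"
    by (intro tendsto_sum)
  then have "\<forall>\<^sub>F n in sequentially. (\<Sum>i<d. measure_pmf.prob (replicate_pmf n J) (bad n i)) < \<eta>"
    using \<theta> by (intro order_tendstoD) (auto simp: \<eta>_def)
  moreover have "\<forall>\<^sub>F n in sequentially. real d * (real \<kappa> + 1) \<le> real n * (d * \<delta>)"
  proof -
    obtain n0 :: nat where n0: "real d * (real \<kappa> + 1) / (d * \<delta>) \<le> n0" using real_arch_simple by blast
    show ?thesis
      using eventually_ge_at_top[of n0]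
    proof eventually_elim
      case (elim n)
      then have "real d * (real \<kappa> + 1) / (d * \<delta>) \<le> n" using n0 by linarith
      then show ?case using \<delta>(1) d_pos by (simp add: field_simps)
    qed
  qed
  ultimately show ?thesis
  proof eventually_elim
    case (elim n)
    let ?Q = "nfold n J"
    have c_k: "2 * (2 powr l n i) / 2 ^ k n i \<le> \<theta> / 2" for i
    proof -
      have "2 powr l n i \<le> 2 powr real (nat \<lceil>l n i\<rceil>)" by (intro powr_mono) (auto simp: real_nat_ceiling_ge)
      then have "2 * (2 powr l n i) / 2 ^ k n i \<le> 2 * 2 ^ nat \<lceil>l n i\<rceil> / 2 ^ k n i"
        by (intro divide_right_mono mult_left_mono) (simp_all add: powr_realpow)
      also have "\<dots> = 2 * (1/2) ^ \<kappa>" by (simp add: k_def power_add power_one_over field_simps)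
      finally show ?thesis using \<kappa> by simp
    qed
    let ?w = "\<lambda>i (\<tau>, x, y). pmf (chosen (even i) (W1 i x (map (state_at i) \<tau>)) (W2 i y (map (state_at i) \<tau>))) (map (state_at (Suc i)) \<tau>)"
    let ?v = "\<lambda>i (\<tau>, x, y). pmf (chosen (even i) (W2 i y (map (state_at i) \<tau>)) (W1 i x (map (state_at i) \<tau>))) (map (state_at (Suc i)) \<tau>)"
    have wv: "?w i (unzip3 zs) = (\<Prod>j<n. w i (zs ! j))" "?v i (unzip3 zs) = (\<Prod>j<n. v i (zs ! j))" if "length zs = n" for i zs
    proof -
      obtain \<tau>s xs ys where u: "unzip3 zs = (\<tau>s, xs, ys)" by (metis prod.exhaust)
      show "?w i (unzip3 zs) = (\<Prod>j<n. w i (zs ! j))" "?v i (unzip3 zs) = (\<Prod>j<n. v i (zs ! j))"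
        unfolding u prod.case by (rule pmf_W[OF that u])+
    qed
    have good: "measure_pmf.prob ?Q {z. \<forall>i<d. ?w i z \<le> 2 powr l n i * ?v i z} \<ge> 1 - \<eta>"
    proof -
      have "measure_pmf.prob (replicate_pmf n J) (\<Union>i<d. bad n i) \<le> (\<Sum>i<d. measure_pmf.prob (replicate_pmf n J) (bad n i))"
        by (intro measure_pmf.finite_measure_subadditive_finite) auto
      then have "1 - \<eta> \<le> 1 - measure_pmf.prob (replicate_pmf n J) (\<Union>i<d. bad n i)" using elim by linarith
      also have "\<dots> = measure_pmf.prob (replicate_pmf n J) (- (\<Union>i<d. bad n i))"
        by (simp add: measure_pmf.prob_compl[symmetric] Compl_eq_Diff_UNIV)
      also have "\<dots> \<le> measure_pmf.prob (replicate_pmf n J) (unzip3 -` {z. \<forall>i<d. ?w i z \<le> 2 powr l n i * ?v i z})"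
      proof (rule prob_mono_support)
        fix zs assume zs: "zs \<in> set_pmf (replicate_pmf n J)" "zs \<in> - (\<Union>i<d. bad n i)"
        then have len: "length zs = n" "set zs \<subseteq> set_pmf J" by (auto simp: set_replicate_pmf)
        have "?w i (unzip3 zs) \<le> 2 powr l n i * ?v i (unzip3 zs)" if "i < d" for i
          unfolding wv[OF len(1)]
        proof (rule typical_ratio[OF len])
          have "zs \<notin> bad n i" using zs(2) that by auto
          then show "(\<Sum>z\<leftarrow>zs. ic (Suc i) z - ic i z) \<le> l n i"
            by (auto simp: bad_def f_def l_def algebra_simps)
        qed
        then show "zs \<in> unzip3 -` {z. \<forall>i<d. ?w i z \<le> 2 powr l n i * ?v i z}" by simp
      qed
      finally show ?thesis by (simp add: nfold_def)
    qed
    have "\<exists>\<sigma> :: ('x list, 'y list, real, real, real) protocol. is_simulation \<epsilon> (inputs_law ?Q) (measure_pmf ?Q) \<sigma> \<and>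
      protocol_length (inputs_law ?Q) \<sigma> \<le> enat (\<Sum>i<d. k n i)"
    proof (rule one_shot_simulation[where st = "\<lambda>i. map (state_at i)" and ?W1.0 = W1 and ?W2.0 = W2
          and ?s0.0 = "replicate n s_init" and out = "map fst" and \<eta> = \<eta> and \<theta> = \<theta> and c = "\<lambda>i. 2 powr l n i" and Q = ?Q])
      show "d > 0" by (rule d_pos)
    next
      fix \<tau>s xs ys assume "(\<tau>s, xs, ys) \<in> set_pmf ?Q"
      then obtain zs where zs: "length zs = n" "set zs \<subseteq> set_pmf J" "unzip3 zs = (\<tau>s, xs, ys)"
        by (auto simp: set_nfold)
      have \<tau>s: "\<tau>s = map fst zs" using zs(3) by (simp add: unzip3_def)
      have mem: "zs ! j \<in> set_pmf J" if "j < n" for j using that zs(1) subsetD[OF zs(2) nth_mem[of j zs]] by simp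
      show "map (state_at 0) \<tau>s = replicate n s_init"
      proof (rule nth_equalityI)
        fix j assume "j < length (map (state_at 0) \<tau>s)"
        then have "j < n" using zs(1) by (simp add: \<tau>s)
        then show "map (state_at 0) \<tau>s ! j = replicate n s_init ! j"
          using state_at_0[of "fst (zs ! j)" "fst (snd (zs ! j))" "snd (snd (zs ! j))"] mem zs(1) by (simp add: \<tau>s)
      qed (simp add: \<tau>s zs(1))
      show "map fst (map (state_at d) \<tau>s) = \<tau>s"
      proof (rule nth_equalityI)
        fix j assume "j < length (map fst (map (state_at d) \<tau>s))"
        then have "j < n" using zs(1) by (simp add: \<tau>s)
        then show "map fst (map (state_at d) \<tau>s) ! j = \<tau>s ! j"
          using support_J(2)[of "fst (zs ! j)" "fst (snd (zs ! j))" "snd (snd (zs ! j))"] mem zs(1) by (simp add: \<tau>s state_at_def)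
      qed simp
      have "pmf ?Q (\<tau>s, xs, ys) = (\<Prod>j<n. pmf P (snd (zs ! j)) * (\<Prod>i<d. w i (zs ! j)))"
        unfolding zs(3)[symmetric] pmf_nfold[OF zs(1)]
      proof (intro prod.cong refl)
        fix j assume "j \<in> {..<n}"
        then show "pmf J (zs ! j) = pmf P (snd (zs ! j)) * (\<Prod>i<d. w i (zs ! j))"
          using pmf_J_prod[of "fst (zs ! j)" "fst (snd (zs ! j))" "snd (snd (zs ! j))"] mem by simp
      qed
      also have "\<dots> = pmf (inputs_law ?Q) (xs, ys) * (\<Prod>i<d. \<Prod>j<n. w i (zs ! j))"
        unfolding prod.distrib pmf_nfold_marginals(1)[OF zs(1,3)] inputs_law_J
        by (subst prod.swap) simp
      also have "(\<Prod>i<d. \<Prod>j<n. w i (zs ! j)) = (\<Prod>i<d. ?w i (\<tau>s, xs, ys))"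
        using wv(1)[OF zs(1)] by (simp only: zs(3))
      finally show "pmf ?Q (\<tau>s, xs, ys) = pmf (inputs_law ?Q) (xs, ys) * (\<Prod>i<d. ?w i (\<tau>s, xs, ys))" .
    next
      show "\<eta> + 2 * 2 powr l n i / 2 ^ k n i \<le> \<theta>" for i using c_k[of i] by (simp add: \<eta>_def)
      show "\<theta> \<le> 1" by (rule \<theta>)
      show "\<eta> > 0" using \<theta> by (simp add: \<eta>_def)
      show "2 powr l n i \<ge> 0" for i by simp
      \<comment> \<open>Bernoulli's inequality for \<open>d + 1\<close> factors; the last one is
        \<open>1 - 2 \<eta> = 1 - \<theta>\<close>.\<close>
      have "1 - \<epsilon> \<le> 1 - real (Suc d) * \<theta>"
        using \<epsilon> by (simp add: \<theta>_def field_simps)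
      also have "\<dots> \<le> (1 - \<theta>) ^ Suc d"
        using Bernoulli_inequality[of "- \<theta>" "Suc d"] \<theta> by simp
      also have "\<dots> = (1 - \<theta>) ^ d * (1 - \<theta>)" by simp
      also have "\<dots> \<le> (1 - \<theta>) ^ d * (measure_pmf.prob ?Q {z. \<forall>i<d. ?w i z \<le> 2 powr l n i * ?v i z} - \<eta>)"
        using good \<theta> by (intro mult_left_mono) (auto simp: \<eta>_def)
      finally show "1 - (1 - \<theta>) ^ d * (measure_pmf.prob ?Q {z. \<forall>i<d. ?w i z \<le> 2 powr l n i * ?v i z} - \<eta>) \<le> \<epsilon>" by simp
    qed
    then obtain \<sigma> :: "('x list, 'y list, real, real, real) protocol" where
      \<sigma>: "is_simulation \<epsilon> (inputs_law ?Q) (measure_pmf ?Q) \<sigma>" "protocol_length (inputs_law ?Q) \<sigma> \<le> enat (\<Sum>i<d. k n i)" by blast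
    have "simulation_cost \<epsilon> (iid_inputs n P) (product_law n P \<pi>) \<le> protocol_length (inputs_law ?Q) \<sigma>"
      unfolding cost_eq unfolding simulation_cost_def using \<sigma>(1) by (intro INF_lower) simp
    also note \<sigma>(2)
    finally have "ereal_of_enat (simulation_cost \<epsilon> (iid_inputs n P) (product_law n P \<pi>)) \<le> ereal (\<Sum>i<d. real (k n i))"
      by (metis ereal_of_enat_le_iff ereal_of_enat_simps(1) of_nat_sum)
    also have "(\<Sum>i<d. real (k n i)) \<le> (\<Sum>i<d. l n i + (real \<kappa> + 1))"
    proof (rule sum_mono)
      fix i
      \<comment> \<open>The sign matters: at negative arguments \<open>nat\<close> would round up by
        more than 1.\<close>
      have "l n i \<ge> 0" using \<Delta>_nonneg[of i] \<delta>(1) by (simp add: l_def)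
      then have "real (nat \<lceil>l n i\<rceil>) \<le> l n i + 1" by linarith
      then show "real (k n i) \<le> l n i + (real \<kappa> + 1)" by (simp add: k_def)
    qed
    also have "\<dots> = real n * (information_complexity P \<pi> + d * \<delta>) + d * (real \<kappa> + 1)"
      unfolding l_def by (simp add: sum.distrib sum_distrib_left[symmetric] sum_\<Delta> algebra_simps)
    also have "\<dots> \<le> real n * (information_complexity P \<pi> + d * \<delta>) + real n * (d * \<delta>)" using elim by simp
    also have "\<dots> = real n * (information_complexity P \<pi> + (d * \<delta> + d * \<delta>))"
      by (simp only: distrib_left)
    also have "information_complexity P \<pi> + (d * \<delta> + d * \<delta>) = r" by (simp add: \<delta>(2))
    finally show ?case by simp
  qed
qed

lemma cost_rate:
  assumes \<epsilon>: "0 < \<epsilon>" "\<epsilon> < 1"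
  shows "(\<lambda>n. ereal_of_enat (simulation_cost \<epsilon> (iid_inputs n P) (product_law n P \<pi>)) / ereal (real n))
           \<longlonglongrightarrow> ereal (information_complexity P \<pi>)"
proof (rule order_tendstoI)
  fix a assume "a < ereal (information_complexity P \<pi>)"
  then obtain r where r: "a < ereal r" "r < information_complexity P \<pi>"
    using ereal_dense2[of a "ereal (information_complexity P \<pi>)"] by auto
  show "\<forall>\<^sub>F n in sequentially. a < ereal_of_enat (simulation_cost \<epsilon> (iid_inputs n P) (product_law n P \<pi>)) / ereal (real n)"
    using cost_lower_bound[OF \<epsilon>(2) r(2)] eventually_gt_at_top[of 0]
  proof eventually_elim
    case (elim n)
    then have "ereal r \<le> ereal_of_enat (simulation_cost \<epsilon> (iid_inputs n P) (product_law n P \<pi>)) / ereal (real n)"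
      by (subst ereal_le_divide_pos) auto
    then show ?case using r(1) by (rule less_le_trans[rotated])
  qed
next
  fix a assume "ereal (information_complexity P \<pi>) < a"
  then obtain r where r: "information_complexity P \<pi> < r" "ereal r < a"
    using ereal_dense2[of "ereal (information_complexity P \<pi>)" a] by auto
  show "\<forall>\<^sub>F n in sequentially. ereal_of_enat (simulation_cost \<epsilon> (iid_inputs n P) (product_law n P \<pi>)) / ereal (real n) < a"
    using cost_upper_bound[OF \<epsilon> r(1)] eventually_gt_at_top[of 0]
  proof eventually_elim
    case (elim n)
    then have "ereal_of_enat (simulation_cost \<epsilon> (iid_inputs n P) (product_law n P \<pi>)) / ereal (real n) \<le> ereal r"
      by (subst ereal_divide_le_pos) auto
    then show ?case using r(2) by (rule le_less_trans)
  qed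
qed

end

theorem corollary4:
  fixes P :: "('x::finite \<times> 'y::finite) pmf"
    and \<pi> :: "('x, 'y, 'a, 'b, 'u) protocol"
    and \<epsilon> :: real
  assumes "interactive_protocol P \<pi>"
    and "private_coin \<pi>"
    and "bounded_rounds P \<pi>"
    and "0 < \<epsilon>" and "\<epsilon> < 1"
  shows "(\<lambda>n. ereal_of_enat (simulation_cost \<epsilon> (iid_inputs n P) (product_law n P \<pi>)) / ereal (real n))
           \<longlonglongrightarrow> ereal (information_complexity P \<pi>)"
proof -
  obtain c where c: "AE u in public_rand \<pi>. u = c" using assms(2) by (auto simp: private_coin_def)
  obtain d where d: "AE \<omega> in execution_space P \<pi>. terminates \<pi> \<omega> \<and> length (transcript_of \<pi> \<omega>) \<le> d"
    using assms(3) by (auto simp: bounded_rounds_def)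
  have "AE \<omega> in execution_space P \<pi>. length (transcript_of \<pi> \<omega>) \<le> d" using d by eventually_elim simp
  then interpret private_coin_protocol P \<pi> c d using assms(1) c by unfold_locales
  show ?thesis by (rule cost_rate[OF assms(4,5)])
qed

end
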